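(* Let $(M,\omega)$ be the $4$-dimensional compact connected symplectic manifold constructed in the context and let $\Delta\subset\mathbb{R}^2$ be the octagon with vertices $(0,2),(0,1),(1,0),(2,0),(3,1),(3,2),(2,3),(1,3)$. Then $F=(J,H):(M,\omega)\to\mathbb{R}^2$ given by $$J([z_1,\ldots,z_8])=\tfrac12|z_1|^2,\qquad H([z_1,\ldots,z_8])=\tfrac12|z_3|^2$$ is a momentum map of an effective Hamiltonian $2$-torus action satisfying $F(M)=\Delta$. Thus, in particular, $F$ has precisely eight elliptic-elliptic singular points.
   Context: Construction of $(M,\omega)$. On $\mathbb{C}^8$ with coordinates $z_k=x_k+iy_k$ take the symplectic form $\omega_{st}=-\frac{i}{2}\sum_{k=1}^8 dz_k\wedge d\bar z_k$. Let $W\subset\mathbb{C}^8$ be the set of points satisfying (A) $|z_1|^2+|z_5|^2=6$, (B) $|z_2|^2+|z_5|^2+|z_7|^2=10$, (C) $|z_3|^2+|z_7|^2=6$, (D) $|z_4|^2-|z_5|^2+|z_7|^2=4$, (E) $|z_5|^2-|z_6|^2+|z_7|^2=2$, (F) $|z_5|^2-|z_7|^2+|z_8|^2=4$. The torus $N\simeq\mathbb{T}^6=(\mathbb{R}/2\pi\mathbb{Z})^6$ acts on $\mathbb{C}^8$ by $$(t,z)\mapsto(e^{it_1}z_1,e^{it_2}z_2,e^{it_3}z_3,e^{it_4}z_4,e^{i(t_1+t_2-t_4-t_5+t_6)}z_5,e^{it_5}z_6,e^{i(t_2+t_3+t_4-t_5-t_6)}z_7,e^{it_6}z_8).$$ $W$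 is a regular level set of a momentum map of this action, $N$ acts freely on $W$, and $M:=W/N$ with quotient map $\tau:W\to M$ carries the unique symplectic form $\omega$ with $\tau^*\omega=\kappa^*\omega_{st}$, where $\kappa:W\hookrightarrow\mathbb{C}^8$ is the inclusion. Points of $M$ are written $[z]=[z_1,\dots,z_8]$. Conventions. The Hamiltonian vector field of $f$ is defined by $\omega(\mathcal{X}^f,\cdot)=df$; circles are $\mathbb{R}/2\pi\mathbb{Z}$. For a completely integrable system $f=(f_1,f_2)$ on a $4$-dimensional symplectic manifold (Poisson commuting components with Hamiltonian vector fields linearly independent almost everywhere), a point is singular if $\mathcal{X}^{f_1},\mathcal{X}^{f_2}$ are linearly dependent there; a fixed point is a singular point of rank $0$. A fixed point $p$ is nondegenerate iff the Hessians $d^2f_1(p),d^2f_2(p)$ are linearly independent and some linear combination of $\omega_p^{-1}d^2f_1(p)$ and $\omega_p^{-1}d^2f_2(p)$ has four distinct eigenvalues; it is elliptic-elliptic if those eigenvalues are $\pm i\alpha,\pm i\beta$ with $\alpha,\beta\in\mathbb{R}\setminus\{0\}$, $\alpha\ne\beta$. *)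

theory Defs
  imports "HOL-Analysis.Analysis"
begin

section \<open>Smooth maps between Euclidean spaces\<close>

definition dir_deriv ::
    "('a::real_normed_vector \<Rightarrow> 'b::real_normed_vector) \<Rightarrow> 'a \<Rightarrow> 'a \<Rightarrow> 'b" where
  "dir_deriv f v x = frechet_derivative f (at x) v"

text \<open>Meant for open \<open>S\<close> in a finite-dimensional space, where this is the usual class of
  \<open>k\<close> times continuously differentiable maps.\<close>

primrec Ck_on ::
    "nat \<Rightarrow> 'a set \<Rightarrow> ('a::real_normed_vector \<Rightarrow> 'b::real_normed_vector) \<Rightarrow> bool" where
  "Ck_on 0 S f \<longleftrightarrow> continuous_on S f"
| "Ck_on (Suc k) S f \<longleftrightarrow>
     (\<forall>x\<in>S. f differentiable (at x)) \<and> (\<forall>v. Ck_on k S (dir_deriv f v))"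

text \<open>On a set that need not be open (such as a submanifold), a map is smooth if it locally
  extends to a smooth map of the ambient space.\<close>

definition smooth_on :: "'a set \<Rightarrow> ('a::real_normed_vector \<Rightarrow> 'b::real_normed_vector) \<Rightarrow> bool" where
  "smooth_on S f \<longleftrightarrow>
     (\<forall>x\<in>S. \<exists>V g. open V \<and> x \<in> V \<and> (\<forall>k. Ck_on k V g) \<and> (\<forall>y\<in>S \<inter> V. g y = f y))"

definition curve_through :: "'a::real_normed_vector set \<Rightarrow> 'a \<Rightarrow> (real \<Rightarrow> 'a) \<Rightarrow> bool" where
  "curve_through S w \<gamma> \<longleftrightarrow>
     \<gamma> 0 = w \<and> (\<exists>e>0. smooth_on {-e<..<e} \<gamma> \<and> \<gamma> ` {-e<..<e} \<subseteq> S)"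

definition velocity :: "(real \<Rightarrow> 'a::real_normed_vector) \<Rightarrow> 'a" where
  "velocity \<gamma> = vector_derivative \<gamma> (at 0)"

section \<open>Four-dimensional manifolds with a two-form\<close>

text \<open>A chart is a pair of its domain and the coordinate map; values of the coordinate map
  outside the domain are irrelevant.  The two-form is given by its coordinate expressions:
  \<open>form S c p u v\<close> is \<open>\<omega>\<^sub>p\<close> on the tangent vectors at \<open>p\<close> whose coordinates in
  the chart \<open>c\<close> are \<open>u\<close> and \<open>v\<close>.

  The notions below do not depend on the chart used at a point, so they are stated with some chart
  around each point; in particular none of them can hold for want of charts.\<close>

type_synonym 'p chart = "'p set \<times> ('p \<Rightarrow> real^4)"

record 'p manifold_with_form =
  points :: "'p set"
  charts :: "'p chart set"
  form :: "'p chart \<Rightarrow> 'p \<Rightarrow> real^4 \<Rightarrow> real^4 \<Rightarrow> real"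

definition chart_at :: "'p manifold_with_form \<Rightarrow> 'p \<Rightarrow> 'p chart \<Rightarrow> bool" where
  "chart_at S p c \<longleftrightarrow> c \<in> charts S \<and> p \<in> fst c"

definition in_chart :: "'p chart \<Rightarrow> ('p \<Rightarrow> 'b) \<Rightarrow> real^4 \<Rightarrow> 'b" where
  "in_chart c f = f \<circ> inv_into (fst c) (snd c)"

definition smooth_fun :: "'p manifold_with_form \<Rightarrow> ('p \<Rightarrow> 'b::real_normed_vector) \<Rightarrow> bool" where
  "smooth_fun S f \<longleftrightarrow>
     (\<forall>p\<in>points S. \<exists>c. chart_at S p c \<and> smooth_on (snd c ` fst c) (in_chart c f))"

definition differential :: "'p chart \<Rightarrow> ('p \<Rightarrow> real) \<Rightarrow> 'p \<Rightarrow> real^4 \<Rightarrow> real" where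
  "differential c f p v = dir_deriv (in_chart c f) v (snd c p)"

text \<open>Only meaningful (chart-independent) at critical points of \<open>f\<close>.\<close>

definition hessian :: "'p chart \<Rightarrow> ('p \<Rightarrow> real) \<Rightarrow> 'p \<Rightarrow> real^4^4" where
  "hessian c f p =
     (\<chi> i j. dir_deriv (dir_deriv (in_chart c f) (axis j 1)) (axis i 1) (snd c p))"

definition form_matrix :: "'p manifold_with_form \<Rightarrow> 'p chart \<Rightarrow> 'p \<Rightarrow> real^4^4" where
  "form_matrix S c p = (\<chi> i j. form S c p (axis i 1) (axis j 1))"

definition null_subset :: "'p manifold_with_form \<Rightarrow> 'p set \<Rightarrow> bool" where
  "null_subset S A \<longleftrightarrow> (\<forall>p\<in>points S. \<exists>c. chart_at S p c \<and> negligible (snd c ` (A \<inter> fst c)))"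

section \<open>Integrable systems and elliptic-elliptic points\<close>

definition ham_vf :: "'p manifold_with_form \<Rightarrow> 'p chart \<Rightarrow> ('p \<Rightarrow> real) \<Rightarrow> 'p \<Rightarrow> real^4" where
  "ham_vf S c f p = (THE X. \<forall>v. form S c p X v = differential c f p v)"

definition system_rank ::
    "'p manifold_with_form \<Rightarrow> 'p chart \<Rightarrow> ('p \<Rightarrow> real) \<Rightarrow> ('p \<Rightarrow> real) \<Rightarrow> 'p \<Rightarrow> nat" where
  "system_rank S c f1 f2 p = dim {ham_vf S c f1 p, ham_vf S c f2 p}"

definition singular_point ::
    "'p manifold_with_form \<Rightarrow> ('p \<Rightarrow> real) \<Rightarrow> ('p \<Rightarrow> real) \<Rightarrow> 'p \<Rightarrow> bool" where
  "singular_point S f1 f2 p \<longleftrightarrow> (\<exists>c. chart_at S p c \<and> system_rank S c f1 f2 p < 2)"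

definition poisson_commute ::
    "'p manifold_with_form \<Rightarrow> ('p \<Rightarrow> real) \<Rightarrow> ('p \<Rightarrow> real) \<Rightarrow> bool" where
  "poisson_commute S f1 f2 \<longleftrightarrow>
     (\<forall>p\<in>points S. \<exists>c. chart_at S p c \<and> form S c p (ham_vf S c f1 p) (ham_vf S c f2 p) = 0)"

definition completely_integrable ::
    "'p manifold_with_form \<Rightarrow> ('p \<Rightarrow> real) \<Rightarrow> ('p \<Rightarrow> real) \<Rightarrow> bool" where
  "completely_integrable S f1 f2 \<longleftrightarrow>
     smooth_fun S f1 \<and> smooth_fun S f2 \<and> poisson_commute S f1 f2 \<and>
     null_subset S {p \<in> points S. singular_point S f1 f2 p}"

definition complex_eigenvalues :: "real^4^4 \<Rightarrow> complex set" where
  "complex_eigenvalues A =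
     {l. \<exists>v::complex^4. v \<noteq> 0 \<and> (\<chi> i j. complex_of_real (A $ i $ j)) *v v = l *s v}"

text \<open>The endomorphism \<open>a \<omega>\<^sub>p\<^sup>-\<^sup>1 d\<^sup>2f\<^sub>1(p) + b \<omega>\<^sub>p\<^sup>-\<^sup>1 d\<^sup>2f\<^sub>2(p)\<close>.\<close>

definition linearization ::
    "'p manifold_with_form \<Rightarrow> 'p chart \<Rightarrow> ('p \<Rightarrow> real) \<Rightarrow> ('p \<Rightarrow> real) \<Rightarrow> 'p
      \<Rightarrow> real \<Rightarrow> real \<Rightarrow> real^4^4" where
  "linearization S c f1 f2 p a b =
     a *\<^sub>R (matrix_inv (form_matrix S c p) ** hessian c f1 p) +
     b *\<^sub>R (matrix_inv (form_matrix S c p) ** hessian c f2 p)"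

text \<open>A nondegenerate fixed point whose four distinct eigenvalues are \<open>\<plusminus>i\<alpha>\<close>,
  \<open>\<plusminus>i\<beta>\<close>.\<close>

definition elliptic_elliptic ::
    "'p manifold_with_form \<Rightarrow> ('p \<Rightarrow> real) \<Rightarrow> ('p \<Rightarrow> real) \<Rightarrow> 'p \<Rightarrow> bool" where
  "elliptic_elliptic S f1 f2 p \<longleftrightarrow>
     (\<exists>c. chart_at S p c \<and>
        system_rank S c f1 f2 p = 0 \<and>
        (\<forall>a b. a *\<^sub>R hessian c f1 p + b *\<^sub>R hessian c f2 p = 0 \<longrightarrow> a = 0 \<and> b = 0) \<and>
        (\<exists>a b. card (complex_eigenvalues (linearization S c f1 f2 p a b)) = 4 \<and>
           (\<exists>\<alpha> \<beta>::real. \<alpha> \<noteq> 0 \<and> \<beta> \<noteq> 0 \<and> \<alpha> \<noteq> \<beta> \<and>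
              complex_eigenvalues (linearization S c f1 f2 p a b) =
                {\<i> * of_real \<alpha>, - \<i> * of_real \<alpha>, \<i> * of_real \<beta>, - \<i> * of_real \<beta>})))"

section \<open>Hamiltonian actions of the two-torus\<close>

text \<open>An action of \<open>(\<real>/2\<pi>\<int>)\<^sup>2\<close> is an action of \<open>\<real>\<^sup>2\<close> that is trivial on
  \<open>2\<pi>\<int>\<^sup>2\<close>; the Lie algebra is \<open>\<real>\<^sup>2\<close>, identified with its dual by the inner product.\<close>

definition torus2_action :: "'p manifold_with_form \<Rightarrow> (real \<times> real \<Rightarrow> 'p \<Rightarrow> 'p) \<Rightarrow> bool" where
  "torus2_action S \<rho> \<longleftrightarrow>
     (\<forall>p\<in>points S. (\<forall>t. \<rho> t p \<in> points S) \<and>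
        (\<forall>s t. \<rho> (s + t) p = \<rho> s (\<rho> t p)) \<and>
        (\<forall>m n::int. \<rho> (2 * pi * of_int m, 2 * pi * of_int n) p = p))"

definition smooth_action :: "'p manifold_with_form \<Rightarrow> (real \<times> real \<Rightarrow> 'p \<Rightarrow> 'p) \<Rightarrow> bool" where
  "smooth_action S \<rho> \<longleftrightarrow>
     (\<forall>p\<in>points S. \<forall>t. \<exists>c d T. chart_at S p c \<and> chart_at S (\<rho> t p) d \<and> open T \<and> t \<in> T \<and>
        (\<forall>s\<in>T. \<forall>q\<in>fst c. \<rho> s q \<in> fst d) \<and>
        smooth_on (T \<times> snd c ` fst c) (\<lambda>(s, x). in_chart c (\<lambda>q. snd d (\<rho> s q)) x))"

definition preserves_form :: "'p manifold_with_form \<Rightarrow> ('p \<Rightarrow> 'p) \<Rightarrow> bool" where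
  "preserves_form S g \<longleftrightarrow>
     (\<forall>p\<in>points S. \<exists>c d. chart_at S p c \<and> chart_at S (g p) d \<and>
        (\<forall>u v. form S d (g p)
                 (dir_deriv (in_chart c (snd d \<circ> g)) u (snd c p))
                 (dir_deriv (in_chart c (snd d \<circ> g)) v (snd c p)) = form S c p u v))"

definition effective_action :: "'p manifold_with_form \<Rightarrow> (real \<times> real \<Rightarrow> 'p \<Rightarrow> 'p) \<Rightarrow> bool" where
  "effective_action S \<rho> \<longleftrightarrow>
     (\<forall>t. (\<forall>p\<in>points S. \<rho> t p = p) \<longrightarrow>
        (\<exists>m n::int. t = (2 * pi * of_int m, 2 * pi * of_int n)))"

text \<open>The last condition says that the fundamental vector field \<open>X\<close> of \<open>\<xi>\<close> is the
  Hamiltonian vector field of \<open>\<langle>F, \<xi>\<rangle>\<close>, with the sign convention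
  \<open>\<omega>(X, -) = d\<langle>F, \<xi>\<rangle>\<close>.  As the torus is abelian, equivariance of \<open>F\<close> is invariance.\<close>

definition momentum_map ::
    "'p manifold_with_form \<Rightarrow> (real \<times> real \<Rightarrow> 'p \<Rightarrow> 'p) \<Rightarrow> ('p \<Rightarrow> real \<times> real) \<Rightarrow> bool" where
  "momentum_map S \<rho> F \<longleftrightarrow>
     smooth_fun S F \<and>
     (\<forall>p\<in>points S. \<forall>t. F (\<rho> t p) = F p) \<and>
     (\<forall>p\<in>points S. \<forall>\<xi>. \<exists>c X. chart_at S p c \<and>
        ((\<lambda>s. snd c (\<rho> (s *\<^sub>R \<xi>) p)) has_vector_derivative X) (at 0) \<and>
        (\<forall>v. form S c p X v = differential c (\<lambda>q. F q \<bullet> \<xi>) p v))"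

definition hamiltonian_torus2_action ::
    "'p manifold_with_form \<Rightarrow> (real \<times> real \<Rightarrow> 'p \<Rightarrow> 'p) \<Rightarrow> ('p \<Rightarrow> real \<times> real) \<Rightarrow> bool" where
  "hamiltonian_torus2_action S \<rho> F \<longleftrightarrow>
     torus2_action S \<rho> \<and> smooth_action S \<rho> \<and> (\<forall>t. preserves_form S (\<rho> t)) \<and> momentum_map S \<rho> F"

section \<open>The symplectic quotient\<close>

text \<open>Coordinates are indexed by the type \<open>8\<close>, in which the numeral \<open>8\<close> denotes the
  same index as \<open>0\<close>; the indices \<open>1, \<dots>, 8\<close> are pairwise distinct.  Likewise for \<open>6\<close>.\<close>

definition W :: "(complex^8) set" where
  "W = {z.
     (cmod (z$1))\<^sup>2 + (cmod (z$5))\<^sup>2 = 6 \<and>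
     (cmod (z$2))\<^sup>2 + (cmod (z$5))\<^sup>2 + (cmod (z$7))\<^sup>2 = 10 \<and>
     (cmod (z$3))\<^sup>2 + (cmod (z$7))\<^sup>2 = 6 \<and>
     (cmod (z$4))\<^sup>2 - (cmod (z$5))\<^sup>2 + (cmod (z$7))\<^sup>2 = 4 \<and>
     (cmod (z$5))\<^sup>2 - (cmod (z$6))\<^sup>2 + (cmod (z$7))\<^sup>2 = 2 \<and>
     (cmod (z$5))\<^sup>2 - (cmod (z$7))\<^sup>2 + (cmod (z$8))\<^sup>2 = 4}"

definition N_phase :: "real^6 \<Rightarrow> real^8" where
  "N_phase t = vector [t$1, t$2, t$3, t$4, t$1 + t$2 - t$4 - t$5 + t$6, t$5,
                       t$2 + t$3 + t$4 - t$5 - t$6, t$6]"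

lemma N_phase_nth [simp]:
  "N_phase t $ 1 = t$1" "N_phase t $ 2 = t$2" "N_phase t $ 3 = t$3" "N_phase t $ 4 = t$4"
  "N_phase t $ 5 = t$1 + t$2 - t$4 - t$5 + t$6" "N_phase t $ 6 = t$5"
  "N_phase t $ 7 = t$2 + t$3 + t$4 - t$5 - t$6" "N_phase t $ 8 = t$6"
  by (simp_all add: N_phase_def vector_def)

definition N_act :: "real^6 \<Rightarrow> complex^8 \<Rightarrow> complex^8" where
  "N_act t z = (\<chi> k. exp (\<i> * of_real (N_phase t $ k)) * z $ k)"

text \<open>The quotient map: \<open>\<tau> z\<close> is the \<open>N\<close>-orbit \<open>[z]\<close>.\<close>

definition \<tau> :: "complex^8 \<Rightarrow> (complex^8) set" where
  "\<tau> z = range (\<lambda>t. N_act t z)"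

text \<open>\<open>-(i/2) \<Sum> dz\<^sub>k \<and> d\<zbar>\<^sub>k\<close> is real-valued, so taking the real part only
  changes the type.\<close>

definition \<omega>_st :: "complex^8 \<Rightarrow> complex^8 \<Rightarrow> real" where
  "\<omega>_st u v = Re (- (\<i> / 2) * (\<Sum>k\<in>UNIV. u$k * cnj (v$k) - v$k * cnj (u$k)))"

definition quotient_top :: "(complex^8) set topology" where
  "quotient_top = topology (\<lambda>U. U \<subseteq> \<tau> ` W \<and> openin (top_of_set W) {z\<in>W. \<tau> z \<in> U})"

lemma openin_quotient_top:
  "openin quotient_top U \<longleftrightarrow> U \<subseteq> \<tau> ` W \<and> openin (top_of_set W) {z\<in>W. \<tau> z \<in> U}"
proof -
  have "istopology (\<lambda>U. U \<subseteq> \<tau> ` W \<and> openin (top_of_set W) {z\<in>W. \<tau> z \<in> U})"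
    unfolding istopology_def
  proof safe
    fix A B assume "openin (top_of_set W) {z\<in>W. \<tau> z \<in> A}" "openin (top_of_set W) {z\<in>W. \<tau> z \<in> B}"
    then have "openin (top_of_set W) ({z\<in>W. \<tau> z \<in> A} \<inter> {z\<in>W. \<tau> z \<in> B})" by blast
    moreover have "{z\<in>W. \<tau> z \<in> A} \<inter> {z\<in>W. \<tau> z \<in> B} = {z\<in>W. \<tau> z \<in> A \<inter> B}" by auto
    ultimately show "openin (top_of_set W) {z\<in>W. \<tau> z \<in> A \<inter> B}" by simp
  next
    fix K x A assume "\<forall>A\<in>K. A \<subseteq> \<tau> ` W \<and> openin (top_of_set W) {z\<in>W. \<tau> z \<in> A}" "x \<in> A" "A \<in> K"
    then show "x \<in> \<tau> ` W" by blast
  next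
    fix K assume "\<forall>A\<in>K. A \<subseteq> \<tau> ` W \<and> openin (top_of_set W) {z\<in>W. \<tau> z \<in> A}"
    then have "openin (top_of_set W) (\<Union>A\<in>K. {z\<in>W. \<tau> z \<in> A})" by blast
    moreover have "(\<Union>A\<in>K. {z\<in>W. \<tau> z \<in> A}) = {z\<in>W. \<tau> z \<in> \<Union>K}" by auto
    ultimately show "openin (top_of_set W) {z\<in>W. \<tau> z \<in> \<Union>K}" by simp
  qed auto
  then show ?thesis unfolding quotient_top_def by (simp add: topology_inverse')
qed

text \<open>The maximal atlas of the smooth structure for which \<open>\<tau>\<close> is a submersion: a
  homeomorphism \<open>\<phi>\<close> from an open subset of the quotient onto an open subset of
  \<open>\<real>\<^sup>4\<close> is a chart iff \<open>\<phi> \<circ> \<tau>\<close> is smooth and the inverse of \<open>\<phi>\<close> lifts locally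
  to smooth maps into \<open>W\<close>.\<close>

definition quotient_charts :: "(complex^8) set chart set" where
  "quotient_charts = {(U, \<phi>).
     openin quotient_top U \<and> open (\<phi> ` U) \<and>
     homeomorphic_map (subtopology quotient_top U) (top_of_set (\<phi> ` U)) \<phi> \<and>
     smooth_on {z\<in>W. \<tau> z \<in> U} (\<phi> \<circ> \<tau>) \<and>
     (\<forall>x\<in>\<phi> ` U. \<exists>V \<sigma>. open V \<and> x \<in> V \<and> V \<subseteq> \<phi> ` U \<and> smooth_on V \<sigma> \<and>
        (\<forall>y\<in>V. \<sigma> y \<in> W \<and> \<tau> (\<sigma> y) = inv_into U \<phi> y))}"

text \<open>The form \<open>\<omega>\<close> determined by \<open>\<tau>\<^sup>*\<omega> = \<kappa>\<^sup>*\<omega>\<^sub>s\<^sub>t\<close>, in the chart \<open>c\<close>; tangent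
  vectors of \<open>W\<close> are velocities of curves in \<open>W\<close>.\<close>

definition quotient_form :: "(complex^8) set chart \<Rightarrow> (complex^8) set \<Rightarrow> real^4 \<Rightarrow> real^4 \<Rightarrow> real" where
  "quotient_form c p = (THE B. bilinear B \<and>
     (\<forall>w\<in>W. \<tau> w = p \<longrightarrow> (\<forall>\<gamma> \<delta>. curve_through W w \<gamma> \<and> curve_through W w \<delta> \<longrightarrow>
        B (velocity (snd c \<circ> \<tau> \<circ> \<gamma>)) (velocity (snd c \<circ> \<tau> \<circ> \<delta>)) =
        \<omega>_st (velocity \<gamma>) (velocity \<delta>))))"

definition M :: "(complex^8) set manifold_with_form" where
  "M = \<lparr>points = \<tau> ` W, charts = quotient_charts, form = quotient_form\<rparr>"

definition octagon :: "(real \<times> real) set" where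
  "octagon = convex hull {(0,2), (0,1), (1,0), (2,0), (3,1), (3,2), (2,3), (1,3)}"

end

theory Submission
  imports Defs
begin

text \<open>The manifold is the Delzant quotient of the octagon.  On \<open>W\<close> the numbers \<open>|z\<^sub>l|\<^sup>2 / 2\<close> are the edge
  functions \<open>n\<^sub>l \<bullet> (J, H) + \<lambda>\<^sub>l\<close>, where \<open>n\<^sub>l\<close> is the inward normal of the \<open>l\<close>-th edge
  (\<open>W_iff_halfplanes\<close>), and \<open>N\<close> consists of the rotations by angles \<open>\<theta>\<close> with
  \<open>\<Sum> \<theta>\<^sub>l n\<^sub>l = 0\<close> (\<open>mem_\<tau>_iff\<close>).  So a pair of values of \<open>(J, H)\<close> is attained iff all edge functions
  are nonnegative there, which describes the octagon (\<open>image_eq_octagon\<close>).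

  Everything else is read off in eight charts, one for each vertex.  Consecutive normals \<open>n\<^sub>k\<close>,
  \<open>n\<^sub>k\<^sub>+\<^sub>1\<close> have determinant 1.  Therefore an orbit on which only \<open>z\<^sub>k\<close> and \<open>z\<^sub>k\<^sub>+\<^sub>1\<close> may vanish
  has exactly one representative whose other coordinates are positive, and these are functions of
  \<open>|z\<^sub>k|\<^sup>2\<close> and \<open>|z\<^sub>k\<^sub>+\<^sub>1|\<^sup>2\<close>.  The two remaining coordinates \<open>(a, b)\<close> of this representative are
  a chart.  Real coordinates do not contribute to \<open>\<omega>\<^sub>s\<^sub>t\<close>, so \<open>\<omega>\<close> is the standard form of
  \<open>\<complex>\<^sup>2\<close> in this chart (\<open>form_vertex_chart\<close>); \<open>J\<close> and \<open>H\<close> are, up to constants, unimodular integer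
  combinations of \<open>|a|\<^sup>2 / 2\<close> and \<open>|b|\<^sup>2 / 2\<close>; and rotating \<open>z\<^sub>1\<close> and \<open>z\<^sub>3\<close> becomes the linear action
  of the two-torus on \<open>\<complex>\<^sup>2\<close> with the corresponding weights, whose momentum map is \<open>(J, H)\<close>.
  The two Hamiltonian vector fields are dependent only on the axes \<open>a = 0\<close> or \<open>b = 0\<close>, and both
  vanish only at the origin, which is elliptic-elliptic.  The origins of the eight charts are the
  eight fixed points.

  Singular points are defined by the existence of some chart of the maximal atlas.  To exclude
  further ones, the rank must not depend on the chart; this is \<open>system_rank_eq\<close>, which rests on the
  fact that transitions between an arbitrary chart and a vertex chart have inverse derivatives that
  intertwine the forms (\<open>chart_change\<close>).\<close>

section \<open>Smooth maps\<close>

lemma dir_deriv_eq: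
  "(f has_derivative f') (at x) \<Longrightarrow> dir_deriv f v x = f' v"
  by (simp add: dir_deriv_def flip: frechet_derivative_at)

lemma has_derivative_dir_deriv:
  "f differentiable (at x) \<Longrightarrow> (f has_derivative (\<lambda>v. dir_deriv f v x)) (at x)"
  by (simp add: dir_deriv_def[abs_def] frechet_derivative_works)

lemma has_derivative_cong_open:
  assumes "open S" "x \<in> S" "\<And>y. y \<in> S \<Longrightarrow> f y = g y"
  shows "(f has_derivative f') (at x) \<longleftrightarrow> (g has_derivative f') (at x)"
  using has_derivative_transform_within_open[OF _ assms(1,2), of f f' UNIV g]
    has_derivative_transform_within_open[OF _ assms(1,2), of g f' UNIV f] assms(3) by auto

lemma dir_deriv_cong_open:
  assumes "open S" "x \<in> S" "\<And>y. y \<in> S \<Longrightarrow> f y = g y"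
  shows "dir_deriv f v x = dir_deriv g v x"
  using has_derivative_cong_open[OF assms] by (simp add: dir_deriv_def frechet_derivative_def)

lemma Ck_on_cong:
  assumes "open S" "\<And>x. x \<in> S \<Longrightarrow> f x = g x"
  shows "Ck_on k S f \<longleftrightarrow> Ck_on k S g"
  using assms(2)
proof (induction k arbitrary: f g)
  case 0 then show ?case by (simp cong: continuous_on_cong)
next
  case (Suc k)
  have "Ck_on k S (dir_deriv f v) \<longleftrightarrow> Ck_on k S (dir_deriv g v)" for v
    using dir_deriv_cong_open[OF assms(1), of _ f g] Suc.prems by (intro Suc.IH) blast
  moreover have "f differentiable (at x) \<longleftrightarrow> g differentiable (at x)" if "x \<in> S" for x
    using has_derivative_cong_open[OF assms(1) that, of f g] Suc.prems
    unfolding differentiable_def by blast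
  ultimately show ?case by simp
qed

lemma Ck_on_subset: "Ck_on k S f \<Longrightarrow> T \<subseteq> S \<Longrightarrow> Ck_on k T f"
  by (induction k arbitrary: f) (auto intro: continuous_on_subset)

lemma Ck_on_Suc_imp: "Ck_on (Suc k) S f \<Longrightarrow> Ck_on k S f"
proof (induction k arbitrary: f)
  case 0
  then show ?case
    by (auto intro!: continuous_at_imp_continuous_on differentiable_imp_continuous_within)
qed auto

lemma Ck_on_const: "Ck_on k (S :: 'a::real_normed_vector set) (\<lambda>x. c)"
proof (induction k arbitrary: c)
  case (Suc k)
  have "dir_deriv (\<lambda>x. c) v = (\<lambda>x. 0)" for v :: 'a
    by (rule ext, rule dir_deriv_eq) simp
  then show ?case using Suc by simp
qed simp

lemma Ck_on_SucI:
  assumes "open S" "\<And>x. x \<in> S \<Longrightarrow> (f has_derivative f' x) (at x)"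
    and "\<And>v. Ck_on k S (\<lambda>x. f' x v)"
  shows "Ck_on (Suc k) S f"
proof -
  have "Ck_on k S (dir_deriv f v)" for v
    using assms(3)[of v] Ck_on_cong[OF assms(1), of "dir_deriv f v" "\<lambda>x. f' x v"]
      dir_deriv_eq[OF assms(2)] by blast
  then show ?thesis using assms(2) differentiable_def by fastforce
qed

lemma Ck_on_SucD:
  assumes "Ck_on (Suc k) S f"
  shows "\<And>x. x \<in> S \<Longrightarrow> (f has_derivative (\<lambda>v. dir_deriv f v x)) (at x)"
    and "Ck_on k S (dir_deriv f v)"
  using assms has_derivative_dir_deriv by auto

lemma Ck_on_bounded_linear:
  assumes "bounded_linear L" "open S" "Ck_on k S f"
  shows "Ck_on k S (\<lambda>x. L (f x))"
  using assms(3)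
proof (induction k arbitrary: f)
  case 0
  then show ?case
    using bounded_linear.continuous_on[OF assms(1)] by simp
next
  case (Suc k)
  show ?case
    by (rule Ck_on_SucI[OF assms(2) bounded_linear.has_derivative[OF assms(1) Ck_on_SucD(1)[OF Suc.prems]]])
      (auto intro: Suc.IH Ck_on_SucD(2)[OF Suc.prems])
qed

lemma Ck_on_add:
  assumes "open S" "Ck_on k S f" "Ck_on k S g"
  shows "Ck_on k S (\<lambda>x. f x + g x)"
  using assms(2,3)
proof (induction k arbitrary: f g)
  case 0 then show ?case by (simp add: continuous_on_add)
next
  case (Suc k)
  show ?case
    by (rule Ck_on_SucI[OF assms(1) has_derivative_add[OF Ck_on_SucD(1)[OF Suc.prems(1)]
       Ck_on_SucD(1)[OF Suc.prems(2)]]])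
      (auto intro: Suc.IH Ck_on_SucD(2)[OF Suc.prems(1)] Ck_on_SucD(2)[OF Suc.prems(2)])
qed

lemma Ck_on_sum:
  assumes "open S" "\<And>i. i \<in> I \<Longrightarrow> Ck_on k S (f i)"
  shows "Ck_on k S (\<lambda>x. \<Sum>i\<in>I. f i x)"
  using assms(2)
  by (induction I rule: infinite_finite_induct) (auto intro: Ck_on_const Ck_on_add[OF assms(1)])

lemma Ck_on_bounded_bilinear:
  assumes "bounded_bilinear prd" "open S" "Ck_on k S f" "Ck_on k S g"
  shows "Ck_on k S (\<lambda>x. prd (f x) (g x))"
  using assms(3,4)
proof (induction k arbitrary: f g)
  case 0 then show ?case by (simp add: bounded_bilinear.continuous_on[OF assms(1)])
next
  case (Suc k)
  show ?case
  proof (rule Ck_on_SucI[OF assms(2) bounded_bilinear.FDERIV[OF assms(1)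
          Ck_on_SucD(1)[OF Suc.prems(1)] Ck_on_SucD(1)[OF Suc.prems(2)]]])
    show "Ck_on k S (\<lambda>x. prd (f x) (dir_deriv g v x) + prd (dir_deriv f v x) (g x))" for v
      by (intro Ck_on_add assms(2) Suc.IH Ck_on_SucD(2)[OF Suc.prems(1)]
          Ck_on_SucD(2)[OF Suc.prems(2)] Ck_on_Suc_imp[OF Suc.prems(1)] Ck_on_Suc_imp[OF Suc.prems(2)])
  qed
qed

text \<open>The chain rule expresses \<open>D(g \<circ> f)\<close> through the partial derivatives of \<open>g\<close>
  along a basis; this is what makes the induction on the order of differentiability close up, and
  it is why the space in the middle is finite-dimensional.\<close>

lemma Ck_on_compose:
  fixes f :: "'a::real_normed_vector \<Rightarrow> 'b::euclidean_space"
    and g :: "'b \<Rightarrow> 'c::real_normed_vector"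
  assumes "open S" "open T" "Ck_on k S f" "Ck_on k T g" "f ` S \<subseteq> T"
  shows "Ck_on k S (\<lambda>x. g (f x))"
  using assms(3,4)
proof (induction k arbitrary: g)
  case 0
  then show ?case using assms(5) by (auto intro: continuous_on_compose2)
next
  case (Suc k)
  have gl: "(g has_derivative (\<lambda>v. \<Sum>b\<in>Basis. (v \<bullet> b) *\<^sub>R dir_deriv g b y)) (at y)"
    if "y \<in> T" for y
  proof -
    note d = Ck_on_SucD(1)[OF Suc.prems(2) that]
    interpret linear "\<lambda>v. dir_deriv g v y" using has_derivative_linear[OF d] .
    have "(\<Sum>b\<in>Basis. (v \<bullet> b) *\<^sub>R dir_deriv g b y) = dir_deriv g v y" for v
    proof -
      have "dir_deriv g (\<Sum>b\<in>Basis. (v \<bullet> b) *\<^sub>R b) y = (\<Sum>b\<in>Basis. (v \<bullet> b) *\<^sub>R dir_deriv g b y)"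
        by (simp add: sum scale)
      then show ?thesis by (simp add: euclidean_representation)
    qed
    then show ?thesis using d by (simp only:)
  qed
  have inT: "f x \<in> T" if "x \<in> S" for x using that assms(5) by auto
  show ?case
  proof (rule Ck_on_SucI[OF assms(1) has_derivative_compose[OF Ck_on_SucD(1)[OF Suc.prems(1)] gl[OF inT]]])
    fix v
    have "Ck_on k S (\<lambda>x. (dir_deriv f v x \<bullet> b) *\<^sub>R dir_deriv g b (f x))" for b
      by (intro Ck_on_bounded_bilinear[OF bounded_bilinear_scaleR assms(1)]
          Ck_on_bounded_linear[OF bounded_linear_inner_left assms(1)]
          Ck_on_SucD(2)[OF Suc.prems(1)] Suc.IH Ck_on_SucD(2)[OF Suc.prems(2)]
          Ck_on_Suc_imp[OF Suc.prems(1)])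
    then show "Ck_on k S (\<lambda>x. \<Sum>b\<in>Basis. (dir_deriv f v x \<bullet> b) *\<^sub>R dir_deriv g b (f x))"
      by (intro Ck_on_sum assms(1))
  qed auto
qed

lemma Ck_on_ident:
  assumes "open S" shows "Ck_on k S (\<lambda>x. x)"
proof (cases k)
  case (Suc m)
  then show ?thesis
    using Ck_on_SucI[OF assms, of "\<lambda>x. x" "\<lambda>x v. v" m] by (simp add: Ck_on_const)
qed auto

lemma Ck_on_inverse: "Ck_on k (- {0::'a::real_normed_field}) inverse"
proof (induction k)
  case 0 show ?case by (auto intro!: continuous_intros)
next
  case (Suc k)
  have op: "open (- {0::'a})" by auto
  show ?case
  proof (rule Ck_on_SucI[OF op])
    show "(inverse has_derivative (\<lambda>v. - (inverse x * v * inverse x))) (at x)" if "x \<in> - {0}" for x :: 'a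
      using Deriv.has_derivative_inverse[OF _ has_derivative_ident, of x UNIV] that by simp
    show "Ck_on k (- {0::'a}) (\<lambda>x. - (inverse x * v * inverse x))" for v
      by (intro Ck_on_bounded_linear[OF bounded_linear_minus[OF bounded_linear_ident] op]
         Ck_on_bounded_bilinear[OF bounded_bilinear_mult op] Suc Ck_on_const)
  qed
qed

lemma Ck_on_sqrt: "Ck_on k {0<..} sqrt"
proof (induction k)
  case 0 show ?case by (auto intro!: continuous_intros)
next
  case (Suc k)
  have op: "open {0::real<..}" by auto
  show ?case
  proof (rule Ck_on_SucI[OF op])
    show "(sqrt has_derivative (\<lambda>v. v * (1/2 * inverse (sqrt x)))) (at x)" if "x \<in> {0<..}" for x
    proof (rule has_derivative_eq_rhs)
      show "(sqrt has_derivative ((*) (inverse (sqrt x) / 2))) (at x)"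
        using DERIV_real_sqrt[of x] that by (simp add: has_field_derivative_def)
    qed auto
    show "Ck_on k {0<..} (\<lambda>x. v * (1/2 * inverse (sqrt x)))" for v
      by (intro Ck_on_bounded_bilinear[OF bounded_bilinear_mult op] Ck_on_const
        Ck_on_compose[OF op _ Suc Ck_on_inverse]) auto
  qed
qed

lemma Ck_on_cis: "Ck_on k UNIV cis"
proof (induction k)
  case 0 show ?case by (auto intro!: continuous_intros)
next
  case (Suc k)
  show ?case
  proof (rule Ck_on_SucI[OF open_UNIV])
    show "(cis has_derivative (\<lambda>v. v *\<^sub>R (\<i> * cis x))) (at x)" for x
      using has_derivative_cis[OF has_derivative_ident, of x UNIV] by simp
    show "Ck_on k UNIV (\<lambda>x. v *\<^sub>R (\<i> * cis x))" for v
      by (intro Ck_on_bounded_linear[OF bounded_linear_scaleR_right open_UNIV]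
        Ck_on_bounded_linear[OF bounded_linear_mult_right open_UNIV] Suc)
  qed
qed

lemma smooth_onE:
  assumes "smooth_on S f" "x \<in> S"
  obtains V g where "open V" "x \<in> V" "\<And>k. Ck_on k V g" "\<And>y. y \<in> S \<Longrightarrow> y \<in> V \<Longrightarrow> g y = f y"
  using assms unfolding smooth_on_def by (metis IntI)

lemma smooth_onI:
  assumes "open V" "S \<subseteq> V" "\<And>k. Ck_on k V f"
  shows "smooth_on S f"
  using assms unfolding smooth_on_def by blast

lemma smooth_on_subset:
  assumes "smooth_on S f" "T \<subseteq> S" shows "smooth_on T f"
  unfolding smooth_on_def
proof
  fix x assume "x \<in> T"
  then obtain V g where "open V" "x \<in> V" "\<And>k. Ck_on k V g" "\<And>y. y \<in> S \<Longrightarrow> y \<in> V \<Longrightarrow> g y = f y"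
    using smooth_onE[OF assms(1), of x] assms(2) by blast
  then show "\<exists>V g. open V \<and> x \<in> V \<and> (\<forall>k. Ck_on k V g) \<and> (\<forall>y\<in>T \<inter> V. g y = f y)"
    using assms(2) by (intro exI[of _ V] exI[of _ g]) auto
qed

lemma smooth_on_cong:
  assumes "smooth_on S f" "\<And>x. x \<in> S \<Longrightarrow> g x = f x" shows "smooth_on S g"
  using assms by (simp add: smooth_on_def)

lemma smooth_on_differentiable:
  assumes "smooth_on S f" "open S" "x \<in> S"
  shows "f differentiable (at x)"
proof -
  obtain V g where V: "open V" "x \<in> V" "\<And>k. Ck_on k V g" "\<And>y. y \<in> S \<Longrightarrow> y \<in> V \<Longrightarrow> g y = f y"
    using smooth_onE[OF assms(1,3)] by metis
  have "g differentiable (at x)" using V(2) V(3)[of "Suc 0"] by simp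
  then show ?thesis
    using has_derivative_cong_open[of "S \<inter> V" x g f] V assms unfolding differentiable_def by auto
qed

lemma smooth_on_continuous_on:
  assumes "smooth_on S f" shows "continuous_on S f"
  unfolding continuous_on_eq_continuous_within
proof
  fix x assume x: "x \<in> S"
  obtain V g where V: "open V" "x \<in> V" "\<And>k. Ck_on k V g" "\<And>y. y \<in> S \<Longrightarrow> y \<in> V \<Longrightarrow> g y = f y"
    using smooth_onE[OF assms x] by metis
  have "continuous_on V g" using V(3)[of 0] by simp
  then have "continuous (at x within S) g"
    using V(1,2) by (meson continuous_on_eq_continuous_at continuous_within_subset subset_UNIV)
  then show "continuous (at x within S) f"
    by (rule continuous_transform_within_openin[where S = "S \<inter> V"])
      (use V x in \<open>auto simp: openin_open_Int\<close>)
qed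

lemma smooth_on_compose:
  fixes f :: "'a::real_normed_vector \<Rightarrow> 'b::euclidean_space"
  assumes "smooth_on T g" "smooth_on S f" "\<And>x. x \<in> S \<Longrightarrow> f x \<in> T"
  shows "smooth_on S (\<lambda>x. g (f x))"
  unfolding smooth_on_def
proof
  fix x assume x: "x \<in> S"
  obtain V f' where V: "open V" "x \<in> V" "\<And>k. Ck_on k V f'" "\<And>y. y \<in> S \<Longrightarrow> y \<in> V \<Longrightarrow> f' y = f y"
    using smooth_onE[OF assms(2) x] by metis
  obtain V' g' where V': "open V'" "f x \<in> V'" "\<And>k. Ck_on k V' g'" "\<And>y. y \<in> T \<Longrightarrow> y \<in> V' \<Longrightarrow> g' y = g y"
    using smooth_onE[OF assms(1) assms(3)[OF x]] by metis
  have "continuous_on V f'" using V(3)[of 0] by simp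
  then have op: "open (V \<inter> f' -` V')" using V(1) V'(1) continuous_on_open_vimage[OF V(1)] by (metis Int_commute)
  have "Ck_on k (V \<inter> f' -` V') (\<lambda>x. g' (f' x))" for k
    by (rule Ck_on_compose[OF op V'(1) Ck_on_subset[OF V(3)] V'(3)]) auto
  then show "\<exists>V h. open V \<and> x \<in> V \<and> (\<forall>k. Ck_on k V h) \<and> (\<forall>y\<in>S \<inter> V. h y = g (f y))"
    using op V V' x assms(3)
    by (intro exI[of _ "V \<inter> f' -` V'"] exI[of _ "\<lambda>x. g' (f' x)"]) auto
qed

lemma smooth_on_bounded_bilinear:
  assumes "bounded_bilinear prd" "smooth_on S f" "smooth_on S g"
  shows "smooth_on S (\<lambda>x. prd (f x) (g x))"
  unfolding smooth_on_def
proof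
  fix x assume x: "x \<in> S"
  obtain V f' where V: "open V" "x \<in> V" "\<And>k. Ck_on k V f'" "\<And>y. y \<in> S \<Longrightarrow> y \<in> V \<Longrightarrow> f' y = f y"
    using smooth_onE[OF assms(2) x] by metis
  obtain V' g' where V': "open V'" "x \<in> V'" "\<And>k. Ck_on k V' g'" "\<And>y. y \<in> S \<Longrightarrow> y \<in> V' \<Longrightarrow> g' y = g y"
    using smooth_onE[OF assms(3) x] by metis
  have "Ck_on k (V \<inter> V') (\<lambda>x. prd (f' x) (g' x))" for k
    by (intro Ck_on_bounded_bilinear[OF assms(1)] Ck_on_subset[OF V(3)] Ck_on_subset[OF V'(3)])
      (use V V' in auto)
  then show "\<exists>V h. open V \<and> x \<in> V \<and> (\<forall>k. Ck_on k V h) \<and> (\<forall>y\<in>S \<inter> V. h y = prd (f y) (g y))"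
    using V V' by (intro exI[of _ "V \<inter> V'"] exI[of _ "\<lambda>x. prd (f' x) (g' x)"]) auto
qed

lemma smooth_on_add:
  assumes "smooth_on S f" "smooth_on S g"
  shows "smooth_on S (\<lambda>x. f x + g x)"
  unfolding smooth_on_def
proof
  fix x assume x: "x \<in> S"
  obtain V f' where V: "open V" "x \<in> V" "\<And>k. Ck_on k V f'" "\<And>y. y \<in> S \<Longrightarrow> y \<in> V \<Longrightarrow> f' y = f y"
    using smooth_onE[OF assms(1) x] by metis
  obtain V' g' where V': "open V'" "x \<in> V'" "\<And>k. Ck_on k V' g'" "\<And>y. y \<in> S \<Longrightarrow> y \<in> V' \<Longrightarrow> g' y = g y"
    using smooth_onE[OF assms(2) x] by metis
  have "Ck_on k (V \<inter> V') (\<lambda>x. f' x + g' x)" for k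
    by (intro Ck_on_add Ck_on_subset[OF V(3)] Ck_on_subset[OF V'(3)])
      (use V V' in auto)
  then show "\<exists>V h. open V \<and> x \<in> V \<and> (\<forall>k. Ck_on k V h) \<and> (\<forall>y\<in>S \<inter> V. h y = f y + g y)"
    using V V' by (intro exI[of _ "V \<inter> V'"] exI[of _ "\<lambda>x. f' x + g' x"]) auto
qed

lemma smooth_on_const: "smooth_on S (\<lambda>x. c)"
  by (rule smooth_onI[OF open_UNIV]) (auto simp: Ck_on_const)

lemma smooth_on_ident: "smooth_on S (\<lambda>x. x)"
  by (rule smooth_onI[OF open_UNIV]) (auto simp: Ck_on_ident)

lemma smooth_on_bounded_linear:
  fixes L :: "'a::euclidean_space \<Rightarrow> 'b::real_normed_vector"
  assumes "bounded_linear L" "smooth_on S f" shows "smooth_on S (\<lambda>x. L (f x))"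
  by (rule smooth_on_compose[OF smooth_onI[OF open_UNIV, of UNIV L] assms(2)])
    (use Ck_on_bounded_linear[OF assms(1) open_UNIV Ck_on_ident] in auto)

lemma smooth_on_sum:
  assumes "\<And>i. i \<in> I \<Longrightarrow> smooth_on S (f i)"
  shows "smooth_on S (\<lambda>x. \<Sum>i\<in>I. f i x)"
  using assms
  by (induction I rule: infinite_finite_induct) (auto intro: smooth_on_const smooth_on_add)

lemma smooth_on_mult:
  fixes f g :: "_ \<Rightarrow> 'a::real_normed_algebra"
  assumes "smooth_on S f" "smooth_on S g"
  shows "smooth_on S (\<lambda>x. f x * g x)"
  by (rule smooth_on_bounded_bilinear[OF bounded_bilinear_mult assms])

lemma smooth_on_prod:
  fixes f :: "'i \<Rightarrow> _ \<Rightarrow> 'a::real_normed_field"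
  assumes "\<And>i. i \<in> I \<Longrightarrow> smooth_on S (f i)"
  shows "smooth_on S (\<lambda>x. \<Prod>i\<in>I. f i x)"
  using assms
  by (induction I rule: infinite_finite_induct) (auto intro: smooth_on_const smooth_on_mult)

lemma smooth_on_power:
  fixes f :: "_ \<Rightarrow> 'a::real_normed_field"
  assumes "smooth_on S f" shows "smooth_on S (\<lambda>x. f x ^ n)"
  by (induction n) (auto intro: smooth_on_const smooth_on_mult assms)

lemma smooth_on_inverse:
  fixes f :: "_ \<Rightarrow> 'a::{real_normed_field,euclidean_space}"
  assumes "smooth_on S f" "\<And>x. x \<in> S \<Longrightarrow> f x \<noteq> 0" shows "smooth_on S (\<lambda>x. inverse (f x))"
  by (rule smooth_on_compose[OF smooth_onI[OF _ order_refl Ck_on_inverse] assms(1)]) (use assms(2) in auto)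

lemma smooth_on_powi:
  fixes f :: "_ \<Rightarrow> 'a::{real_normed_field,euclidean_space}"
  assumes "smooth_on S f" "\<And>x. x \<in> S \<Longrightarrow> f x \<noteq> 0" shows "smooth_on S (\<lambda>x. f x powi m)"
  unfolding power_int_def
  by (cases "m \<ge> 0") (auto intro!: smooth_on_power smooth_on_inverse assms)

lemma smooth_on_sqrt:
  assumes "smooth_on S f" "\<And>x. x \<in> S \<Longrightarrow> f x > 0" shows "smooth_on S (\<lambda>x. sqrt (f x))"
  by (rule smooth_on_compose[OF smooth_onI[OF _ order_refl Ck_on_sqrt] assms(1)]) (use assms(2) in auto)

lemma smooth_on_cis:
  assumes "smooth_on S f" shows "smooth_on S (\<lambda>x. cis (f x))"
  by (rule smooth_on_compose[OF smooth_onI[OF _ order_refl Ck_on_cis] assms(1)]) auto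

lemma smooth_on_sgn:
  fixes f :: "_ \<Rightarrow> 'a::euclidean_space"
  assumes "smooth_on S f" "\<And>x. x \<in> S \<Longrightarrow> f x \<noteq> 0" shows "smooth_on S (\<lambda>x. sgn (f x))"
  unfolding sgn_div_norm norm_eq_sqrt_inner
  by (intro smooth_on_bounded_bilinear[OF bounded_bilinear_scaleR] smooth_on_inverse smooth_on_sqrt
    smooth_on_bounded_bilinear[OF bounded_bilinear_inner] assms(1)) (use assms(2) in auto)

text \<open>A map into \<open>\<complex>\<^sup>n\<close> or \<open>\<real>\<^sup>n\<close> is the sum of its components, each followed by the
  linear inclusion of a coordinate axis.\<close>

lemma smooth_on_vec:
  fixes f :: "'a::real_normed_vector \<Rightarrow> 'b::euclidean_space ^ 'n"
  assumes "\<And>i. smooth_on S (\<lambda>x. f x $ i)" shows "smooth_on S f"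
proof -
  have "linear (axis i :: 'b \<Rightarrow> 'b^'n)" for i
    by (rule linearI) (simp_all add: axis_def vec_eq_iff)
  then have "bounded_linear (axis i :: 'b \<Rightarrow> 'b^'n)" for i
    by (simp add: linear_conv_bounded_linear)
  then have "smooth_on S (\<lambda>x. \<Sum>i\<in>UNIV. axis i (f x $ i))"
    by (intro smooth_on_sum smooth_on_bounded_linear[of "axis _"] assms)
  moreover have "(\<Sum>i\<in>UNIV. axis i (f x $ i)) = f x" for x
    by (simp add: vec_eq_iff axis_def if_distrib[of "\<lambda>v. v $ _"] cong: if_cong)
  ultimately show ?thesis by simp
qed

section \<open>The edges of the octagon and the orbits\<close>

lemma UNIV_8: "(UNIV :: 8 set) = {1,2,3,4,5,6,7,8}"
  by (rule sym, rule card_subset_eq) auto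

lemma forall_8: "(\<forall>i::8. P i) \<longleftrightarrow> P 1 \<and> P 2 \<and> P 3 \<and> P 4 \<and> P 5 \<and> P 6 \<and> P 7 \<and> P 8"
proof -
  have "(\<forall>i::8. P i) \<longleftrightarrow> (\<forall>i\<in>UNIV. P i)" by simp
  then show ?thesis unfolding UNIV_8 by simp
qed

lemma sum_8: "sum f (UNIV :: 8 set) = f 1 + f 2 + f 3 + f 4 + f 5 + f 6 + f 7 + f 8"
  unfolding UNIV_8 by (simp add: ac_simps)

text \<open>The inward normals \<open>n\<^sub>l\<close> and offsets of the edges of the octagon, in cyclic order and numbered
  so that the edge \<open>l\<close> is the image of \<open>{z\<^sub>l = 0}\<close>.  As \<open>8 + 1 = 1\<close> in the index type, the
  neighbours of the edge \<open>l\<close> are \<open>l - 1\<close> and \<open>l + 1\<close> for every \<open>l\<close>.\<close>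

definition normal_x :: "int^8" where "normal_x = vector [1,1,0,-1,-1,-1,0,1]"
definition normal_y :: "int^8" where "normal_y = vector [0,1,1,1,0,-1,-1,-1]"
definition offset :: "real^8" where "offset = vector [0,-1,0,2,3,5,3,2]"

lemma normal_nth:
  "normal_x$1 = 1" "normal_x$2 = 1" "normal_x$3 = 0" "normal_x$4 = -1"
  "normal_x$5 = -1" "normal_x$6 = -1" "normal_x$7 = 0" "normal_x$8 = 1"
  "normal_y$1 = 0" "normal_y$2 = 1" "normal_y$3 = 1" "normal_y$4 = 1"
  "normal_y$5 = 0" "normal_y$6 = -1" "normal_y$7 = -1" "normal_y$8 = -1"
  "offset$1 = 0" "offset$2 = -1" "offset$3 = 0" "offset$4 = 2"
  "offset$5 = 3" "offset$6 = 5" "offset$7 = 3" "offset$8 = 2"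
  by (simp_all add: normal_x_def normal_y_def offset_def vector_def)

definition det_normals :: "8 \<Rightarrow> 8 \<Rightarrow> int" where
  "det_normals k l = normal_x$k * normal_y$l - normal_y$k * normal_x$l"

lemma det_normals_self: "det_normals k k = 0" by (simp add: det_normals_def)

text \<open>Smoothness of the octagon: at each vertex the two normals form a basis of \<open>\<int>\<^sup>2\<close>.  This is
  what makes the stabilizers trivial and gives the vertex charts integer exponents.\<close>

lemma det_adjacent: "det_normals k (k+1) = 1"
proof -
  have wrap: "(9::8) = 1" by simp
  have "\<forall>k. det_normals k (k+1) = 1" unfolding forall_8 by (simp add: det_normals_def normal_nth wrap)
  then show ?thesis ..
qed

text \<open>Cramer's rule in the basis \<open>n\<^sub>k, n\<^sub>k\<^sub>+\<^sub>1\<close>, with denominator 1.\<close>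

lemma normal_expand:
  "normal_x$l = det_normals l (k+1) * normal_x$k + det_normals k l * normal_x$(k+1)"
  "normal_y$l = det_normals l (k+1) * normal_y$k + det_normals k l * normal_y$(k+1)"
  using det_adjacent[of k] unfolding det_normals_def by algebra+

text \<open>In the numbers \<open>|z\<^sub>l|\<^sup>2 / 2\<close> the six equations of \<open>W\<close> are linear and leave a plane, on which
  \<open>x = J\<close> and \<open>y = H\<close> are affine coordinates; the other six numbers are then the edge functions of
  the octagon.\<close>

lemma W_iff_halfplanes:
  "z \<in> W \<longleftrightarrow> (\<exists>(x::real) (y::real). \<forall>l. (cmod (z$l))\<^sup>2 = 2 * (normal_x$l * x + normal_y$l * y + offset$l))"
proof
  assume "z \<in> W"
  then show "\<exists>(x::real) (y::real). \<forall>l. (cmod (z$l))\<^sup>2 = 2 * (normal_x$l * x + normal_y$l * y + offset$l)"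
    unfolding W_def forall_8
    by (intro exI[of _ "(cmod (z$1))\<^sup>2 / 2"] exI[of _ "(cmod (z$3))\<^sup>2 / 2"]) (auto simp: normal_nth)
next
  assume "\<exists>(x::real) (y::real). \<forall>l. (cmod (z$l))\<^sup>2 = 2 * (normal_x$l * x + normal_y$l * y + offset$l)"
  then show "z \<in> W" unfolding W_def forall_8 by (auto simp: normal_nth)
qed

lemma W_halfplanes:
  assumes "z \<in> W"
  shows "(cmod (z$l))\<^sup>2 = normal_x$l * (cmod (z$1))\<^sup>2 + normal_y$l * (cmod (z$3))\<^sup>2 + 2 * offset$l"
proof -
  obtain x y :: real where *: "\<And>l. (cmod (z$l))\<^sup>2 = 2 * (normal_x$l * x + normal_y$l * y + offset$l)"
    using assms W_iff_halfplanes by auto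
  show ?thesis using *[of 1] *[of 3] *[of l] by (simp add: normal_nth)
qed

text \<open>The Lie algebra of \<open>N\<close> inside that of the torus of dimension eight, as the kernel of the map
  sending the \<open>l\<close>-th basis vector to \<open>n\<^sub>l\<close>.\<close>

definition phase_relation :: "(8 \<Rightarrow> real) \<Rightarrow> bool" where
  "phase_relation \<theta> \<longleftrightarrow>
     (\<Sum>l\<in>UNIV. real_of_int (normal_x$l) * \<theta> l) = 0 \<and> (\<Sum>l\<in>UNIV. real_of_int (normal_y$l) * \<theta> l) = 0"

text \<open>The two relations determine \<open>\<theta>\<^sub>5\<close> and \<open>\<theta>\<^sub>7\<close> from the six remaining angles, which are arbitrary;
  solving them reproduces the parametrization of \<open>N\<close>.\<close>

lemma mem_\<tau>_iff:
  "w \<in> \<tau> z \<longleftrightarrow> (\<exists>\<theta>. phase_relation \<theta> \<and> (\<forall>l. w$l = cis (\<theta> l) * z$l))"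
proof
  assume "w \<in> \<tau> z"
  then obtain t where "w = N_act t z" by (auto simp: \<tau>_def)
  then show "\<exists>\<theta>. phase_relation \<theta> \<and> (\<forall>l. w$l = cis (\<theta> l) * z$l)"
    by (intro exI[of _ "\<lambda>l. N_phase t $ l"])
      (simp add: phase_relation_def sum_8 normal_nth N_act_def cis_conv_exp)
next
  assume "\<exists>\<theta>. phase_relation \<theta> \<and> (\<forall>l. w$l = cis (\<theta> l) * z$l)"
  then obtain \<theta> where \<theta>: "phase_relation \<theta>" "\<And>l. w$l = cis (\<theta> l) * z$l" by auto
  define t :: "real^6" where "t = vector [\<theta> 1, \<theta> 2, \<theta> 3, \<theta> 4, \<theta> 6, \<theta> 8]"
  have t: "t$1 = \<theta> 1" "t$2 = \<theta> 2" "t$3 = \<theta> 3" "t$4 = \<theta> 4" "t$5 = \<theta> 6" "t$6 = \<theta> 8"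
    by (simp_all add: t_def vector_def)
  have "\<forall>l. N_phase t $ l = \<theta> l"
    unfolding forall_8 using \<theta>(1) by (simp add: phase_relation_def t sum_8 normal_nth)
  then have "w = N_act t z" by (simp add: vec_eq_iff N_act_def \<theta>(2) cis_conv_exp)
  then show "w \<in> \<tau> z" by (simp add: \<tau>_def)
qed

text \<open>Written in the basis \<open>n\<^sub>k, n\<^sub>k\<^sub>+\<^sub>1\<close>, the relations contain \<open>\<theta>\<^sub>k\<close> only in the first and
  \<open>\<theta>\<^sub>k\<^sub>+\<^sub>1\<close> only in the second sum, with coefficient 1.  Hence the phases of all other coordinates
  can be prescribed, in exactly one way.\<close>

lemma phase_relation_iff:
  "phase_relation \<theta> \<longleftrightarrow>
     (\<Sum>l\<in>UNIV. real_of_int (det_normals l (k+1)) * \<theta> l) = 0 \<and>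
     (\<Sum>l\<in>UNIV. real_of_int (det_normals k l) * \<theta> l) = 0"
proof -
  let ?x = "\<Sum>l\<in>UNIV. real_of_int (normal_x$l) * \<theta> l"
  let ?y = "\<Sum>l\<in>UNIV. real_of_int (normal_y$l) * \<theta> l"
  let ?a = "\<Sum>l\<in>UNIV. real_of_int (det_normals l (k+1)) * \<theta> l"
  let ?b = "\<Sum>l\<in>UNIV. real_of_int (det_normals k l) * \<theta> l"
  have "?x = normal_x$k * ?a + normal_x$(k+1) * ?b"
    unfolding sum_distrib_left sum.distrib[symmetric]
    by (rule sum.cong[OF refl], subst normal_expand(1)[of _ k]) (simp add: algebra_simps)
  moreover have "?y = normal_y$k * ?a + normal_y$(k+1) * ?b"
    unfolding sum_distrib_left sum.distrib[symmetric]
    by (rule sum.cong[OF refl], subst normal_expand(2)[of _ k]) (simp add: algebra_simps)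
  ultimately have "?x = 0 \<and> ?y = 0" if "?a = 0 \<and> ?b = 0" using that by simp
  moreover have "?a = normal_y$(k+1) * ?x - normal_x$(k+1) * ?y"
    unfolding sum_distrib_left sum_subtractf[symmetric]
    by (rule sum.cong; simp add: det_normals_def algebra_simps)
  moreover have "?b = normal_x$k * ?y - normal_y$k * ?x"
    unfolding sum_distrib_left sum_subtractf[symmetric]
    by (rule sum.cong; simp add: det_normals_def algebra_simps)
  moreover have "(x = 0 \<and> y = 0) \<longleftrightarrow> (a = 0 \<and> b = 0)"
    if "a = 0 \<and> b = 0 \<Longrightarrow> x = 0 \<and> y = 0" "a = p * x - q * y" "b = r * y - s * x"
    for a b x y p q r s :: real
    using that by auto
  ultimately show ?thesis unfolding phase_relation_def by blast
qed

lemma phase_relation_add: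
  "phase_relation \<theta> \<Longrightarrow> phase_relation \<eta> \<Longrightarrow> phase_relation (\<lambda>l. \<theta> l + \<eta> l)"
  unfolding phase_relation_def by (simp add: distrib_left sum.distrib)

lemma phase_relation_uminus: "phase_relation \<theta> \<Longrightarrow> phase_relation (\<lambda>l. - \<theta> l)"
  unfolding phase_relation_def by (simp add: sum_negf)

lemma mem_\<tau>_self: "z \<in> \<tau> z"
  unfolding mem_\<tau>_iff by (rule exI[of _ "\<lambda>l. 0"]) (simp add: phase_relation_def)

lemma mem_\<tau>_sym:
  assumes "w \<in> \<tau> z" shows "z \<in> \<tau> w"
proof -
  obtain \<theta> where \<theta>: "phase_relation \<theta>" "\<And>l. w$l = cis (\<theta> l) * z$l" using assms by (auto simp: mem_\<tau>_iff)
  show ?thesis unfolding mem_\<tau>_iff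
    by (rule exI[of _ "\<lambda>l. - \<theta> l"]) (simp add: phase_relation_uminus \<theta> mult.assoc[symmetric] cis_mult)
qed

lemma mem_\<tau>_trans:
  assumes "w \<in> \<tau> z" "v \<in> \<tau> w" shows "v \<in> \<tau> z"
proof -
  obtain \<theta> where \<theta>: "phase_relation \<theta>" "\<And>l. w$l = cis (\<theta> l) * z$l" using assms by (auto simp: mem_\<tau>_iff)
  obtain \<eta> where \<eta>: "phase_relation \<eta>" "\<And>l. v$l = cis (\<eta> l) * w$l" using assms by (auto simp: mem_\<tau>_iff)
  show ?thesis unfolding mem_\<tau>_iff
    by (rule exI[of _ "\<lambda>l. \<eta> l + \<theta> l"]) (simp add: phase_relation_add \<theta> \<eta> mult.assoc[symmetric] cis_mult)
qed

lemma \<tau>_eq_iff: "\<tau> w = \<tau> z \<longleftrightarrow> w \<in> \<tau> z"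
  using mem_\<tau>_self mem_\<tau>_sym mem_\<tau>_trans by blast

lemma orbit_cmod: "w \<in> \<tau> z \<Longrightarrow> cmod (w$l) = cmod (z$l)"
  by (auto simp: mem_\<tau>_iff norm_mult)

section \<open>Slices through the orbits\<close>

text \<open>The value of \<open>|z\<^sub>l|\<^sup>2\<close> at a point of \<open>W\<close> with \<open>z\<^sub>k = a\<close> and \<open>z\<^sub>k\<^sub>+\<^sub>1 = b\<close>.\<close>

definition slice_radius :: "8 \<Rightarrow> complex \<Rightarrow> complex \<Rightarrow> 8 \<Rightarrow> real" where
  "slice_radius k a b l =
     2 * (offset$l - det_normals l (k+1) * offset$k - det_normals k l * offset$(k+1)) +
     det_normals l (k+1) * (cmod a)\<^sup>2 + det_normals k l * (cmod b)\<^sup>2"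

lemma W_iff_slice:
  "z \<in> W \<longleftrightarrow> (\<forall>l. (cmod (z$l))\<^sup>2 = slice_radius k (z$k) (z$(k+1)) l)"
proof
  assume "z \<in> W"
  then obtain x y :: real
    where r: "\<And>l. (cmod (z$l))\<^sup>2 = 2 * (normal_x$l * x + normal_y$l * y + offset$l)"
    using W_iff_halfplanes by auto
  show "\<forall>l. (cmod (z$l))\<^sup>2 = slice_radius k (z$k) (z$(k+1)) l"
  proof
    fix l
    show "(cmod (z$l))\<^sup>2 = slice_radius k (z$k) (z$(k+1)) l"
      unfolding slice_radius_def r
      by (subst normal_expand(1)[of l k], subst normal_expand(2)[of l k]) (simp add: algebra_simps)
  qed
next
  assume r: "\<forall>l. (cmod (z$l))\<^sup>2 = slice_radius k (z$k) (z$(k+1)) l"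
  define p where "p = (cmod (z$k))\<^sup>2 / 2 - offset$k"
  define q where "q = (cmod (z$(k+1)))\<^sup>2 / 2 - offset$(k+1)"
  show "z \<in> W" unfolding W_iff_halfplanes
  proof (intro exI allI)
    fix l
    have "(cmod (z$l))\<^sup>2 = 2 * (det_normals l (k+1) * p + det_normals k l * q + offset$l)"
      unfolding r[rule_format, of l] by (simp add: slice_radius_def p_def q_def algebra_simps)
    then show "(cmod (z$l))\<^sup>2 = 2 * (normal_x$l * (normal_y$(k+1) * p - normal_y$k * q) +
        normal_y$l * (normal_x$k * q - normal_x$(k+1) * p) + offset$l)"
      by (simp add: det_normals_def algebra_simps)
  qed
qed

lemma slice_radius_self: "slice_radius k a b k = (cmod a)\<^sup>2" "slice_radius k a b (k+1) = (cmod b)\<^sup>2"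
  by (simp_all add: slice_radius_def det_adjacent det_normals_self)

lemma slice_radius_cong:
  "cmod a = cmod a' \<Longrightarrow> cmod b = cmod b' \<Longrightarrow> slice_radius k a b l = slice_radius k a' b' l"
  by (simp add: slice_radius_def)

definition coord1 :: "real^4 \<Rightarrow> complex" where "coord1 x = Complex (x$1) (x$2)"
definition coord2 :: "real^4 \<Rightarrow> complex" where "coord2 x = Complex (x$3) (x$4)"
definition of_coords :: "complex \<Rightarrow> complex \<Rightarrow> real^4" where
  "of_coords a b = vector [Re a, Im a, Re b, Im b]"

lemma of_coords_nth: "of_coords a b $ 1 = Re a" "of_coords a b $ 2 = Im a"
  "of_coords a b $ 3 = Re b" "of_coords a b $ 4 = Im b"
  by (simp_all add: of_coords_def vector_def)

lemma coords_of_coords [simp]: "coord1 (of_coords a b) = a" "coord2 (of_coords a b) = b"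
  by (simp_all add: coord1_def coord2_def of_coords_nth)

lemma of_coords_coords [simp]: "of_coords (coord1 x) (coord2 x) = x"
  by (simp add: vec_eq_iff forall_4 of_coords_nth coord1_def coord2_def)

lemma coords_eqI: "coord1 x = coord1 y \<Longrightarrow> coord2 x = coord2 y \<Longrightarrow> x = y"
  by (metis of_coords_coords)

lemma bounded_linear_coord: "bounded_linear coord1" "bounded_linear coord2"
  unfolding linear_conv_bounded_linear[symmetric]
  by (auto intro!: linearI simp: coord1_def coord2_def complex_eq_iff)

definition off_axes :: "8 \<Rightarrow> (complex^8) set" where
  "off_axes k = {z. \<forall>l. l \<noteq> k \<longrightarrow> l \<noteq> k+1 \<longrightarrow> z$l \<noteq> 0}"

definition slice_domain :: "8 \<Rightarrow> (real^4) set" where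
  "slice_domain k = {x. \<forall>l. l \<noteq> k \<longrightarrow> l \<noteq> k+1 \<longrightarrow> slice_radius k (coord1 x) (coord2 x) l > 0}"

text \<open>The representative of an orbit whose coordinates other than \<open>k\<close> and \<open>k + 1\<close> are positive.\<close>

definition slice :: "8 \<Rightarrow> real^4 \<Rightarrow> complex^8" where
  "slice k x = (\<chi> l. if l = k then coord1 x else if l = k+1 then coord2 x
     else of_real (sqrt (slice_radius k (coord1 x) (coord2 x) l)))"

text \<open>Multiplying \<open>z\<^sub>k\<close> and \<open>z\<^sub>k\<^sub>+\<^sub>1\<close> by these Laurent monomials in the phases of the other coordinates
  has the effect of moving \<open>z\<close> along its orbit into the slice.\<close>

definition phase_product :: "8 \<Rightarrow> (8 \<Rightarrow> int) \<Rightarrow> complex^8 \<Rightarrow> complex" where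
  "phase_product k m z = (\<Prod>l\<in>-{k,k+1}. sgn (z$l) powi m l)"

definition slice_coords :: "8 \<Rightarrow> complex^8 \<Rightarrow> real^4" where
  "slice_coords k z = of_coords (phase_product k (\<lambda>l. det_normals l (k+1)) z * z$k)
     (phase_product k (det_normals k) z * z$(k+1))"

lemma slice_nth:
  "slice k x $ k = coord1 x" "slice k x $ (k+1) = coord2 x"
  "l \<noteq> k \<Longrightarrow> l \<noteq> k+1 \<Longrightarrow> slice k x $ l = of_real (sqrt (slice_radius k (coord1 x) (coord2 x) l))"
  by (simp_all add: slice_def)

lemma slice_mem_W:
  assumes "x \<in> slice_domain k" shows "slice k x \<in> W"
  unfolding W_iff_slice[of _ k]
proof
  fix l show "(cmod (slice k x $ l))\<^sup>2 = slice_radius k (slice k x $ k) (slice k x $ (k+1)) l"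
    using assms slice_radius_self[of k]
    by (cases "l = k"; cases "l = k+1") (auto simp: slice_nth slice_domain_def less_imp_le)
qed

lemma slice_off_axes: "x \<in> slice_domain k \<Longrightarrow> slice k x \<in> off_axes k"
  by (fastforce simp: off_axes_def slice_domain_def slice_nth)

lemma prod_cis: "(\<Prod>i\<in>I. cis (f i)) = cis (\<Sum>i\<in>I. f i)"
  by (induction I rule: infinite_finite_induct) (auto simp: cis_mult)

lemma phase_product_rotate:
  assumes "\<And>l. w$l = cis (\<theta> l) * z$l"
  shows "phase_product k m w = cis (\<Sum>l\<in>-{k,k+1}. m l * \<theta> l) * phase_product k m z"
  unfolding phase_product_def
  by (simp add: assms sgn_mult power_int_mult_distrib cis_power_int prod.distrib prod_cis)

lemma sum_split_adjacent:
  fixes f :: "8 \<Rightarrow> real"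
  shows "sum f UNIV = f k + f (k+1) + sum f (-{k,k+1})"
proof -
  have "sum f UNIV = sum f {k,k+1} + sum f (-{k,k+1})"
    by (metis finite sum.subset_diff Compl_eq_Diff_UNIV add.commute subset_UNIV)
  then show ?thesis by simp
qed

text \<open>For angles in the Lie algebra of \<open>N\<close> both sums vanish and the coordinates are invariant; for the
  angles of the residual torus the formula shows that it acts on the coordinates by rotations.\<close>

lemma slice_coords_rotate:
  assumes "\<And>l. w$l = cis (\<theta> l) * z$l"
  shows "slice_coords k w = of_coords
    (cis (\<Sum>l\<in>UNIV. real_of_int (det_normals l (k+1)) * \<theta> l) * coord1 (slice_coords k z))
    (cis (\<Sum>l\<in>UNIV. real_of_int (det_normals k l) * \<theta> l) * coord2 (slice_coords k z))"
proof -
  have eq: "(\<Sum>l\<in>UNIV. real_of_int (det_normals l (k+1)) * \<theta> l) =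
      (\<Sum>l\<in>-{k,k+1}. real_of_int (det_normals l (k+1)) * \<theta> l) + \<theta> k"
    "(\<Sum>l\<in>UNIV. real_of_int (det_normals k l) * \<theta> l) =
      (\<Sum>l\<in>-{k,k+1}. real_of_int (det_normals k l) * \<theta> l) + \<theta> (k+1)"
    by (subst sum_split_adjacent[of _ k], simp add: det_adjacent det_normals_self)+
  show ?thesis unfolding eq slice_coords_def
    by (simp add: phase_product_rotate[OF assms] assms cis_mult[symmetric] ac_simps)
qed

lemma slice_coords_invariant:
  assumes "w \<in> \<tau> z" shows "slice_coords k w = slice_coords k z"
proof -
  obtain \<theta> where \<theta>: "phase_relation \<theta>" "\<And>l. w$l = cis (\<theta> l) * z$l" using assms by (auto simp: mem_\<tau>_iff)
  show ?thesis using slice_coords_rotate[OF \<theta>(2), of k] \<theta>(1)[unfolded phase_relation_iff[of _ k]] by simp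
qed

lemma slice_coords_slice:
  assumes "x \<in> slice_domain k" shows "slice_coords k (slice k x) = x"
proof -
  have "sgn (slice k x $ l) = 1" if "l \<in> -{k,k+1}" for l
    using assms that by (simp add: slice_domain_def slice_nth sgn_of_real)
  then have "phase_product k m (slice k x) = 1" for m
    by (simp add: phase_product_def)
  then show ?thesis by (simp add: slice_coords_def slice_nth)
qed

lemma norm_phase_product:
  assumes "z \<in> off_axes k" shows "cmod (phase_product k m z) = 1"
proof -
  have "cmod (sgn (z $ l)) = 1" if "l \<in> -{k,k+1}" for l
    using assms that by (simp add: off_axes_def norm_sgn)
  then show ?thesis unfolding phase_product_def by (simp add: prod_norm[symmetric] norm_power_int)
qed

lemma slice_radius_slice_coords:
  assumes "z \<in> W" "z \<in> off_axes k"
  shows "slice_radius k (coord1 (slice_coords k z)) (coord2 (slice_coords k z)) l = (cmod (z$l))\<^sup>2"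
proof -
  have "slice_radius k (coord1 (slice_coords k z)) (coord2 (slice_coords k z)) l =
    slice_radius k (z$k) (z$(k+1)) l"
    by (rule slice_radius_cong) (simp_all add: slice_coords_def norm_mult norm_phase_product[OF assms(2)])
  then show ?thesis using assms(1) by (simp add: W_iff_slice[of _ k])
qed

lemma slice_coords_mem_domain:
  "z \<in> W \<Longrightarrow> z \<in> off_axes k \<Longrightarrow> slice_coords k z \<in> slice_domain k"
  unfolding slice_domain_def by (auto simp: slice_radius_slice_coords) (auto simp: off_axes_def)

text \<open>Take \<open>\<theta>\<^sub>l\<close> to be the argument of \<open>z\<^sub>l\<close> off the vertex; the other two angles are then
  forced by the phase relation, and they undo the monomials in the slice coordinates.\<close>

lemma slice_meets_orbit:
  assumes "z \<in> W" "z \<in> off_axes k"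
  shows "\<tau> (slice k (slice_coords k z)) = \<tau> z"
proof -
  define s1 where "s1 = (\<Sum>l\<in>-{k,k+1}. real_of_int (det_normals l (k+1)) * Arg (z$l))"
  define s2 where "s2 = (\<Sum>l\<in>-{k,k+1}. real_of_int (det_normals k l) * Arg (z$l))"
  define \<theta> where "\<theta> l = (if l = k then - s1 else if l = k+1 then - s2 else Arg (z$l))" for l
  let ?s = "slice k (slice_coords k z)"
  have "(\<Sum>l\<in>-{k,k+1}. real_of_int (det_normals l (k+1)) * \<theta> l) = s1"
    "(\<Sum>l\<in>-{k,k+1}. real_of_int (det_normals k l) * \<theta> l) = s2"
    unfolding s1_def s2_def by (rule sum.cong; simp add: \<theta>_def)+
  then have rel: "phase_relation \<theta>"
    unfolding phase_relation_iff[of _ k] sum_split_adjacent[of _ k]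
    by (simp add: det_adjacent det_normals_self \<theta>_def)
  have sgn: "sgn (z$l) = cis (Arg (z$l))" if "l \<in> -{k,k+1}" for l
    using assms(2) that by (simp add: off_axes_def cis_Arg)
  have "phase_product k m z = cis (\<Sum>l\<in>-{k,k+1}. m l * Arg (z$l))" for m
    unfolding phase_product_def prod_cis[symmetric]
    by (rule prod.cong) (simp_all add: sgn cis_power_int)
  then have pp: "phase_product k (\<lambda>l. det_normals l (k+1)) z = cis s1" "phase_product k (det_normals k) z = cis s2"
    by (simp_all add: s1_def s2_def)
  have "z$l = cis (\<theta> l) * ?s$l" for l
  proof -
    consider "l = k" | "l = k+1" | "l \<noteq> k" "l \<noteq> k+1" by blast
    then show ?thesis
    proof cases
      case 1 then show ?thesis by (simp add: \<theta>_def slice_nth slice_coords_def pp mult.assoc[symmetric] cis_mult)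
    next
      case 2 then show ?thesis by (simp add: \<theta>_def slice_nth slice_coords_def pp mult.assoc[symmetric] cis_mult)
    next
      case 3
      then have "?s$l = of_real (cmod (z$l))"
        by (simp add: slice_nth slice_radius_slice_coords[OF assms])
      then show ?thesis using 3 rcis_cmod_Arg[of "z$l"] by (simp add: \<theta>_def rcis_def mult.commute)
    qed
  qed
  then have "z \<in> \<tau> ?s" using rel mem_\<tau>_iff by blast
  then show ?thesis by (simp add: \<tau>_eq_iff mem_\<tau>_sym)
qed

text \<open>Edges of the octagon that are not adjacent are disjoint, so the vanishing coordinates of a point
  of \<open>W\<close> are among two cyclically consecutive ones.\<close>

lemma W_cover:
  assumes "z \<in> W" shows "\<exists>k. z \<in> off_axes k"
proof -
  define r where "r l = (cmod (z$l))\<^sup>2" for l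
  define x y where "x = r 1" and "y = r 3"
  have nonneg: "r l \<ge> 0" for l by (simp add: r_def)
  have rl: "r l = normal_x$l * x + normal_y$l * y + 2 * offset$l" for l
    using W_halfplanes[OF assms, of l] by (simp add: r_def x_def y_def)
  have r: "r 1 = x" "r 2 = x + y - 2" "r 3 = y" "r 4 = 4 - x + y" "r 5 = 6 - x"
    "r 6 = 10 - x - y" "r 7 = 6 - y" "r 8 = 4 + x - y"
    by (simp_all add: rl normal_nth)
  note ge = nonneg[of 1] nonneg[of 2] nonneg[of 3] nonneg[of 4] nonneg[of 5] nonneg[of 6]
    nonneg[of 7] nonneg[of 8]
  have "r 1 = 0 \<Longrightarrow> r 3 > 0 \<and> r 4 > 0 \<and> r 5 > 0 \<and> r 6 > 0 \<and> r 7 > 0"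
    "r 2 = 0 \<Longrightarrow> r 4 > 0 \<and> r 5 > 0 \<and> r 6 > 0 \<and> r 7 > 0 \<and> r 8 > 0"
    "r 3 = 0 \<Longrightarrow> r 5 > 0 \<and> r 6 > 0 \<and> r 7 > 0 \<and> r 8 > 0 \<and> r 1 > 0"
    "r 4 = 0 \<Longrightarrow> r 6 > 0 \<and> r 7 > 0 \<and> r 8 > 0 \<and> r 1 > 0 \<and> r 2 > 0"
    "r 5 = 0 \<Longrightarrow> r 7 > 0 \<and> r 8 > 0 \<and> r 1 > 0 \<and> r 2 > 0 \<and> r 3 > 0"
    "r 6 = 0 \<Longrightarrow> r 8 > 0 \<and> r 1 > 0 \<and> r 2 > 0 \<and> r 3 > 0 \<and> r 4 > 0"
    "r 7 = 0 \<Longrightarrow> r 1 > 0 \<and> r 2 > 0 \<and> r 3 > 0 \<and> r 4 > 0 \<and> r 5 > 0"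
    "r 8 = 0 \<Longrightarrow> r 2 > 0 \<and> r 3 > 0 \<and> r 4 > 0 \<and> r 5 > 0 \<and> r 6 > 0"
    using ge unfolding r by linarith+
  then have "\<forall>l. r l = 0 \<longrightarrow> (\<forall>m. m \<noteq> l \<longrightarrow> m \<noteq> l+1 \<longrightarrow> m+1 \<noteq> l \<longrightarrow> r m > 0)"
    unfolding forall_8 by simp
  \<comment> \<open>only the neighbours of an edge can meet it\<close>
  then have far: "z$m \<noteq> 0" if "z$l = 0" "m \<noteq> l" "m \<noteq> l+1" "m+1 \<noteq> l" for l m
    using that by (metis less_irrefl norm_zero r_def zero_power2)
  show ?thesis
  proof (cases "\<exists>l. z$l = 0")
    case False
    then show ?thesis by (auto simp: off_axes_def)
  next
    case True
    then obtain l where l: "z$l = 0" by blast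
    show ?thesis
    proof (cases "z$(l-1) = 0")
      case True
      have "z$m \<noteq> 0" if "m \<noteq> l-1" "m \<noteq> l" for m
      proof (cases "m = l+1")
        case m: True
        have "l + 1 \<noteq> l - 1" "l + 1 + 1 \<noteq> l - 1"
          by (simp_all add: algebra_simps)
        then show ?thesis using far[OF True, of m] m by simp
      next
        case False
        then show ?thesis using far[OF l, of m] that by (metis add_diff_cancel_right')
      qed
      then have "z \<in> off_axes (l-1)" by (simp add: off_axes_def)
      then show ?thesis by blast
    next
      case False
      then have "z$m \<noteq> 0" if "m \<noteq> l" "m \<noteq> l+1" for m
        using far[OF l, of m] that by (metis add_diff_cancel_right')
      then have "z \<in> off_axes l" by (simp add: off_axes_def)
      then show ?thesis by blast
    qed
  qed
qed

section \<open>The vertex charts\<close>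

lemma open_off_axes: "open (off_axes k)"
proof -
  have "off_axes k = (\<Inter>l\<in>-{k,k+1}. {z. z$l \<noteq> 0})" by (auto simp: off_axes_def)
  also have "open \<dots>"
    by (intro open_INT) (auto intro!: open_Collect_neq continuous_intros)
  finally show ?thesis .
qed

lemma smooth_coord: "smooth_on S coord1" "smooth_on S coord2"
  by (intro smooth_on_bounded_linear[OF bounded_linear_coord(1) smooth_on_ident]
    smooth_on_bounded_linear[OF bounded_linear_coord(2) smooth_on_ident])+

lemma smooth_slice_radius: "smooth_on S (\<lambda>x. slice_radius k (coord1 x) (coord2 x) l)"
  unfolding slice_radius_def power2_norm_eq_inner
  by (intro smooth_on_add smooth_on_mult smooth_on_const smooth_coord
    smooth_on_bounded_bilinear[OF bounded_bilinear_inner])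

lemma open_slice_domain: "open (slice_domain k)"
proof -
  have "slice_domain k = (\<Inter>l\<in>-{k,k+1}. {x. 0 < slice_radius k (coord1 x) (coord2 x) l})"
    by (auto simp: slice_domain_def)
  also have "open \<dots>"
    by (intro open_INT ballI open_Collect_less continuous_on_const
        smooth_on_continuous_on[OF smooth_slice_radius]) auto
  finally show ?thesis .
qed

lemma smooth_slice: "smooth_on (slice_domain k) (slice k)"
proof (rule smooth_on_vec)
  fix l
  consider "l = k" | "l = k+1" | "l \<noteq> k" "l \<noteq> k+1" by blast
  then show "smooth_on (slice_domain k) (\<lambda>x. slice k x $ l)"
  proof cases
    case 3
    then show ?thesis
      by (auto simp: slice_nth slice_domain_def
          intro!: smooth_on_bounded_linear[OF bounded_linear_of_real] smooth_on_sqrt smooth_slice_radius)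
  qed (auto simp: slice_nth smooth_coord)
qed

lemma smooth_on_nth: "smooth_on S (\<lambda>z::'a::euclidean_space^'n. z$l)"
  by (intro smooth_on_bounded_linear[OF bounded_linear_vec_nth] smooth_on_ident)

lemma smooth_on_of_coords:
  assumes "smooth_on S f" "smooth_on S g" shows "smooth_on S (\<lambda>x. of_coords (f x) (g x))"
proof (rule smooth_on_vec)
  fix i :: 4
  show "smooth_on S (\<lambda>x. of_coords (f x) (g x) $ i)"
    using exhaust_4[of i] smooth_on_bounded_linear[OF bounded_linear_Re] assms
      smooth_on_bounded_linear[OF bounded_linear_Im] by (auto simp: of_coords_nth)
qed

lemma smooth_slice_coords: "smooth_on (off_axes k) (slice_coords k)"
  unfolding slice_coords_def[abs_def] phase_product_def
  by (intro smooth_on_of_coords smooth_on_mult smooth_on_prod smooth_on_powi smooth_on_sgn smooth_on_nth)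
    (auto simp: off_axes_def sgn_zero_iff)

definition vertex_domain :: "8 \<Rightarrow> (complex^8) set set" where
  "vertex_domain k = \<tau> ` (W \<inter> off_axes k)"

text \<open>By invariance the choice of a representative is immaterial.\<close>

definition orbit_coords :: "8 \<Rightarrow> (complex^8) set \<Rightarrow> real^4" where
  "orbit_coords k p = slice_coords k (SOME z. z \<in> p)"

definition vertex_chart :: "8 \<Rightarrow> (complex^8) set chart" where
  "vertex_chart k = (vertex_domain k, orbit_coords k)"

lemma orbit_coords_\<tau> [simp]: "orbit_coords k (\<tau> z) = slice_coords k z"
proof -
  have "(SOME w. w \<in> \<tau> z) \<in> \<tau> z" using mem_\<tau>_self by (rule someI)
  then show ?thesis by (simp add: orbit_coords_def slice_coords_invariant)
qed

lemma orbit_off_axes: "w \<in> \<tau> z \<Longrightarrow> z \<in> off_axes k \<Longrightarrow> w \<in> off_axes k"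
  using orbit_cmod[of w z] by (simp add: off_axes_def) (metis norm_eq_zero)

lemma \<tau>_mem_vertex_domain: "z \<in> W \<Longrightarrow> \<tau> z \<in> vertex_domain k \<longleftrightarrow> z \<in> off_axes k"
  unfolding vertex_domain_def using orbit_off_axes \<tau>_eq_iff by blast

lemma vertex_domainE:
  assumes "p \<in> vertex_domain k"
  obtains x where "x \<in> slice_domain k" "p = \<tau> (slice k x)" "orbit_coords k p = x"
proof -
  obtain z where z: "z \<in> W" "z \<in> off_axes k" "p = \<tau> z" using assms by (auto simp: vertex_domain_def)
  show ?thesis
    by (rule that[of "slice_coords k z"]) (simp_all add: z slice_coords_mem_domain slice_meets_orbit)
qed

lemma \<tau>_slice:
  assumes "x \<in> slice_domain k"
  shows "\<tau> (slice k x) \<in> vertex_domain k" "orbit_coords k (\<tau> (slice k x)) = x"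
  using assms by (simp_all add: slice_coords_slice \<tau>_mem_vertex_domain slice_mem_W slice_off_axes)

lemma vertex_chart_image: "orbit_coords k ` vertex_domain k = slice_domain k"
proof
  show "orbit_coords k ` vertex_domain k \<subseteq> slice_domain k" by (auto elim!: vertex_domainE)
  show "slice_domain k \<subseteq> orbit_coords k ` vertex_domain k"
    using \<tau>_slice by (metis image_eqI subsetI)
qed

lemma inv_into_vertex_chart:
  assumes "x \<in> slice_domain k"
  shows "inv_into (vertex_domain k) (orbit_coords k) x = \<tau> (slice k x)"
proof (rule inv_into_f_eq)
  show "inj_on (orbit_coords k) (vertex_domain k)"
    by (rule inj_onI) (auto elim!: vertex_domainE simp: slice_coords_slice)
qed (use \<tau>_slice[OF assms] in auto)

lemma openin_vertex_domain: "openin quotient_top (vertex_domain k)"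
proof -
  have "{z \<in> W. \<tau> z \<in> vertex_domain k} = W \<inter> off_axes k" using \<tau>_mem_vertex_domain by blast
  then show ?thesis
    unfolding openin_quotient_top using open_off_axes
    by (auto simp: vertex_domain_def openin_open_Int)
qed

text \<open>The inverse \<open>\<tau> \<circ> slice k\<close> is continuous because it factors through \<open>W\<close>.\<close>

lemma homeomorphic_map_vertex_chart:
  "homeomorphic_map (subtopology quotient_top (vertex_domain k)) (top_of_set (slice_domain k)) (orbit_coords k)"
  unfolding homeomorphic_map_maps
proof (rule exI[of _ "\<lambda>x. \<tau> (slice k x)"])
  let ?X = "subtopology quotient_top (vertex_domain k)"
  have oX: "openin ?X S \<longleftrightarrow> openin quotient_top S \<and> S \<subseteq> vertex_domain k" for S
    by (rule openin_open_subtopology[OF openin_vertex_domain])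
  have tX: "topspace ?X = vertex_domain k"
    using openin_subset[OF openin_vertex_domain] by auto
  have "continuous_map ?X (top_of_set (slice_domain k)) (orbit_coords k)"
    unfolding continuous_map_def tX
  proof (intro conjI allI impI funcsetI)
    show "orbit_coords k p \<in> topspace (top_of_set (slice_domain k))" if "p \<in> vertex_domain k" for p
      using that vertex_chart_image by auto
    fix V assume "openin (top_of_set (slice_domain k)) V"
    then obtain V' where V': "open V'" "V = slice_domain k \<inter> V'" by (auto simp: openin_open)
    have "open (off_axes k \<inter> slice_coords k -` V')"
      using continuous_on_open_vimage[OF open_off_axes] smooth_on_continuous_on[OF smooth_slice_coords] V'(1)
      by (metis Int_commute)
    moreover have "{z \<in> W. \<tau> z \<in> {p \<in> vertex_domain k. orbit_coords k p \<in> V}} =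
        W \<inter> (off_axes k \<inter> slice_coords k -` V')"
      using \<tau>_mem_vertex_domain slice_coords_mem_domain by (auto simp: V')
    ultimately have "openin (top_of_set W) {z \<in> W. \<tau> z \<in> {p \<in> vertex_domain k. orbit_coords k p \<in> V}}"
      by (metis openin_open_Int)
    then show "openin ?X {p \<in> vertex_domain k. orbit_coords k p \<in> V}"
      unfolding oX openin_quotient_top by (auto simp: vertex_domain_def)
  qed
  moreover have "continuous_map (top_of_set (slice_domain k)) ?X (\<lambda>x. \<tau> (slice k x))"
    unfolding continuous_map_def tX
  proof (intro conjI allI impI funcsetI)
    show "\<tau> (slice k x) \<in> vertex_domain k" if "x \<in> topspace (top_of_set (slice_domain k))" for x
      using that \<tau>_slice by auto
    fix S assume "openin ?X S"
    then have "openin (top_of_set W) {z \<in> W. \<tau> z \<in> S}" by (simp add: oX openin_quotient_top)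
    then obtain O' where O': "open O'" "{z \<in> W. \<tau> z \<in> S} = W \<inter> O'" by (auto simp: openin_open)
    have "{x \<in> slice_domain k. \<tau> (slice k x) \<in> S} = slice_domain k \<inter> slice k -` O'"
      using O'(2) slice_mem_W by blast
    moreover have "open (slice_domain k \<inter> slice k -` O')"
      using continuous_on_open_vimage[OF open_slice_domain] smooth_on_continuous_on[OF smooth_slice] O'(1)
      by (metis Int_commute)
    ultimately show "openin (top_of_set (slice_domain k)) {x \<in> topspace (top_of_set (slice_domain k)). \<tau> (slice k x) \<in> S}"
      by (simp add: openin_open_eq[OF open_slice_domain])
  qed
  moreover have "\<forall>p\<in>vertex_domain k. \<tau> (slice k (orbit_coords k p)) = p"
    by (auto elim!: vertex_domainE)
  ultimately show "homeomorphic_maps ?X (top_of_set (slice_domain k)) (orbit_coords k) (\<lambda>x. \<tau> (slice k x))"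
    unfolding homeomorphic_maps_def tX by (simp add: slice_coords_slice)
qed

text \<open>The slice itself is a smooth lift of the inverse of the chart.\<close>

lemma vertex_chart_mem: "vertex_chart k \<in> quotient_charts"
  unfolding vertex_chart_def quotient_charts_def
proof (clarsimp simp only: mem_Collect_eq prod.case vertex_chart_image, intro conjI ballI)
  have "{z \<in> W. \<tau> z \<in> vertex_domain k} \<subseteq> off_axes k" using \<tau>_mem_vertex_domain by blast
  then have "smooth_on {z \<in> W. \<tau> z \<in> vertex_domain k} (slice_coords k)"
    by (rule smooth_on_subset[OF smooth_slice_coords])
  then show "smooth_on {z \<in> W. \<tau> z \<in> vertex_domain k} (orbit_coords k \<circ> \<tau>)"
    by (simp add: comp_def)
  fix x assume "x \<in> slice_domain k"
  then show "\<exists>V \<sigma>. open V \<and> x \<in> V \<and> V \<subseteq> slice_domain k \<and> smooth_on V \<sigma> \<and>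
        (\<forall>y\<in>V. \<sigma> y \<in> W \<and> \<tau> (\<sigma> y) = inv_into (vertex_domain k) (orbit_coords k) y)"
    using open_slice_domain smooth_slice
    by (intro exI[of _ "slice_domain k"] exI[of _ "slice k"])
       (auto simp: slice_mem_W inv_into_vertex_chart)
qed (auto simp: openin_vertex_domain open_slice_domain homeomorphic_map_vertex_chart)

section \<open>The symplectic form in a vertex chart\<close>

text \<open>The form \<open>\<omega>\<^sub>s\<^sub>t\<close> of \<open>\<complex>\<^sup>2\<close>; it will turn out to be \<open>\<omega>\<close> in every vertex chart.\<close>

definition std_form :: "real^4 \<Rightarrow> real^4 \<Rightarrow> real" where
  "std_form u v = Im (coord1 u * cnj (coord1 v)) + Im (coord2 u * cnj (coord2 v))"

lemma coord_linear:
  "coord1 (x + y) = coord1 x + coord1 y" "coord2 (x + y) = coord2 x + coord2 y"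
  "coord1 (r *\<^sub>R x) = r *\<^sub>R coord1 x" "coord2 (r *\<^sub>R x) = r *\<^sub>R coord2 x"
  "coord1 0 = 0" "coord2 0 = 0"
  by (simp_all add: coord1_def coord2_def complex_eq_iff)

lemma bilinear_std_form: "bilinear std_form"
  unfolding bilinear_def by (auto intro!: linearI simp: std_form_def coord_linear algebra_simps)

lemma \<omega>_st_eq: "\<omega>_st u v = (\<Sum>l\<in>UNIV. Im (u$l * cnj (v$l)))"
proof -
  have "u$l * cnj (v$l) - v$l * cnj (u$l) = 2 * \<i> * of_real (Im (u$l * cnj (v$l)))" for l
    by (simp add: complex_eq_iff algebra_simps)
  then have "(\<Sum>l\<in>UNIV. u$l * cnj (v$l) - v$l * cnj (u$l)) =
      2 * \<i> * of_real (\<Sum>l\<in>UNIV. Im (u$l * cnj (v$l)))"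
    by (simp only: sum_distrib_left of_real_sum)
  then show ?thesis by (simp add: \<omega>_st_def)
qed

text \<open>The condition characterizing \<open>\<omega>\<close> in a chart, as a predicate, so that it can be transported from
  one chart to another.\<close>

definition pulls_back :: "(complex^8) set chart \<Rightarrow> (complex^8) set \<Rightarrow> (real^4 \<Rightarrow> real^4 \<Rightarrow> real) \<Rightarrow> bool" where
  "pulls_back c p B \<longleftrightarrow> bilinear B \<and>
     (\<forall>w\<in>W. \<tau> w = p \<longrightarrow> (\<forall>\<gamma> \<delta>. curve_through W w \<gamma> \<and> curve_through W w \<delta> \<longrightarrow>
        B (velocity (snd c \<circ> \<tau> \<circ> \<gamma>)) (velocity (snd c \<circ> \<tau> \<circ> \<delta>)) =
        \<omega>_st (velocity \<gamma>) (velocity \<delta>)))"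

lemma quotient_form_eq: "quotient_form c p = (THE B. pulls_back c p B)"
  by (simp add: quotient_form_def pulls_back_def)

lemma curve_throughD:
  assumes "curve_through S w \<gamma>"
  shows "\<gamma> 0 = w" "(\<gamma> has_vector_derivative velocity \<gamma>) (at 0)" "eventually (\<lambda>s. \<gamma> s \<in> S) (nhds 0)"
proof -
  obtain e where e: "e > 0" "smooth_on {-e<..<e} \<gamma>" "\<gamma> ` {-e<..<e} \<subseteq> S" and "\<gamma> 0 = w"
    using assms by (auto simp: curve_through_def)
  then show "\<gamma> 0 = w" by simp
  have "\<gamma> differentiable (at 0)" using smooth_on_differentiable[OF e(2)] e(1) by simp
  then show "(\<gamma> has_vector_derivative velocity \<gamma>) (at 0)"
    by (simp add: velocity_def vector_derivative_works)
  have "eventually (\<lambda>s. s \<in> {-e<..<e}) (nhds 0)"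
    by (rule eventually_nhds_in_open) (use e in auto)
  then show "eventually (\<lambda>s. \<gamma> s \<in> S) (nhds 0)"
    by (rule eventually_mono) (use e in auto)
qed

lemma velocityI: "(\<gamma> has_vector_derivative v) (at 0) \<Longrightarrow> velocity \<gamma> = v"
  by (simp add: velocity_def vector_derivative_at)

lemma has_vector_derivative_sgn:
  fixes f :: "real \<Rightarrow> complex"
  assumes "(f has_vector_derivative f') (at t)" "f t \<noteq> 0"
  shows "((\<lambda>s. sgn (f s)) has_vector_derivative \<i> * of_real (Im (f' / f t)) * sgn (f t)) (at t)"
proof -
  have f: "(f has_derivative (\<lambda>x. x *\<^sub>R f')) (at t)"
    using assms(1) by (simp add: has_vector_derivative_def)
  have n: "((\<lambda>s. norm (f s)) has_derivative (\<lambda>x. (x *\<^sub>R f') \<bullet> sgn (f t))) (at t)"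
    using has_derivative_compose[OF f has_derivative_norm[OF assms(2)]] by simp
  have i: "((\<lambda>s. inverse (norm (f s))) has_derivative
     (\<lambda>x. - (inverse (norm (f t)) * ((x *\<^sub>R f') \<bullet> sgn (f t)) * inverse (norm (f t))))) (at t)"
    by (rule Deriv.has_derivative_inverse[OF _ n]) (use assms(2) in auto)
  let ?n = "cmod (f t)"
  have "inverse ?n *\<^sub>R f' + (- (inverse ?n * (f' \<bullet> sgn (f t)) * inverse ?n)) *\<^sub>R f t =
      \<i> * of_real (Im (f' / f t)) * sgn (f t)"
  proof -
    define q where "q = f' / f t"
    have f': "f' = q * f t" using assms(2) by (simp add: q_def)
    have "f' \<bullet> sgn (f t) = inverse ?n * (f' \<bullet> f t)" by (simp add: sgn_div_norm)
    also have "f' \<bullet> f t = Re (f' * cnj (f t))" by (simp add: inner_complex_def)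
    also have "f' * cnj (f t) = q * of_real (?n\<^sup>2)" by (simp add: f' complex_norm_square[symmetric] mult.assoc)
    also have "inverse ?n * Re (q * of_real (?n\<^sup>2)) = Re q * ?n"
      using assms(2) by (simp add: power2_eq_square)
    finally have radial: "inverse ?n * (f' \<bullet> sgn (f t)) * inverse ?n = Re q * inverse ?n"
      using assms(2) by simp
    have "inverse ?n *\<^sub>R f' + (- (inverse ?n * (f' \<bullet> sgn (f t)) * inverse ?n)) *\<^sub>R f t =
        (q - of_real (Re q)) * (inverse ?n *\<^sub>R f t)"
      unfolding radial by (simp add: f' scaleR_conv_of_real algebra_simps)
    also have "q - of_real (Re q) = \<i> * of_real (Im q)" by (simp add: complex_eq_iff)
    finally show ?thesis by (simp add: sgn_div_norm q_def)
  qed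
  moreover have "((\<lambda>s. inverse (norm (f s)) *\<^sub>R f s) has_derivative
     (\<lambda>x. x *\<^sub>R (inverse ?n *\<^sub>R f' + (- (inverse ?n * (f' \<bullet> sgn (f t)) * inverse ?n)) *\<^sub>R f t))) (at t)"
    by (rule has_derivative_eq_rhs[OF has_derivative_scaleR[OF i f]])
      (auto simp: fun_eq_iff algebra_simps)
  ultimately show ?thesis by (simp only: has_vector_derivative_def sgn_div_norm)
qed

text \<open>The slice coordinates are products of powers of phases, so derivatives are kept in the
  logarithmic form \<open>rate * value\<close>: rates are multiplied by exponents and added over factors.\<close>

lemma has_vector_derivative_powi_log:
  fixes f :: "real \<Rightarrow> complex"
  assumes "(f has_vector_derivative c * f t) (at t)" "f t \<noteq> 0"
  shows "((\<lambda>s. f s powi m) has_vector_derivative of_int m * c * f t powi m) (at t)"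
proof -
  have "((\<lambda>z. z powi m) has_field_derivative of_int m * f t powi (m - 1) * 1) (at (f t))"
    by (rule DERIV_power_int) (auto simp: assms(2))
  from field_vector_diff_chain_at[OF assms(1) this]
  have "((\<lambda>s. f s powi m) has_vector_derivative c * f t * (of_int m * f t powi (m - 1))) (at t)"
    by (simp add: comp_def)
  moreover have "f t * f t powi (m - 1) = f t powi m"
    using assms(2) by (metis diff_add_cancel power_int_add_1')
  ultimately show ?thesis by (metis (no_types, lifting) mult.assoc mult.commute)
qed

lemma has_vector_derivative_prod_log:
  fixes f :: "'i \<Rightarrow> real \<Rightarrow> complex"
  assumes "finite I" "\<And>i. i \<in> I \<Longrightarrow> (f i has_vector_derivative c i * f i t) (at t)"
  shows "((\<lambda>s. \<Prod>i\<in>I. f i s) has_vector_derivative (\<Sum>i\<in>I. c i) * (\<Prod>i\<in>I. f i t)) (at t)"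
  using assms
proof (induction I rule: finite_induct)
  case (insert i I)
  have "((\<lambda>s. f i s * (\<Prod>i\<in>I. f i s)) has_vector_derivative
      f i t * ((\<Sum>i\<in>I. c i) * (\<Prod>i\<in>I. f i t)) + c i * f i t * (\<Prod>i\<in>I. f i t)) (at t)"
    by (intro has_vector_derivative_mult insert) auto
  then show ?case using insert.hyps by (simp add: algebra_simps)
qed simp

definition angular_velocity :: "complex^8 \<Rightarrow> complex^8 \<Rightarrow> 8 \<Rightarrow> real" where
  "angular_velocity w u l = Im (u$l / w$l)"

lemma has_vector_derivative_nth:
  assumes "(\<gamma> has_vector_derivative v) F"
  shows "((\<lambda>s. \<gamma> s $ l) has_vector_derivative v $ l) F"
  using bounded_linear.has_vector_derivative[OF bounded_linear_vec_nth assms] .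

lemma phase_product_derivative:
  assumes "(\<gamma> has_vector_derivative v) (at t)" "\<gamma> t \<in> off_axes k"
  shows "((\<lambda>s. phase_product k m (\<gamma> s)) has_vector_derivative
     \<i> * of_real (\<Sum>l\<in>-{k,k+1}. m l * angular_velocity (\<gamma> t) v l) * phase_product k m (\<gamma> t)) (at t)"
proof -
  have "((\<lambda>s. sgn (\<gamma> s $ l) powi m l) has_vector_derivative
     (of_int (m l) * (\<i> * of_real (angular_velocity (\<gamma> t) v l))) * sgn (\<gamma> t $ l) powi m l) (at t)" if "l \<in> -{k,k+1}" for l
  proof -
    have "\<gamma> t $ l \<noteq> 0" using assms(2) that by (auto simp: off_axes_def)
    then show ?thesis
      unfolding angular_velocity_def
      by (intro has_vector_derivative_powi_log has_vector_derivative_sgn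
          has_vector_derivative_nth[OF assms(1)]) (auto simp: sgn_zero_iff)
  qed
  from has_vector_derivative_prod_log[OF _ this, of "-{k,k+1}"]
  show ?thesis
    by (simp add: phase_product_def sum_distrib_left mult.left_commute)
qed

lemma slice_coords_derivative:
  assumes "(\<gamma> has_vector_derivative v) (at t)" "\<gamma> t \<in> off_axes k"
  shows "((\<lambda>s. slice_coords k (\<gamma> s)) has_vector_derivative of_coords
     (phase_product k (\<lambda>l. det_normals l (k+1)) (\<gamma> t) *
        (v$k + \<i> * \<gamma> t $ k * of_real (\<Sum>l\<in>-{k,k+1}. det_normals l (k+1) * angular_velocity (\<gamma> t) v l)))
     (phase_product k (det_normals k) (\<gamma> t) *
        (v$(k+1) + \<i> * \<gamma> t $ (k+1) * of_real (\<Sum>l\<in>-{k,k+1}. det_normals k l * angular_velocity (\<gamma> t) v l)))) (at t)"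
proof -
  have "linear (\<lambda>(a,b). of_coords a b)"
    by (rule linearI) (auto simp: vec_eq_iff forall_4 of_coords_nth)
  then have bl: "bounded_linear (\<lambda>(a,b). of_coords a b)" by (simp add: linear_conv_bounded_linear)
  have "((\<lambda>s. (\<lambda>(a,b). of_coords a b) (phase_product k (\<lambda>l. det_normals l (k+1)) (\<gamma> s) * \<gamma> s $ k,
         phase_product k (det_normals k) (\<gamma> s) * \<gamma> s $ (k+1))) has_vector_derivative
     (\<lambda>(a,b). of_coords a b)
     (phase_product k (\<lambda>l. det_normals l (k+1)) (\<gamma> t) * v$k +
       \<i> * of_real (\<Sum>l\<in>-{k,k+1}. det_normals l (k+1) * angular_velocity (\<gamma> t) v l) *
         phase_product k (\<lambda>l. det_normals l (k+1)) (\<gamma> t) * \<gamma> t $ k,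
      phase_product k (det_normals k) (\<gamma> t) * v$(k+1) +
       \<i> * of_real (\<Sum>l\<in>-{k,k+1}. det_normals k l * angular_velocity (\<gamma> t) v l) *
         phase_product k (det_normals k) (\<gamma> t) * \<gamma> t $ (k+1))) (at t)"
    by (intro bounded_linear.has_vector_derivative[OF bl] has_vector_derivative_Pair has_vector_derivative_mult
        phase_product_derivative assms has_vector_derivative_nth[OF assms(1)])
  then show ?thesis by (simp add: slice_coords_def algebra_simps)
qed

text \<open>The derivative of the relation between the squared moduli along a curve in \<open>W\<close>: the radial
  velocities off the vertex are integer combinations of the two at the vertex.\<close>

lemma W_tangent:
  assumes "curve_through W w \<gamma>"
  shows "w$l \<bullet> velocity \<gamma> $ l = det_normals l (k+1) * (w$k \<bullet> velocity \<gamma> $ k) +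
    det_normals k l * (w$(k+1) \<bullet> velocity \<gamma> $ (k+1))"
proof -
  note c = curve_throughD[OF assms]
  have d: "((\<lambda>s. (cmod (\<gamma> s $ l))\<^sup>2) has_real_derivative 2 * (w$l \<bullet> velocity \<gamma> $ l)) (at 0)" for l
  proof -
    have *: "((\<lambda>s. \<gamma> s $ l) has_derivative (\<lambda>x. x *\<^sub>R velocity \<gamma> $ l)) (at 0)"
      using has_vector_derivative_nth[OF c(2)] by (simp add: has_vector_derivative_def)
    show ?thesis
      unfolding power2_norm_eq_inner has_field_derivative_def
      by (rule has_derivative_eq_rhs[OF has_derivative_inner[OF * *]])
        (auto simp: c(1) inner_commute)
  qed
  have "((\<lambda>s. slice_radius k (\<gamma> s $ k) (\<gamma> s $ (k+1)) l) has_real_derivative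
      det_normals l (k+1) * (2 * (w$k \<bullet> velocity \<gamma> $ k)) +
      det_normals k l * (2 * (w$(k+1) \<bullet> velocity \<gamma> $ (k+1)))) (at 0)"
    unfolding slice_radius_def
    by (rule DERIV_cong[OF DERIV_add[OF DERIV_add[OF DERIV_const DERIV_cmult[OF d]] DERIV_cmult[OF d]]]) simp
  moreover have "eventually (\<lambda>s. (cmod (\<gamma> s $ l))\<^sup>2 = slice_radius k (\<gamma> s $ k) (\<gamma> s $ (k+1)) l) (nhds 0)"
    using c(3) by (rule eventually_mono) (simp add: W_iff_slice[of _ k])
  ultimately have "((\<lambda>s. (cmod (\<gamma> s $ l))\<^sup>2) has_real_derivative
      det_normals l (k+1) * (2 * (w$k \<bullet> velocity \<gamma> $ k)) +
      det_normals k l * (2 * (w$(k+1) \<bullet> velocity \<gamma> $ (k+1)))) (at 0)"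
    by (subst DERIV_cong_ev[OF refl _ refl]) auto
  from DERIV_unique[OF this d] show ?thesis by simp
qed

text \<open>Area in polar coordinates around \<open>w\<close>: angular velocity is paired with radial velocity.\<close>

lemma Im_mult_cnj_polar:
  assumes "w \<noteq> 0"
  shows "Im (u * cnj v) = Im (u / w) * (w \<bullet> v) - (w \<bullet> u) * Im (v / w)"
proof -
  define p q where "p = u / w" and "q = v / w"
  have u: "u = p * w" "v = q * w" using assms by (simp_all add: p_def q_def)
  show ?thesis unfolding p_def[symmetric] q_def[symmetric] unfolding u inner_complex_def
    by (simp add: algebra_simps)
qed

lemma Im_mult_cnj_shear:
  "Im ((u + \<i> * w * of_real s) * cnj (v + \<i> * w * of_real t)) =
    Im (u * cnj v) + s * (w \<bullet> v) - (w \<bullet> u) * t"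
  by (simp add: inner_complex_def algebra_simps)

lemma Im_mult_cnj_unit:
  assumes "cmod p = 1" shows "Im ((p * u) * cnj (p * v)) = Im (u * cnj v)"
proof -
  have "(p * u) * cnj (p * v) = (p * cnj p) * (u * cnj v)" by simp
  also have "p * cnj p = 1" using assms by (simp add: complex_norm_square[symmetric])
  finally show ?thesis by (simp only: mult_1_left)
qed

text \<open>In a coordinate \<open>l\<close> off the vertex \<open>\<omega>\<^sub>s\<^sub>t\<close> pairs angular with radial velocities.  By
  \<open>W_tangent\<close> the radial ones are combinations of those in the coordinates \<open>k\<close> and \<open>k + 1\<close>, with
  the exponents of the slice coordinates as coefficients.  Summed over \<open>l\<close>, these terms are exactly
  the contribution of the moving phase factors in the velocity of the slice coordinates.\<close>

lemma pulls_back_std_form: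
  assumes "p \<in> vertex_domain k"
  shows "pulls_back (vertex_chart k) p std_form"
  unfolding pulls_back_def
proof (intro conjI bilinear_std_form ballI impI allI)
  fix w \<gamma> \<delta> assume w: "w \<in> W" "\<tau> w = p" and cv: "curve_through W w \<gamma> \<and> curve_through W w \<delta>"
  have off: "w \<in> off_axes k" using w assms \<tau>_mem_vertex_domain by blast
  let ?O = "-{k,k+1}"
  define u where "u = velocity \<gamma>"
  define v where "v = velocity \<delta>"
  define \<alpha> where "\<alpha> = (\<lambda>l. real_of_int (det_normals l (k+1)))"
  define \<beta> where "\<beta> = (\<lambda>l. real_of_int (det_normals k l))"
  define A where "A x = (\<Sum>l\<in>?O. \<alpha> l * angular_velocity w x l)" for x
  define B where "B x = (\<Sum>l\<in>?O. \<beta> l * angular_velocity w x l)" for x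
  have vel: "velocity (snd (vertex_chart k) \<circ> \<tau> \<circ> \<eta>) = of_coords
     (phase_product k (\<lambda>l. det_normals l (k+1)) w * (velocity \<eta> $ k + \<i> * w$k * of_real (A (velocity \<eta>))))
     (phase_product k (det_normals k) w * (velocity \<eta> $ (k+1) + \<i> * w$(k+1) * of_real (B (velocity \<eta>))))"
    if "curve_through W w \<eta>" for \<eta>
    using slice_coords_derivative[OF curve_throughD(2)[OF that], of k] curve_throughD(1)[OF that] off
    by (intro velocityI) (simp add: vertex_chart_def comp_def A_def B_def \<alpha>_def \<beta>_def)
  have lhs: "std_form (velocity (snd (vertex_chart k) \<circ> \<tau> \<circ> \<gamma>)) (velocity (snd (vertex_chart k) \<circ> \<tau> \<circ> \<delta>)) =
    Im (u$k * cnj (v$k)) + A u * (w$k \<bullet> v$k) - (w$k \<bullet> u$k) * A v +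
    (Im (u$(k+1) * cnj (v$(k+1))) + B u * (w$(k+1) \<bullet> v$(k+1)) - (w$(k+1) \<bullet> u$(k+1)) * B v)"
    unfolding std_form_def vel[OF conjunct1[OF cv]] vel[OF conjunct2[OF cv]] coords_of_coords
      Im_mult_cnj_unit[OF norm_phase_product[OF off]] Im_mult_cnj_shear u_def v_def ..
  have "(\<Sum>l\<in>?O. Im (u$l * cnj (v$l))) =
     (\<Sum>l\<in>?O. \<alpha> l * angular_velocity w u l * (w$k \<bullet> v$k) + \<beta> l * angular_velocity w u l * (w$(k+1) \<bullet> v$(k+1))
        - (\<alpha> l * angular_velocity w v l * (w$k \<bullet> u$k) + \<beta> l * angular_velocity w v l * (w$(k+1) \<bullet> u$(k+1))))"
  proof (rule sum.cong[OF refl])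
    fix l assume "l \<in> ?O"
    then have "w$l \<noteq> 0" using off by (auto simp: off_axes_def)
    from Im_mult_cnj_polar[OF this, of "u$l" "v$l"]
    show "Im (u$l * cnj (v$l)) = \<alpha> l * angular_velocity w u l * (w$k \<bullet> v$k) + \<beta> l * angular_velocity w u l * (w$(k+1) \<bullet> v$(k+1))
        - (\<alpha> l * angular_velocity w v l * (w$k \<bullet> u$k) + \<beta> l * angular_velocity w v l * (w$(k+1) \<bullet> u$(k+1)))"
      using W_tangent[OF conjunct1[OF cv], of l k] W_tangent[OF conjunct2[OF cv], of l k]
      by (simp add: angular_velocity_def u_def v_def \<alpha>_def \<beta>_def algebra_simps)
  qed
  also have "\<dots> = A u * (w$k \<bullet> v$k) + B u * (w$(k+1) \<bullet> v$(k+1)) -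
      (A v * (w$k \<bullet> u$k) + B v * (w$(k+1) \<bullet> u$(k+1)))"
    by (simp add: A_def B_def sum.distrib sum_subtractf sum_distrib_right)
  finally show "std_form (velocity (snd (vertex_chart k) \<circ> \<tau> \<circ> \<gamma>)) (velocity (snd (vertex_chart k) \<circ> \<tau> \<circ> \<delta>)) =
      \<omega>_st (velocity \<gamma>) (velocity \<delta>)"
    unfolding lhs unfolding \<omega>_st_eq sum_split_adjacent[of _ k] u_def[symmetric] v_def[symmetric] by simp
qed

text \<open>Straight lines in a vertex chart lift to \<open>W\<close>.  Thus every vector is the velocity of a projected
  curve, and at most one bilinear form can satisfy \<open>pulls_back\<close>.\<close>

lemma slice_line:
  assumes "x \<in> slice_domain k"
  shows "curve_through W (slice k x) (\<lambda>s. slice k (x + s *\<^sub>R u))"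
    and "velocity (orbit_coords k \<circ> \<tau> \<circ> (\<lambda>s. slice k (x + s *\<^sub>R u))) = u"
proof -
  let ?l = "\<lambda>s::real. x + s *\<^sub>R u"
  have sl: "smooth_on UNIV ?l"
    by (intro smooth_on_add smooth_on_const smooth_on_bounded_linear[OF bounded_linear_scaleR_left] smooth_on_ident)
  have "open (?l -` slice_domain k)"
    by (intro open_vimage open_slice_domain smooth_on_continuous_on[OF sl])
  moreover have "0 \<in> ?l -` slice_domain k" using assms by simp
  ultimately obtain e where e: "e > 0" "ball 0 e \<subseteq> ?l -` slice_domain k"
    using openE by blast
  then have sub: "{-e<..<e} \<subseteq> ?l -` slice_domain k"
    by (auto simp: subset_iff dist_real_def)
  have "smooth_on {-e<..<e} (\<lambda>s. slice k (?l s))"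
    by (rule smooth_on_compose[OF smooth_slice smooth_on_subset[OF sl]]) (use sub in auto)
  then show "curve_through W (slice k x) (\<lambda>s. slice k (x + s *\<^sub>R u))"
    unfolding curve_through_def using e(1) sub slice_mem_W by (auto intro!: exI[of _ e])
  have "((\<lambda>s. orbit_coords k (\<tau> (slice k (?l s)))) has_vector_derivative u) (at 0)"
  proof (rule has_vector_derivative_transform_within_open[where f = ?l and S = "{-e<..<e}"])
    show "(?l has_vector_derivative u) (at 0)"
      by (auto intro!: derivative_eq_intros)
    show "?l s = orbit_coords k (\<tau> (slice k (?l s)))" if "s \<in> {-e<..<e}" for s
      using \<tau>_slice(2)[of "?l s" k] that sub by auto
  qed (use e in auto)
  then show "velocity (orbit_coords k \<circ> \<tau> \<circ> (\<lambda>s. slice k (x + s *\<^sub>R u))) = u"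
    by (intro velocityI) (simp only: comp_def)
qed

lemma pulls_back_vertex_chart:
  assumes "p \<in> vertex_domain k"
  shows "pulls_back (vertex_chart k) p B \<longleftrightarrow> B = std_form"
proof
  assume B: "pulls_back (vertex_chart k) p B"
  obtain x where x: "x \<in> slice_domain k" "p = \<tau> (slice k x)" using vertex_domainE[OF assms] by metis
  have *: "C u v = \<omega>_st (velocity (\<lambda>s. slice k (x + s *\<^sub>R u))) (velocity (\<lambda>s. slice k (x + s *\<^sub>R v)))"
    if "pulls_back (vertex_chart k) p C" for C u v
  proof -
    have "snd (vertex_chart k) = orbit_coords k" by (simp add: vertex_chart_def)
    moreover have "C (velocity (snd (vertex_chart k) \<circ> \<tau> \<circ> (\<lambda>s. slice k (x + s *\<^sub>R u))))
        (velocity (snd (vertex_chart k) \<circ> \<tau> \<circ> (\<lambda>s. slice k (x + s *\<^sub>R v)))) =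
        \<omega>_st (velocity (\<lambda>s. slice k (x + s *\<^sub>R u))) (velocity (\<lambda>s. slice k (x + s *\<^sub>R v)))"
      using that slice_mem_W[OF x(1)] x(2) slice_line(1)[OF x(1)] unfolding pulls_back_def by blast
    ultimately show ?thesis by (simp only: slice_line(2)[OF x(1)])
  qed
  show "B = std_form"
    by (intro ext) (simp add: *[OF B] *[OF pulls_back_std_form[OF assms]])
qed (simp add: pulls_back_std_form assms)

lemma form_vertex_chart: "p \<in> vertex_domain k \<Longrightarrow> form M (vertex_chart k) p = std_form"
  by (simp add: M_def quotient_form_eq pulls_back_vertex_chart)

section \<open>Independence of the chart\<close>

lemma has_derivative_cong_nhds:
  assumes "(f has_derivative f') (at x)" "eventually (\<lambda>y. f y = g y) (nhds x)"
  shows "(g has_derivative f') (at x)"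
  using has_derivative_transform_eventually[OF assms(1), of g] assms(2)
  by (simp add: eventually_nhds_conv_at)

lemma differentiable_tendsto_nhds: "f differentiable (at x) \<Longrightarrow> (f \<longlongrightarrow> f x) (nhds x)"
  using differentiable_imp_continuous_within[of f x UNIV]
  by (simp add: continuous_at tendsto_at_iff_tendsto_nhds)

lemma std_form_nondegenerate:
  assumes "\<And>v. std_form u v = std_form u' v" shows "u = u'"
proof -
  have "std_form u (of_coords 1 0) = std_form u' (of_coords 1 0)"
    "std_form u (of_coords \<i> 0) = std_form u' (of_coords \<i> 0)"
    "std_form u (of_coords 0 1) = std_form u' (of_coords 0 1)"
    "std_form u (of_coords 0 \<i>) = std_form u' (of_coords 0 \<i>)"
    using assms by blast+
  then show ?thesis by (intro coords_eqI complex_eqI) (simp_all add: std_form_def)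
qed

lemma quotient_chartD:
  assumes "c \<in> quotient_charts"
  shows "openin quotient_top (fst c)" "inj_on (snd c) (fst c)"
    "smooth_on {z\<in>W. \<tau> z \<in> fst c} (snd c \<circ> \<tau>)"
    "p \<in> fst c \<Longrightarrow> \<exists>V \<sigma>. open V \<and> snd c p \<in> V \<and> smooth_on V \<sigma> \<and>
        (\<forall>y\<in>V. \<sigma> y \<in> W \<and> \<tau> (\<sigma> y) = inv_into (fst c) (snd c) y)"
proof -
  obtain U \<phi> where c: "c = (U, \<phi>)" by (cases c)
  have *: "openin quotient_top U" 
     "homeomorphic_map (subtopology quotient_top U) (top_of_set (\<phi> ` U)) \<phi>"
     "smooth_on {z\<in>W. \<tau> z \<in> U} (\<phi> \<circ> \<tau>)"
     "\<forall>x\<in>\<phi> ` U. \<exists>V \<sigma>. open V \<and> x \<in> V \<and> V \<subseteq> \<phi> ` U \<and> smooth_on V \<sigma> \<and>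
        (\<forall>y\<in>V. \<sigma> y \<in> W \<and> \<tau> (\<sigma> y) = inv_into U \<phi> y)"
    using assms unfolding c quotient_charts_def by auto
  have "topspace (subtopology quotient_top U) = U"
    using openin_subset[OF *(1)] by auto
  then show "inj_on (snd c) (fst c)"
    using homeomorphic_imp_injective_map[OF *(2)] by (simp add: c)
  show "openin quotient_top (fst c)" "smooth_on {z\<in>W. \<tau> z \<in> fst c} (snd c \<circ> \<tau>)"
    using * by (simp_all add: c)
  show "\<exists>V \<sigma>. open V \<and> snd c p \<in> V \<and> smooth_on V \<sigma> \<and>
        (\<forall>y\<in>V. \<sigma> y \<in> W \<and> \<tau> (\<sigma> y) = inv_into (fst c) (snd c) y)" if "p \<in> fst c"
    using *(4) that unfolding c by fastforce
qed

text \<open>Let \<open>\<phi>\<close> be the coordinate map of \<open>c\<close>.  The transition \<open>T\<close> from the vertex chart is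
  \<open>\<phi> \<circ> \<tau>\<close> on the slice, and the opposite transition \<open>S\<close> is the slice coordinate map applied to a
  local lift of the inverse of \<open>\<phi>\<close>.  Both are differentiable at the point because an arbitrary chart
  provides exactly these two kinds of smoothness; being mutually inverse, they have mutually inverse
  derivatives.\<close>

lemma chart_transition:
  assumes c: "c \<in> quotient_charts" and p: "p \<in> fst c" "p \<in> vertex_domain k"
  obtains T S A A' where
    "linear A" "linear A'" "A \<circ> A' = id" "A' \<circ> A = id"
    "(T has_derivative A) (at (orbit_coords k p))"
    "\<And>z. z \<in> W \<Longrightarrow> z \<in> off_axes k \<Longrightarrow> T (slice_coords k z) = snd c (\<tau> z)"
    "(S has_derivative A') (at (snd c p))" "S (snd c p) = orbit_coords k p"
    "\<And>f :: _ \<Rightarrow> real. eventually (\<lambda>y. in_chart c f y = in_chart (vertex_chart k) f (S y)) (nhds (snd c p))"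
proof -
  note chart = quotient_chartD[OF c]
  obtain x0 where x0: "x0 \<in> slice_domain k" "p = \<tau> (slice k x0)" "orbit_coords k p = x0"
    using vertex_domainE[OF p(2)] by blast
  define T where "T x = snd c (\<tau> (slice k x))" for x
  obtain V \<sigma> where V: "open V" "snd c p \<in> V" and \<sigma>: "smooth_on V \<sigma>"
    "\<And>y. y \<in> V \<Longrightarrow> \<sigma> y \<in> W" "\<And>y. y \<in> V \<Longrightarrow> \<tau> (\<sigma> y) = inv_into (fst c) (snd c) y"
    using chart(4)[OF p(1)] by blast
  define S where "S y = slice_coords k (\<sigma> y)" for y
  obtain O' where O': "open O'" "{z \<in> W. \<tau> z \<in> fst c} = W \<inter> O'"
    using chart(1) by (auto simp: openin_quotient_top openin_open)
  have near0: "eventually (\<lambda>x. x \<in> slice_domain k) (nhds x0)"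
    by (rule eventually_nhds_in_open[OF open_slice_domain x0(1)])
  have diff_slice: "slice k differentiable (at x0)"
    by (rule smooth_on_differentiable[OF smooth_slice open_slice_domain x0(1)])
  then have slice_lim: "(slice k \<longlongrightarrow> slice k x0) (nhds x0)"
    by (rule differentiable_tendsto_nhds)
  have p_in: "slice k x0 \<in> {z \<in> W. \<tau> z \<in> fst c}" using x0 p(1) slice_mem_W by auto
  have inU: "eventually (\<lambda>x. \<tau> (slice k x) \<in> fst c) (nhds x0)"
  proof -
    have "eventually (\<lambda>x. slice k x \<in> O') (nhds x0)"
      using topological_tendstoD[OF slice_lim O'(1)] p_in O'(2) by auto
    with near0 show ?thesis
    proof eventually_elim
      case (elim x)
      then have "slice k x \<in> {z \<in> W. \<tau> z \<in> fst c}" unfolding O'(2) using slice_mem_W by simp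
      then show ?case by simp
    qed
  qed
  obtain V' g where V': "open V'" "slice k x0 \<in> V'" "\<And>n. Ck_on n V' g"
    "\<And>z. z \<in> {z \<in> W. \<tau> z \<in> fst c} \<Longrightarrow> z \<in> V' \<Longrightarrow> g z = (snd c \<circ> \<tau>) z"
    by (rule smooth_onE[OF chart(3) p_in]) (rule that)
  have "g differentiable (at (slice k x0))" using V'(2) V'(3)[of "Suc 0"] by simp
  then have "(\<lambda>x. g (slice k x)) differentiable (at x0)"
    using differentiable_chain_at[OF diff_slice] by (simp add: comp_def)
  then obtain A where A: "((\<lambda>x. g (slice k x)) has_derivative A) (at x0)"
    by (auto simp: differentiable_def)
  have "eventually (\<lambda>x. g (slice k x) = T x) (nhds x0)"
  proof -
    have "eventually (\<lambda>x. slice k x \<in> V') (nhds x0)"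
      using topological_tendstoD[OF slice_lim V'(1,2)] .
    with near0 inU show ?thesis
      by eventually_elim (simp add: V'(4) slice_mem_W T_def)
  qed
  then have TA: "(T has_derivative A) (at x0)"
    using has_derivative_cong_nhds[OF A] by blast
  have Tx0: "T x0 = snd c p" by (simp add: T_def x0)
  have \<sigma>p: "\<tau> (\<sigma> (snd c p)) = p"
    using \<sigma>(3)[OF V(2)] inv_into_f_f[OF chart(2) p(1)] by simp
  have \<sigma>off: "\<sigma> (snd c p) \<in> off_axes k"
    using \<sigma>(2)[OF V(2)] \<sigma>p p(2) \<tau>_mem_vertex_domain by metis
  have Sp: "S (snd c p) = x0"
    using orbit_coords_\<tau>[of k "\<sigma> (snd c p)"] \<sigma>p x0(3) by (simp add: S_def)
  have diff\<sigma>: "\<sigma> differentiable (at (snd c p))"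
    by (rule smooth_on_differentiable[OF \<sigma>(1) V])
  have "slice_coords k differentiable (at (\<sigma> (snd c p)))"
    by (rule smooth_on_differentiable[OF smooth_slice_coords open_off_axes \<sigma>off])
  then have "S differentiable (at (snd c p))"
    using differentiable_chain_at[OF diff\<sigma>] by (simp add: comp_def S_def[abs_def])
  then obtain A' where SA: "(S has_derivative A') (at (snd c p))" by (auto simp: differentiable_def)
  have "(T \<longlongrightarrow> snd c p) (nhds x0)"
    using differentiable_tendsto_nhds[of T x0] TA Tx0 by (auto simp: differentiable_def)
  then have "eventually (\<lambda>x. T x \<in> V) (nhds x0)" using topological_tendstoD V by blast
  with near0 inU have ST: "eventually (\<lambda>x. S (T x) = x) (nhds x0)"
  proof eventually_elim
    case (elim x)
    have "\<tau> (\<sigma> (T x)) = \<tau> (slice k x)"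
      using \<sigma>(3)[OF elim(3)] inv_into_f_f[OF chart(2) elim(2)] by (simp add: T_def)
    then show ?case
      using orbit_coords_\<tau>[of k "\<sigma> (T x)"] \<tau>_slice(2)[OF elim(1)] by (simp add: S_def)
  qed
  have "((\<lambda>x. S (T x)) has_derivative (\<lambda>v. A' (A v))) (at x0)"
    using has_derivative_compose[OF TA, of S A'] SA by (simp add: Tx0)
  then have "((\<lambda>x. x) has_derivative (\<lambda>v. A' (A v))) (at x0)"
    by (rule has_derivative_cong_nhds) (rule ST)
  then have "(\<lambda>v. A' (A v)) = (\<lambda>v. v)" using has_derivative_unique has_derivative_ident by blast
  then have A'A: "A' \<circ> A = id" by (simp add: fun_eq_iff)
  have lin: "linear A" "linear A'" using TA SA has_derivative_linear by blast+
  then have AA': "A \<circ> A' = id" using A'A linear_inverse_left by blast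
  have ev: "eventually (\<lambda>y. in_chart c f y = in_chart (vertex_chart k) f (S y)) (nhds (snd c p))" for f :: "_ \<Rightarrow> real"
  proof -
    have "(\<sigma> \<longlongrightarrow> \<sigma> (snd c p)) (nhds (snd c p))"
      by (rule differentiable_tendsto_nhds[OF diff\<sigma>])
    then have "eventually (\<lambda>y. \<sigma> y \<in> off_axes k) (nhds (snd c p))"
      using topological_tendstoD[OF _ open_off_axes \<sigma>off] by blast
    moreover have "eventually (\<lambda>y. y \<in> V) (nhds (snd c p))"
      by (rule eventually_nhds_in_open[OF V])
    ultimately show ?thesis
    proof eventually_elim
      case (elim y)
      then show ?case
        using \<sigma>(2,3)[OF elim(2)]
        by (simp add: in_chart_def vertex_chart_def S_def inv_into_vertex_chart slice_coords_mem_domain slice_meets_orbit)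
    qed
  qed
  have Tz: "T (slice_coords k z) = snd c (\<tau> z)" if "z \<in> W" "z \<in> off_axes k" for z
    using that by (simp add: T_def slice_meets_orbit)
  have TA': "(T has_derivative A) (at (orbit_coords k p))" using TA unfolding x0(3) .
  have Sp': "S (snd c p) = orbit_coords k p" using Sp unfolding x0(3) .
  show ?thesis
    by (rule that[of A A' T S]) (fact lin AA' A'A TA' Tz SA Sp' ev)+
qed

text \<open>The derivative \<open>A\<close> of the transition carries velocities to velocities, so \<open>\<omega>\<close> and differentials
  of functions in an arbitrary chart are pulled back by \<open>A'\<close> from the vertex chart.\<close>

lemma chart_change:
  assumes c: "c \<in> quotient_charts" and p: "p \<in> fst c" "p \<in> vertex_domain k"
  obtains A A' where "linear A" "linear A'" "A \<circ> A' = id" "A' \<circ> A = id"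
    "form M c p = (\<lambda>u v. std_form (A' u) (A' v))"
    "\<And>(f :: _ \<Rightarrow> real) D. (in_chart (vertex_chart k) f has_derivative D) (at (orbit_coords k p)) \<Longrightarrow>
       differential c f p = (\<lambda>v. D (A' v))"
proof -
  obtain T S A A' where A: "linear A" "linear A'" "A \<circ> A' = id" "A' \<circ> A = id"
    and T: "(T has_derivative A) (at (orbit_coords k p))"
    "\<And>z. z \<in> W \<Longrightarrow> z \<in> off_axes k \<Longrightarrow> T (slice_coords k z) = snd c (\<tau> z)"
    and S: "(S has_derivative A') (at (snd c p))" "S (snd c p) = orbit_coords k p"
    "\<And>f :: _ \<Rightarrow> real. eventually (\<lambda>y. in_chart c f y = in_chart (vertex_chart k) f (S y)) (nhds (snd c p))"
    by (rule chart_transition[OF c p]) (rule that)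
  have inv: "A (A' u) = u" "A' (A u) = u" for u using A(3,4) by (metis comp_apply id_apply)+
  have vel: "velocity (snd c \<circ> \<tau> \<circ> \<gamma>) = A (velocity (snd (vertex_chart k) \<circ> \<tau> \<circ> \<gamma>))"
    if cv: "curve_through W w \<gamma>" and w: "w \<in> W" "\<tau> w = p" for w \<gamma>
  proof -
    note \<gamma> = curve_throughD[OF cv]
    have off: "\<gamma> 0 \<in> off_axes k" using w p(2) \<tau>_mem_vertex_domain \<gamma>(1) by metis
    from slice_coords_derivative[OF \<gamma>(2) off]
    obtain v where v: "((\<lambda>s. slice_coords k (\<gamma> s)) has_vector_derivative v) (at 0)" by blast
    have "slice_coords k (\<gamma> 0) = orbit_coords k p" using w \<gamma>(1) by auto
    then have "((\<lambda>s. T (slice_coords k (\<gamma> s))) has_derivative (\<lambda>s. A (s *\<^sub>R v))) (at 0)"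
      using has_derivative_compose[OF v[unfolded has_vector_derivative_def], of T A] T(1) by simp
    then have "((\<lambda>s. T (slice_coords k (\<gamma> s))) has_vector_derivative A v) (at 0)"
      unfolding has_vector_derivative_def by (simp add: linear_scale[OF A(1)])
    moreover have "eventually (\<lambda>s. T (slice_coords k (\<gamma> s)) = snd c (\<tau> (\<gamma> s))) (nhds 0)"
    proof -
      have "(\<gamma> \<longlongrightarrow> \<gamma> 0) (nhds 0)"
        using \<gamma>(2) by (intro differentiable_tendsto_nhds) (auto simp: has_vector_derivative_def differentiable_def)
      then have "eventually (\<lambda>s. \<gamma> s \<in> off_axes k) (nhds 0)"
        using topological_tendstoD[OF _ open_off_axes off] by blast
      with \<gamma>(3) show ?thesis by eventually_elim (rule T(2))
    qed
    ultimately have "((\<lambda>s. snd c (\<tau> (\<gamma> s))) has_vector_derivative A v) (at 0)"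
      unfolding has_vector_derivative_def by (rule has_derivative_cong_nhds)
    then have "velocity (snd c \<circ> \<tau> \<circ> \<gamma>) = A v" by (intro velocityI) (simp add: comp_def)
    moreover have "velocity (snd (vertex_chart k) \<circ> \<tau> \<circ> \<gamma>) = v"
      by (intro velocityI) (use v in \<open>simp add: comp_def vertex_chart_def\<close>)
    ultimately show ?thesis by simp
  qed
  have bil: "bilinear (\<lambda>u v. B (L u) (L v))" if "bilinear B" "linear L" for B :: "real^4 \<Rightarrow> real^4 \<Rightarrow> real" and L
    using that unfolding bilinear_def by (auto intro: linear_compose[unfolded comp_def, OF \<open>linear L\<close>])
  have form: "form M c p = (\<lambda>u v. std_form (A' u) (A' v))"
    unfolding M_def manifold_with_form.simps quotient_form_eq
  proof (rule the_equality)
    show "pulls_back c p (\<lambda>u v. std_form (A' u) (A' v))"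
      using pulls_back_std_form[OF p(2)] unfolding pulls_back_def
      by (auto simp: vel inv bil[OF bilinear_std_form A(2)])
    fix B assume B: "pulls_back c p B"
    then have "pulls_back (vertex_chart k) p (\<lambda>u v. B (A u) (A v))"
      unfolding pulls_back_def using bil[OF _ A(1)] by (metis vel)
    then have "(\<lambda>u v. B (A u) (A v)) = std_form" by (simp add: pulls_back_vertex_chart[OF p(2)])
    then show "B = (\<lambda>u v. std_form (A' u) (A' v))" by (metis inv(1) ext)
  qed
  have "differential c f p = (\<lambda>v. D (A' v))"
    if "(in_chart (vertex_chart k) f has_derivative D) (at (orbit_coords k p))" for f :: "_ \<Rightarrow> real" and D
  proof -
    have "((\<lambda>y. in_chart (vertex_chart k) f (S y)) has_derivative (\<lambda>v. D (A' v))) (at (snd c p))"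
      using has_derivative_compose[OF S(1), of "in_chart (vertex_chart k) f" D] that by (simp add: S(2))
    then have "(in_chart c f has_derivative (\<lambda>v. D (A' v))) (at (snd c p))"
      by (rule has_derivative_cong_nhds) (use S(3)[of f] in \<open>simp add: eq_commute\<close>)
    then show ?thesis by (simp add: differential_def fun_eq_iff dir_deriv_eq)
  qed
  then show ?thesis using that[OF A form] by blast
qed

lemma ham_vf_change:
  assumes "linear A" "linear A'" "A \<circ> A' = id" "A' \<circ> A = id"
    and form: "form M c p = (\<lambda>u v. std_form (A' u) (A' v))"
    and diff: "differential c f p = (\<lambda>v. D (A' v))"
    and X: "\<And>v. std_form X v = D v"
  shows "ham_vf M c f p = A X"
  unfolding ham_vf_def form diff
proof (rule the_equality)
  have inv: "A (A' u) = u" "A' (A u) = u" for u using assms(3,4) by (metis comp_apply id_apply)+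
  show "\<forall>v. std_form (A' (A X)) (A' v) = D (A' v)" by (simp add: inv X)
  fix Y assume "\<forall>v. std_form (A' Y) (A' v) = D (A' v)"
  then have "std_form (A' Y) v = std_form X v" for v using inv(2)[of v] X by metis
  then have "A' Y = X" using std_form_nondegenerate by blast
  then show "Y = A X" using inv(1) by metis
qed

text \<open>Singular and fixed points are defined through some chart of the maximal atlas.  That the rank can
  be computed in a vertex chart, whatever the given chart is, excludes further such points.\<close>

lemma system_rank_eq:
  assumes "chart_at M p c" "p \<in> vertex_domain k"
    and f: "(in_chart (vertex_chart k) f has_derivative D) (at (orbit_coords k p))" "\<And>v. std_form X v = D v"
    and g: "(in_chart (vertex_chart k) g has_derivative E) (at (orbit_coords k p))" "\<And>v. std_form Y v = E v"
  shows "system_rank M c f g p = dim {X, Y}"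
proof -
  have c: "c \<in> quotient_charts" "p \<in> fst c" using assms(1) by (auto simp: chart_at_def M_def)
  obtain A A' where A: "linear A" "linear A'" "A \<circ> A' = id" "A' \<circ> A = id"
    and form: "form M c p = (\<lambda>u v. std_form (A' u) (A' v))"
    and diff: "\<And>(f :: _ \<Rightarrow> real) D. (in_chart (vertex_chart k) f has_derivative D) (at (orbit_coords k p)) \<Longrightarrow>
       differential c f p = (\<lambda>v. D (A' v))"
    by (rule chart_change[OF c assms(2)]) (rule that)
  have "inj A" using A(4) by (metis inj_on_id inj_on_imageI2)
  have "system_rank M c f g p = dim (A ` {X, Y})"
    unfolding system_rank_def
    using ham_vf_change[OF A form diff[OF f(1)], of X, OF f(2)]
      ham_vf_change[OF A form diff[OF g(1)], of Y, OF g(2)] by simp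
  also have "\<dots> = dim {X, Y}"
    by (rule dim_image_eq[OF A(1)]) (use \<open>inj A\<close> in \<open>auto intro: inj_on_subset\<close>)
  finally show ?thesis .
qed

section \<open>The squared moduli as Hamiltonians\<close>

context
  fixes f :: "(complex^8) set \<Rightarrow> real" and j :: 8
  assumes f: "\<And>z. z \<in> W \<Longrightarrow> f (\<tau> z) = 1/2 * (cmod (z$j))\<^sup>2"
begin

lemma in_vertex_chart_modulus:
  assumes "x \<in> slice_domain k"
  shows "in_chart (vertex_chart k) f x = 1/2 * slice_radius k (coord1 x) (coord2 x) j"
proof -
  have W: "slice k x \<in> W" by (rule slice_mem_W[OF assms])
  then have "(cmod (slice k x $ j))\<^sup>2 = slice_radius k (coord1 x) (coord2 x) j"
    unfolding W_iff_slice[of _ k] by (simp add: slice_nth)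
  then show ?thesis
    by (simp add: in_chart_def vertex_chart_def inv_into_vertex_chart[OF assms] f[OF W])
qed

lemma smooth_in_vertex_chart_modulus: "smooth_on (slice_domain k) (in_chart (vertex_chart k) f)"
proof (rule smooth_on_cong)
  show "smooth_on (slice_domain k) (\<lambda>x. 1/2 * slice_radius k (coord1 x) (coord2 x) j)"
    by (intro smooth_on_mult smooth_on_const smooth_slice_radius)
qed (rule in_vertex_chart_modulus)

lemma modulus_has_derivative:
  assumes "x \<in> slice_domain k"
  shows "(in_chart (vertex_chart k) f has_derivative
     (\<lambda>v. det_normals j (k+1) * (coord1 x \<bullet> coord1 v) + det_normals k j * (coord2 x \<bullet> coord2 v))) (at x)"
proof -
  have d: "(coord1 has_derivative coord1) (at x)" "(coord2 has_derivative coord2) (at x)"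
    by (auto intro: bounded_linear_imp_has_derivative bounded_linear_coord)
  have "((\<lambda>x. 1/2 * slice_radius k (coord1 x) (coord2 x) j) has_derivative
     (\<lambda>v. det_normals j (k+1) * (coord1 x \<bullet> coord1 v) + det_normals k j * (coord2 x \<bullet> coord2 v))) (at x)"
    unfolding slice_radius_def power2_norm_eq_inner
  proof (rule has_derivative_eq_rhs[OF has_derivative_mult_right[OF has_derivative_add[OF
          has_derivative_add[OF has_derivative_const has_derivative_mult_right[OF has_derivative_inner[OF d(1) d(1)]]]
          has_derivative_mult_right[OF has_derivative_inner[OF d(2) d(2)]]]]], rule ext)
    fix v
    have "coord1 v \<bullet> coord1 x = coord1 x \<bullet> coord1 v" "coord2 v \<bullet> coord2 x = coord2 x \<bullet> coord2 v"
      by (rule inner_commute)+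
    then show "1/2 * (0 + det_normals j (k+1) * (coord1 x \<bullet> coord1 v + coord1 v \<bullet> coord1 x) +
        det_normals k j * (coord2 x \<bullet> coord2 v + coord2 v \<bullet> coord2 x)) =
      det_normals j (k+1) * (coord1 x \<bullet> coord1 v) + det_normals k j * (coord2 x \<bullet> coord2 v)"
      by simp
  qed
  then show ?thesis
    by (rule has_derivative_transform_within_open[OF _ open_slice_domain assms])
      (simp only: in_vertex_chart_modulus)
qed

lemma hessian_modulus:
  assumes "orbit_coords k p = x" "x \<in> slice_domain k"
  shows "hessian (vertex_chart k) f p = (\<chi> i i'.
     det_normals j (k+1) * (coord1 (axis i 1) \<bullet> coord1 (axis i' 1)) +
     det_normals k j * (coord2 (axis i 1) \<bullet> coord2 (axis i' 1)))"
proof -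
  have d: "(coord1 has_derivative coord1) (at x)" "(coord2 has_derivative coord2) (at x)"
    by (auto intro: bounded_linear_imp_has_derivative bounded_linear_coord)
  have "dir_deriv (dir_deriv (in_chart (vertex_chart k) f) v) u x =
      det_normals j (k+1) * (coord1 u \<bullet> coord1 v) + det_normals k j * (coord2 u \<bullet> coord2 v)" for u v
  proof -
    have "dir_deriv (dir_deriv (in_chart (vertex_chart k) f) v) u x =
        dir_deriv (\<lambda>x. det_normals j (k+1) * (coord1 x \<bullet> coord1 v) + det_normals k j * (coord2 x \<bullet> coord2 v)) u x"
      by (rule dir_deriv_cong_open[OF open_slice_domain assms(2)]) (rule dir_deriv_eq[OF modulus_has_derivative])
    also have "\<dots> = det_normals j (k+1) * (coord1 u \<bullet> coord1 v) + det_normals k j * (coord2 u \<bullet> coord2 v)"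
      by (rule dir_deriv_eq) (auto intro!: derivative_eq_intros d)
    finally show ?thesis .
  qed
  then show ?thesis by (simp add: hessian_def vertex_chart_def assms(1) vec_eq_iff)
qed

end

text \<open>The Hamiltonian vector field of \<open>a |z|\<^sup>2 / 2 + b |w|\<^sup>2 / 2\<close> on \<open>\<complex>\<^sup>2\<close>.\<close>

definition rotation_field :: "real \<Rightarrow> real \<Rightarrow> real^4 \<Rightarrow> real^4" where
  "rotation_field a b x = of_coords (\<i> * of_real a * coord1 x) (\<i> * of_real b * coord2 x)"

lemma std_form_rotation_field:
  "std_form (rotation_field a b x) v = a * (coord1 x \<bullet> coord1 v) + b * (coord2 x \<bullet> coord2 v)"
  by (simp add: std_form_def rotation_field_def inner_complex_def algebra_simps)

lemma vertex_chart_at: "p \<in> vertex_domain k \<Longrightarrow> chart_at M p (vertex_chart k)"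
  using vertex_chart_mem by (simp add: chart_at_def M_def vertex_chart_def)

lemma M_cover:
  assumes "p \<in> points M" obtains k where "p \<in> vertex_domain k"
proof -
  obtain z where "z \<in> W" "p = \<tau> z" using assms by (auto simp: M_def)
  then show ?thesis using that W_cover[of z] by (auto simp: vertex_domain_def)
qed

lemma orbit_coords_mem: "p \<in> vertex_domain k \<Longrightarrow> orbit_coords k p \<in> slice_domain k"
  using vertex_chart_image by blast

lemma vertex_domain_points: "p \<in> vertex_domain k \<Longrightarrow> p \<in> points M"
  by (auto simp: vertex_domain_def M_def)

lemma ham_vf_modulus:
  assumes f: "\<And>z. z \<in> W \<Longrightarrow> f (\<tau> z) = 1/2 * (cmod (z$j))\<^sup>2"
    and p: "p \<in> vertex_domain k"
  shows "ham_vf M (vertex_chart k) f p =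
    rotation_field (det_normals j (k+1)) (det_normals k j) (orbit_coords k p)"
proof -
  have "differential (vertex_chart k) f p v =
      det_normals j (k+1) * (coord1 (orbit_coords k p) \<bullet> coord1 v) +
      det_normals k j * (coord2 (orbit_coords k p) \<bullet> coord2 v)" for v
    using dir_deriv_eq[OF modulus_has_derivative[of f j, OF f orbit_coords_mem[OF p]]]
    by (simp add: differential_def vertex_chart_def)
  then show ?thesis
    using std_form_rotation_field std_form_nondegenerate
    unfolding ham_vf_def form_vertex_chart[OF p] by (intro the_equality) (metis, metis)
qed

text \<open>As \<open>n\<^sub>1\<close> and \<open>n\<^sub>3\<close> are the standard basis, this is the determinant of \<open>n\<^sub>k, n\<^sub>k\<^sub>+\<^sub>1\<close> again.  It
  says that in a vertex chart \<open>J\<close> and \<open>H\<close> are, up to constants, unimodular integer combinations of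
  the halved squared moduli of the two complex coordinates.\<close>

lemma det_normals_J_H:
  "det_normals 1 (k+1) * det_normals k 3 - det_normals 3 (k+1) * det_normals k 1 = 1"
  using det_adjacent[of k] by (simp add: det_normals_def normal_nth algebra_simps)

lemma dim_pair:
  fixes u v :: "'a::euclidean_space"
  assumes "\<And>a b. a *\<^sub>R u + b *\<^sub>R v = 0 \<Longrightarrow> a = 0 \<and> b = 0"
  shows "dim {u, v} = 2"
proof -
  have "v \<noteq> 0" using assms[of 0 1] by auto
  have u: "u \<noteq> c *\<^sub>R v" for c using assms[of 1 "- c"] by auto
  then have "independent {u, v}"
    using \<open>v \<noteq> 0\<close> u[of 1] by (auto simp: independent_insert span_singleton)
  moreover have "u \<noteq> v" using u[of 1] by simp
  ultimately show ?thesis by (simp add: dim_eq_card_independent)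
qed

lemma rotation_fields_dependent:
  fixes a b :: real
  assumes "a *\<^sub>R rotation_field (det_normals 1 (k+1)) (det_normals k 1) x +
      b *\<^sub>R rotation_field (det_normals 3 (k+1)) (det_normals k 3) x = 0"
  shows "coord1 x = 0 \<or> det_normals 1 (k+1) * a + det_normals 3 (k+1) * b = 0"
    and "coord2 x = 0 \<or> det_normals k 1 * a + det_normals k 3 * b = 0"
proof -
  let ?v = "a *\<^sub>R rotation_field (det_normals 1 (k+1)) (det_normals k 1) x +
      b *\<^sub>R rotation_field (det_normals 3 (k+1)) (det_normals k 3) x"
  have "coord1 ?v = \<i> * of_real (det_normals 1 (k+1) * a + det_normals 3 (k+1) * b) * coord1 x"
    "coord2 ?v = \<i> * of_real (det_normals k 1 * a + det_normals k 3 * b) * coord2 x"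
    by (simp_all only: coord_linear rotation_field_def coords_of_coords)
      (simp_all add: scaleR_conv_of_real algebra_simps)
  then have "\<i> * of_real (det_normals 1 (k+1) * a + det_normals 3 (k+1) * b) * coord1 x = 0"
    "\<i> * of_real (det_normals k 1 * a + det_normals k 3 * b) * coord2 x = 0"
    unfolding assms by (simp_all only: coord_linear)
  then show "coord1 x = 0 \<or> det_normals 1 (k+1) * a + det_normals 3 (k+1) * b = 0"
    "coord2 x = 0 \<or> det_normals k 1 * a + det_normals k 3 * b = 0"
    by (simp_all only: mult_eq_0_iff of_real_eq_0_iff complex_i_not_zero) auto
qed

lemma coefficients_eq_0:
  fixes a b :: real
  assumes "det_normals 1 (k+1) * a + det_normals 3 (k+1) * b = 0"
    and "det_normals k 1 * a + det_normals k 3 * b = 0"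
  shows "a = 0 \<and> b = 0"
proof -
  let ?p = "real_of_int (det_normals 1 (k+1))" and ?q = "real_of_int (det_normals 3 (k+1))"
  let ?r = "real_of_int (det_normals k 1)" and ?s = "real_of_int (det_normals k 3)"
  have "real_of_int (det_normals 1 (k+1) * det_normals k 3 - det_normals 3 (k+1) * det_normals k 1) = 1"
    by (simp only: det_normals_J_H of_int_1)
  then have det: "?p * ?s - ?q * ?r = 1"
    by (simp only: of_int_diff of_int_mult)
  have "a * (?p * ?s - ?q * ?r) = ?s * (?p * a + ?q * b) - ?q * (?r * a + ?s * b)"
    "b * (?p * ?s - ?q * ?r) = ?p * (?r * a + ?s * b) - ?r * (?p * a + ?q * b)"
    by (simp_all only: algebra_simps)
  then show ?thesis unfolding det assms by simp
qed

lemma negligible_axes: "negligible {x. coord1 x = 0 \<or> coord2 x = 0}"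
proof (rule negligible_subset)
  show "negligible ({x::real^4. axis 1 1 \<bullet> x = 0} \<union> {x. axis 3 1 \<bullet> x = 0})"
    by (intro negligible_Un negligible_hyperplane) (auto simp: axis_eq_0_iff)
  show "{x. coord1 x = 0 \<or> coord2 x = 0} \<subseteq> {x::real^4. axis 1 1 \<bullet> x = 0} \<union> {x. axis 3 1 \<bullet> x = 0}"
    by (auto simp: coord1_def coord2_def complex_eq_iff inner_axis' )
qed

context
  fixes J H :: "(complex^8) set \<Rightarrow> real"
  assumes J: "\<And>z. z \<in> W \<Longrightarrow> J (\<tau> z) = 1/2 * (cmod (z$1))\<^sup>2"
    and H: "\<And>z. z \<in> W \<Longrightarrow> H (\<tau> z) = 1/2 * (cmod (z$3))\<^sup>2"
begin

lemma system_rank_J_H: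
  assumes "chart_at M p c" "p \<in> vertex_domain k"
  shows "system_rank M c J H p =
    dim {rotation_field (det_normals 1 (k+1)) (det_normals k 1) (orbit_coords k p),
         rotation_field (det_normals 3 (k+1)) (det_normals k 3) (orbit_coords k p)}"
  by (rule system_rank_eq[OF assms modulus_has_derivative[of J, OF J orbit_coords_mem[OF assms(2)]] _
      modulus_has_derivative[of H, OF H orbit_coords_mem[OF assms(2)]]])
    (auto simp: std_form_rotation_field)

lemma rank_less_2_imp:
  assumes "chart_at M p c" "p \<in> vertex_domain k" "system_rank M c J H p < 2"
  shows "coord1 (orbit_coords k p) = 0 \<or> coord2 (orbit_coords k p) = 0"
proof (rule ccontr)
  assume "\<not> ?thesis"
  then have "system_rank M c J H p = 2"
    unfolding system_rank_J_H[OF assms(1,2)]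
    using rotation_fields_dependent coefficients_eq_0 by (intro dim_pair) blast
  then show False using assms(3) by simp
qed

lemma rank_0_iff:
  assumes "chart_at M p c" "p \<in> vertex_domain k"
  shows "system_rank M c J H p = 0 \<longleftrightarrow> orbit_coords k p = 0"
proof -
  let ?x = "orbit_coords k p"
  have "system_rank M c J H p = 0 \<longleftrightarrow>
      rotation_field (det_normals 1 (k+1)) (det_normals k 1) ?x = 0 \<and>
      rotation_field (det_normals 3 (k+1)) (det_normals k 3) ?x = 0"
    unfolding system_rank_J_H[OF assms] by (simp add: dim_eq_0)
  also have "\<dots> \<longleftrightarrow> ?x = 0"
  proof
    assume *: "rotation_field (det_normals 1 (k+1)) (det_normals k 1) ?x = 0 \<and>
      rotation_field (det_normals 3 (k+1)) (det_normals k 3) ?x = 0"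
    have "coord1 ?x = 0"
      using coefficients_eq_0[of k 1 0] rotation_fields_dependent[of 1 k ?x 0] rotation_fields_dependent[of 0 k ?x 1]
        det_normals_J_H[of k] * by (auto simp: mult_eq_0_iff)
    moreover have "coord2 ?x = 0"
      using rotation_fields_dependent[of 1 k ?x 0] rotation_fields_dependent[of 0 k ?x 1]
        det_normals_J_H[of k] * by (auto simp: mult_eq_0_iff)
    ultimately show "?x = 0" by (intro coords_eqI) (simp_all add: coord_linear)
  next
    assume "?x = 0"
    then show "rotation_field (det_normals 1 (k+1)) (det_normals k 1) ?x = 0 \<and>
      rotation_field (det_normals 3 (k+1)) (det_normals k 3) ?x = 0"
      by (auto intro!: coords_eqI simp: rotation_field_def coord_linear)
  qed
  finally show ?thesis .
qed

text \<open>In a vertex chart both vector fields rotate the two complex coordinates, so they commute, and they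
  can be dependent only where one of these coordinates vanishes.\<close>

lemma completely_integrable_J_H: "completely_integrable M J H"
  unfolding completely_integrable_def
proof (intro conjI)
  have img: "snd (vertex_chart k) ` fst (vertex_chart k) = slice_domain k" for k
    by (simp add: vertex_chart_def vertex_chart_image)
  show "smooth_fun M J" "smooth_fun M H"
    unfolding smooth_fun_def
    using vertex_chart_at M_cover smooth_in_vertex_chart_modulus[of J 1, OF J]
      smooth_in_vertex_chart_modulus[of H 3, OF H] by (metis img)+
  show "poisson_commute M J H"
    unfolding poisson_commute_def
  proof
    fix p assume "p \<in> points M"
    then obtain k where k: "p \<in> vertex_domain k" by (rule M_cover)
    have "std_form (rotation_field a b x) (rotation_field a' b' x) = 0" for a b a' b' x
      by (simp add: std_form_rotation_field) (simp add: rotation_field_def inner_complex_def)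
    then show "\<exists>c. chart_at M p c \<and> form M c p (ham_vf M c J p) (ham_vf M c H p) = 0"
      using vertex_chart_at[OF k] form_vertex_chart[OF k] ham_vf_modulus[of J 1, OF J k]
        ham_vf_modulus[of H 3, OF H k] by (intro exI[of _ "vertex_chart k"]) simp
  qed
  show "null_subset M {p \<in> points M. singular_point M J H p}"
    unfolding null_subset_def
  proof
    fix p assume "p \<in> points M"
    then obtain k where k: "p \<in> vertex_domain k" by (rule M_cover)
    have "snd (vertex_chart k) ` ({p \<in> points M. singular_point M J H p} \<inter> fst (vertex_chart k)) \<subseteq>
        {x. coord1 x = 0 \<or> coord2 x = 0}"
      using rank_less_2_imp by (fastforce simp: vertex_chart_def singular_point_def)
    then show "\<exists>c. chart_at M p c \<and> negligible (snd c ` ({p \<in> points M. singular_point M J H p} \<inter> fst c))"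
      using vertex_chart_at[OF k] negligible_subset[OF negligible_axes] by blast
  qed
qed

end

section \<open>The image\<close>

text \<open>The horizontal line through the point meets the boundary at \<open>(l, y)\<close> and \<open>(r, y)\<close>; each of these
  lies on an edge, which one depending on whether \<open>y\<close> is in \<open>[0, 1]\<close>, \<open>[1, 2]\<close> or \<open>[2, 3]\<close>.\<close>

lemma mem_octagon:
  assumes "0 \<le> x" "x \<le> 3" "0 \<le> y" "y \<le> 3" "1 \<le> x + y" "x + y \<le> 5" "x - y \<le> 2" "y - x \<le> 2"
  shows "(x, y) \<in> octagon"
proof -
  have cx: "convex octagon" by (simp add: octagon_def)
  have v: "v \<in> octagon" if "v \<in> {(0,2), (0,1), (1,0), (2,0), (3,1), (3,2), (2,3), (1,3)}" for v
    using that unfolding octagon_def by (rule hull_inc)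
  have seg: "((1 - s) * a + s * c, (1 - s) * b + s * d) \<in> octagon"
    if "(a,b) \<in> octagon" "(c,d) \<in> octagon" "0 \<le> s" "s \<le> 1" for a b c d s :: real
    using convexD[OF cx that(1,2), of "1 - s" s] that(3,4) by simp
  define l where "l = max 0 (max (1 - y) (y - 2))"
  define r where "r = min 3 (min (2 + y) (5 - y))"
  have l: "(l, y) \<in> octagon"
  proof -
    consider "y \<le> 1" | "1 \<le> y" "y \<le> 2" | "2 \<le> y" by linarith
    then show ?thesis
    proof cases
      case 1 then show ?thesis using seg[of 1 0 0 1 y] assms v by (simp add: l_def)
    next
      case 2 then show ?thesis using seg[of 0 1 0 2 "y - 1"] assms v by (simp add: l_def algebra_simps)
    next
      case 3 then show ?thesis using seg[of 0 2 1 3 "y - 2"] assms v by (simp add: l_def algebra_simps)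
    qed
  qed
  have r: "(r, y) \<in> octagon"
  proof -
    consider "y \<le> 1" | "1 \<le> y" "y \<le> 2" | "2 \<le> y" by linarith
    then show ?thesis
    proof cases
      case 1 then show ?thesis using seg[of 2 0 3 1 y] assms v by (simp add: r_def algebra_simps)
    next
      case 2 then show ?thesis using seg[of 3 1 3 2 "y - 1"] assms v by (simp add: r_def algebra_simps)
    next
      case 3 then show ?thesis using seg[of 3 2 2 3 "y - 2"] assms v by (simp add: r_def algebra_simps)
    qed
  qed
  have lr: "l \<le> x" "x \<le> r" "l < r" using assms by (auto simp: l_def r_def)
  define s where "s = (x - l) / (r - l)"
  have "s * (r - l) = x - l" using lr by (simp add: s_def)
  then have "(1 - s) * l + s * r = x" by (simp add: algebra_simps)
  moreover have s: "0 \<le> s" "s \<le> 1" using lr by (auto simp: s_def)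
  moreover have "(1 - s) * y + s * y = y" by (simp add: algebra_simps)
  ultimately show ?thesis using seg[OF l r s] by (simp only:)
qed

lemma octagon_iff_halfplanes:
  fixes x y :: real
  shows "(x, y) \<in> octagon \<longleftrightarrow> (\<forall>l. 0 \<le> normal_x$l * x + normal_y$l * y + offset$l)"
proof
  assume "(x, y) \<in> octagon"
  moreover have "octagon \<subseteq> (\<Inter>l. {p. - offset$l \<le> (real_of_int (normal_x$l), real_of_int (normal_y$l)) \<bullet> p})"
    unfolding octagon_def
  proof (rule hull_minimal)
    show "convex (\<Inter>l. {p. - offset$l \<le> (real_of_int (normal_x$l), real_of_int (normal_y$l)) \<bullet> p})"
      by (intro convex_INT convex_halfspace_ge)
  next
    have vertices: "\<forall>l. - offset$l \<le> normal_x$l * a + normal_y$l * b"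
      if "(a, b) \<in> {(0,2), (0,1), (1,0), (2,0), (3,1), (3,2), (2,3), (1,3)}" for a b :: real
      unfolding forall_8 using that by (auto simp: normal_nth)
    show "{(0,2), (0,1), (1,0), (2,0), (3,1), (3,2), (2,3), (1,3)} \<subseteq>
        (\<Inter>l. {p. - offset$l \<le> (real_of_int (normal_x$l), real_of_int (normal_y$l)) \<bullet> p})"
    proof
      fix p :: "real \<times> real"
      assume p: "p \<in> {(0,2), (0,1), (1,0), (2,0), (3,1), (3,2), (2,3), (1,3)}"
      then have "(fst p, snd p) \<in> {(0,2), (0,1), (1,0), (2,0), (3,1), (3,2), (2,3), (1,3)}" by simp
      from vertices[OF this]
      show "p \<in> (\<Inter>l. {p. - offset$l \<le> (real_of_int (normal_x$l), real_of_int (normal_y$l)) \<bullet> p})"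
        by (simp add: inner_prod_def)
    qed
  qed
  ultimately have "(x, y) \<in> (\<Inter>l. {p. - offset$l \<le> (real_of_int (normal_x$l), real_of_int (normal_y$l)) \<bullet> p})"
    by blast
  then have edge: "- offset$l \<le> normal_x$l * x + normal_y$l * y" for l by simp
  have "0 \<le> normal_x$l * x + normal_y$l * y + offset$l" for l
    using edge[of l] by linarith
  then show "\<forall>l. 0 \<le> normal_x$l * x + normal_y$l * y + offset$l" ..
next
  assume "\<forall>l. 0 \<le> normal_x$l * x + normal_y$l * y + offset$l"
  then show "(x, y) \<in> octagon"
    unfolding forall_8 by (intro mem_octagon) (simp_all add: normal_nth)
qed

lemma fiber_point:
  fixes x y :: real
  assumes "(x, y) \<in> octagon"
  obtains z where "z \<in> W" "\<And>l. (cmod (z$l))\<^sup>2 = 2 * (normal_x$l * x + normal_y$l * y + offset$l)"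
proof -
  define g where "g l = normal_x$l * x + normal_y$l * y + offset$l" for l
  define z :: "complex^8" where "z = (\<chi> l. of_real (sqrt (2 * g l)))"
  have "0 \<le> g l" for l using assms by (simp only: octagon_iff_halfplanes g_def)
  then have "(cmod (z$l))\<^sup>2 = 2 * g l" for l by (simp add: z_def)
  then have r: "(cmod (z$l))\<^sup>2 = 2 * (normal_x$l * x + normal_y$l * y + offset$l)" for l
    by (simp only: g_def)
  then have "z \<in> W" unfolding W_iff_halfplanes by blast
  then show ?thesis using r by (rule that)
qed

lemma image_eq_octagon:
  assumes J: "\<And>z. z \<in> W \<Longrightarrow> J (\<tau> z) = 1/2 * (cmod (z$1))\<^sup>2"
    and H: "\<And>z. z \<in> W \<Longrightarrow> H (\<tau> z) = 1/2 * (cmod (z$3))\<^sup>2"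
  shows "(\<lambda>p. (J p, H p)) ` points M = octagon"
proof (intro set_eqI iffI)
  fix q assume "q \<in> (\<lambda>p. (J p, H p)) ` points M"
  then obtain z where z: "z \<in> W" "q = (1/2 * (cmod (z$1))\<^sup>2, 1/2 * (cmod (z$3))\<^sup>2)"
    using J H by (auto simp: M_def)
  have "0 \<le> normal_x$l * (1/2 * (cmod (z$1))\<^sup>2) + normal_y$l * (1/2 * (cmod (z$3))\<^sup>2) + offset$l" for l
    using W_halfplanes[OF z(1), of l] zero_le_power2[of "cmod (z$l)"] by simp
  then show "q \<in> octagon" unfolding z(2) octagon_iff_halfplanes by blast
next
  fix q assume q: "q \<in> octagon"
  obtain x y where xy: "q = (x, y)" by (cases q)
  obtain z where "z \<in> W" and r: "\<And>l. (cmod (z$l))\<^sup>2 = 2 * (normal_x$l * x + normal_y$l * y + offset$l)"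
    using q unfolding xy by (rule fiber_point) (rule that)
  note \<open>z \<in> W\<close>
  moreover have "q = (J (\<tau> z), H (\<tau> z))"
    using J[OF \<open>z \<in> W\<close>] H[OF \<open>z \<in> W\<close>] r[of 1] r[of 3] by (simp add: xy normal_nth)
  ultimately show "q \<in> (\<lambda>p. (J p, H p)) ` points M" by (auto simp: M_def)
qed

section \<open>The torus action\<close>

text \<open>The residual torus is realized by rotating \<open>z\<^sub>1\<close> and \<open>z\<^sub>3\<close>, whose normals are the standard basis
  of \<open>\<int>\<^sup>2\<close>; it commutes with \<open>N\<close> and therefore permutes the orbits.\<close>

definition torus_angle :: "real \<times> real \<Rightarrow> 8 \<Rightarrow> real" where
  "torus_angle t l = (if l = 1 then fst t else if l = 3 then snd t else 0)"

definition torus_rotate :: "real \<times> real \<Rightarrow> complex^8 \<Rightarrow> complex^8" where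
  "torus_rotate t z = (\<chi> l. cis (torus_angle t l) * z$l)"

definition torus_act :: "real \<times> real \<Rightarrow> (complex^8) set \<Rightarrow> (complex^8) set" where
  "torus_act t p = torus_rotate t ` p"

lemma torus_rotate_add: "torus_rotate (s + t) z = torus_rotate s (torus_rotate t z)"
  by (simp add: torus_rotate_def torus_angle_def vec_eq_iff cis_mult mult.assoc[symmetric])

lemma torus_rotate_mem_W: "z \<in> W \<Longrightarrow> torus_rotate t z \<in> W"
  by (simp add: W_def torus_rotate_def norm_mult)

lemma torus_rotate_off_axes: "torus_rotate t z \<in> off_axes k \<longleftrightarrow> z \<in> off_axes k"
  by (simp add: off_axes_def torus_rotate_def)

lemma torus_act_\<tau>: "torus_act t (\<tau> z) = \<tau> (torus_rotate t z)"
proof -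
  have "N_act s (torus_rotate t z) = torus_rotate t (N_act s z)" for s
    by (simp add: N_act_def torus_rotate_def vec_eq_iff)
  then show ?thesis by (simp add: torus_act_def \<tau>_def image_image)
qed

definition weight1 :: "8 \<Rightarrow> real \<times> real \<Rightarrow> real" where
  "weight1 k t = of_int (det_normals 1 (k+1)) * fst t + of_int (det_normals 3 (k+1)) * snd t"

definition weight2 :: "8 \<Rightarrow> real \<times> real \<Rightarrow> real" where
  "weight2 k t = of_int (det_normals k 1) * fst t + of_int (det_normals k 3) * snd t"

definition rotate_coords :: "real \<Rightarrow> real \<Rightarrow> real^4 \<Rightarrow> real^4" where
  "rotate_coords a b x = of_coords (cis a * coord1 x) (cis b * coord2 x)"

lemma slice_coords_torus_rotate:
  "slice_coords k (torus_rotate t z) = rotate_coords (weight1 k t) (weight2 k t) (slice_coords k z)"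
proof -
  have "(\<Sum>l\<in>UNIV. real_of_int (m l) * torus_angle t l) = m 1 * fst t + m 3 * snd t" for m :: "8 \<Rightarrow> int"
    by (simp add: sum_8 torus_angle_def)
  then show ?thesis
    by (subst slice_coords_rotate[of _ "torus_angle t" z])
      (simp_all add: torus_rotate_def rotate_coords_def weight1_def weight2_def)
qed

lemma torus_act_vertex_chart:
  assumes "p \<in> vertex_domain k"
  shows "torus_act t p \<in> vertex_domain k"
    and "orbit_coords k (torus_act t p) = rotate_coords (weight1 k t) (weight2 k t) (orbit_coords k p)"
proof -
  obtain z where z: "z \<in> W" "z \<in> off_axes k" "p = \<tau> z" using assms by (auto simp: vertex_domain_def)
  then show "torus_act t p \<in> vertex_domain k"
    by (simp add: torus_act_\<tau> \<tau>_mem_vertex_domain torus_rotate_mem_W torus_rotate_off_axes)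
  show "orbit_coords k (torus_act t p) = rotate_coords (weight1 k t) (weight2 k t) (orbit_coords k p)"
    by (simp add: z torus_act_\<tau> slice_coords_torus_rotate)
qed

lemma in_vertex_chart_torus_act:
  assumes "x \<in> slice_domain k"
  shows "in_chart (vertex_chart k) (\<lambda>q. snd (vertex_chart k) (torus_act t q)) x =
    rotate_coords (weight1 k t) (weight2 k t) x"
  using \<tau>_slice(1)[OF assms] torus_act_vertex_chart(2)[OF \<tau>_slice(1)[OF assms], of t]
  by (simp add: in_chart_def vertex_chart_def inv_into_vertex_chart[OF assms] slice_coords_slice[OF assms])

lemma bounded_linear_rotate: "bounded_linear (rotate_coords a b)"
  unfolding linear_conv_bounded_linear[symmetric]
  by (rule linearI; rule coords_eqI) (simp_all add: rotate_coords_def coord_linear algebra_simps)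

lemma torus2_action_torus_act: "torus2_action M torus_act"
  unfolding torus2_action_def
proof (intro ballI conjI allI)
  fix p assume "p \<in> points M"
  then obtain z where z: "z \<in> W" "p = \<tau> z" by (auto simp: M_def)
  show "torus_act t p \<in> points M" for t
    using torus_rotate_mem_W[OF z(1)] by (auto simp: M_def z torus_act_\<tau>)
  show "torus_act (s + t) p = torus_act s (torus_act t p)" for s t
    by (simp add: z torus_act_\<tau> torus_rotate_add)
  show "torus_act (2 * pi * of_int m, 2 * pi * of_int n) p = p" for m n
  proof -
    have "cis (2 * pi * of_int i) = 1" for i by (rule cis_multiple_2pi) simp
    then have "torus_rotate (2 * pi * of_int m, 2 * pi * of_int n) z = z"
      by (simp add: torus_rotate_def torus_angle_def vec_eq_iff)
    then show ?thesis by (simp add: z torus_act_\<tau>)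
  qed
qed

lemma smooth_on_linear_fst:
  fixes L :: "real \<times> real \<Rightarrow> real"
  assumes "bounded_linear L" shows "smooth_on S (\<lambda>(s, x :: real^4). L s)"
proof -
  have "smooth_on S (\<lambda>y. L (fst y))"
    by (intro smooth_on_bounded_linear[OF assms] smooth_on_bounded_linear[OF bounded_linear_fst] smooth_on_ident)
  then show ?thesis by (simp add: case_prod_beta')
qed

lemma bounded_linear_weight: "bounded_linear (weight1 k)" "bounded_linear (weight2 k)"
  unfolding linear_conv_bounded_linear[symmetric]
  by (auto intro!: linearI simp: weight1_def weight2_def algebra_simps)

lemma smooth_rotate:
  "smooth_on S (\<lambda>(s, x). rotate_coords (weight1 k s) (weight2 k s) x)"
proof -
  have x: "smooth_on S (\<lambda>y. coord1 (snd y))" "smooth_on S (\<lambda>y. coord2 (snd y))"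
    by (intro smooth_on_bounded_linear[OF bounded_linear_coord(1)] smooth_on_bounded_linear[OF bounded_linear_coord(2)]
      smooth_on_bounded_linear[OF bounded_linear_snd] smooth_on_ident)+
  have w: "smooth_on S (\<lambda>y. weight1 k (fst y))" "smooth_on S (\<lambda>y. weight2 k (fst y))"
    using smooth_on_linear_fst[OF bounded_linear_weight(1)[of k], of S]
      smooth_on_linear_fst[OF bounded_linear_weight(2)[of k], of S] by (simp_all add: case_prod_beta')
  have "smooth_on S (\<lambda>y. rotate_coords (weight1 k (fst y)) (weight2 k (fst y)) (snd y))"
    unfolding rotate_coords_def by (intro smooth_on_of_coords smooth_on_mult smooth_on_cis x w)
  then show ?thesis by (simp add: case_prod_beta')
qed

lemma smooth_action_torus_act: "smooth_action M torus_act"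
  unfolding smooth_action_def
proof (intro ballI allI)
  fix p t assume "p \<in> points M"
  then obtain k where k: "p \<in> vertex_domain k" by (rule M_cover)
  let ?c = "vertex_chart k"
  have "smooth_on (UNIV \<times> slice_domain k) (\<lambda>(s, x). in_chart ?c (\<lambda>q. snd ?c (torus_act s q)) x)"
    by (rule smooth_on_cong[OF smooth_rotate[of _ k]]) (auto simp: in_vertex_chart_torus_act)
  moreover have "snd ?c ` fst ?c = slice_domain k" by (simp add: vertex_chart_def vertex_chart_image)
  moreover have "\<forall>s\<in>UNIV. \<forall>q\<in>fst ?c. torus_act s q \<in> fst ?c"
    by (simp add: vertex_chart_def torus_act_vertex_chart)
  ultimately show "\<exists>c d T. chart_at M p c \<and> chart_at M (torus_act t p) d \<and> open T \<and> t \<in> T \<and>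
        (\<forall>s\<in>T. \<forall>q\<in>fst c. torus_act s q \<in> fst d) \<and>
        smooth_on (T \<times> snd c ` fst c) (\<lambda>(s, x). in_chart c (\<lambda>q. snd d (torus_act s q)) x)"
    using vertex_chart_at[OF k] vertex_chart_at[OF torus_act_vertex_chart(1)[OF k]]
    by (intro exI[of _ ?c] exI[of _ UNIV]) simp
qed

lemma std_form_rotate: "std_form (rotate_coords a b u) (rotate_coords a b v) = std_form u v"
  by (simp only: std_form_def rotate_coords_def coords_of_coords Im_mult_cnj_unit norm_cis)

lemma preserves_form_torus_act: "preserves_form M (torus_act t)"
  unfolding preserves_form_def
proof
  fix p assume "p \<in> points M"
  then obtain k where k: "p \<in> vertex_domain k" by (rule M_cover)
  let ?c = "vertex_chart k"
  have "dir_deriv (in_chart ?c (snd ?c \<circ> torus_act t)) u (orbit_coords k p) = rotate_coords (weight1 k t) (weight2 k t) u" for u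
  proof (rule dir_deriv_eq, rule has_derivative_transform_within_open[OF _ open_slice_domain orbit_coords_mem[OF k]])
    show "(rotate_coords (weight1 k t) (weight2 k t) has_derivative rotate_coords (weight1 k t) (weight2 k t)) (at (orbit_coords k p))"
      by (rule bounded_linear_imp_has_derivative[OF bounded_linear_rotate])
  qed (simp add: in_vertex_chart_torus_act comp_def)
  then have "form M ?c (torus_act t p)
      (dir_deriv (in_chart ?c (snd ?c \<circ> torus_act t)) u (snd ?c p))
      (dir_deriv (in_chart ?c (snd ?c \<circ> torus_act t)) v (snd ?c p)) = form M ?c p u v" for u v
    unfolding form_vertex_chart[OF k] form_vertex_chart[OF torus_act_vertex_chart(1)[OF k]]
    by (simp add: vertex_chart_def std_form_rotate)
  then show "\<exists>c d. chart_at M p c \<and> chart_at M (torus_act t p) d \<and>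
        (\<forall>u v. form M d (torus_act t p)
                 (dir_deriv (in_chart c (snd d \<circ> torus_act t)) u (snd c p))
                 (dir_deriv (in_chart c (snd d \<circ> torus_act t)) v (snd c p)) = form M c p u v)"
    using vertex_chart_at[OF k] vertex_chart_at[OF torus_act_vertex_chart(1)[OF k]] by blast
qed

text \<open>Over an interior point of the octagon neither coordinate in a vertex chart vanishes, so an element
  fixing the orbit has both weights in \<open>2\<pi>\<int>\<close>; the weights at a vertex form a basis of the weight
  lattice.\<close>

lemma effective_action_torus_act: "effective_action M torus_act"
  unfolding effective_action_def
proof (intro allI impI)
  fix t assume fixed: "\<forall>p\<in>points M. torus_act t p = p"
  \<comment> \<open>the centre of the octagon\<close>
  have "(3/2, 3/2) \<in> octagon" by (rule mem_octagon) simp_all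
  then obtain z where zW: "z \<in> W" and
    r: "\<And>l. (cmod (z$l))\<^sup>2 = 2 * (normal_x$l * (3/2) + normal_y$l * (3/2) + offset$l)"
    by (rule fiber_point) (rule that)
  have "\<forall>l. z$l \<noteq> 0"
    unfolding forall_8 using r[of 1] r[of 2] r[of 3] r[of 4] r[of 5] r[of 6] r[of 7] r[of 8]
    by (auto simp: normal_nth)
  then have nz: "z$l \<noteq> 0" for l ..
  have off: "z \<in> off_axes 1" using nz by (simp add: off_axes_def)
  let ?x = "slice_coords 1 z"
  have "torus_act t (\<tau> z) = \<tau> z" using fixed zW by (auto simp: M_def)
  then have "rotate_coords (weight1 1 t) (weight2 1 t) ?x = ?x"
    using torus_act_vertex_chart(2)[of "\<tau> z" 1 t] zW off by (simp add: \<tau>_mem_vertex_domain)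
  then have "cis (weight1 1 t) * coord1 ?x = coord1 ?x" "cis (weight2 1 t) * coord2 ?x = coord2 ?x"
    unfolding rotate_coords_def by (metis coords_of_coords)+
  moreover have "coord1 ?x \<noteq> 0" "coord2 ?x \<noteq> 0"
    using nz norm_phase_product[OF off] by (auto simp: slice_coords_def) (metis norm_zero zero_neq_one)+
  ultimately have c: "cis (weight1 1 t) = 1" "cis (weight2 1 t) = 1" by auto
  have *: "\<exists>n::int. a = 2 * pi * of_int n" if "cis a = 1" for a
    using that by (metis cis.simps(1) cos_one_2pi_int mult.commute mult.left_commute one_complex.simps(1))
  \<comment> \<open>at the vertex 1 the weights are t1 - t2 and t2\<close>
  obtain m n :: int where "weight1 1 t = 2 * pi * of_int m" "weight2 1 t = 2 * pi * of_int n"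
    using *[OF c(1)] *[OF c(2)] by blast
  then have "t = (2 * pi * of_int (m + n), 2 * pi * of_int n)"
    by (intro prod_eqI) (auto simp: weight1_def weight2_def det_normals_def normal_nth algebra_simps)
  then show "\<exists>m n::int. t = (2 * pi * of_int m, 2 * pi * of_int n)" by blast
qed

lemma smooth_on_Pair:
  fixes f :: "_ \<Rightarrow> 'a::euclidean_space" and g :: "_ \<Rightarrow> 'b::euclidean_space"
  assumes "smooth_on S f" "smooth_on S g" shows "smooth_on S (\<lambda>x. (f x, g x))"
proof -
  have "bounded_linear (\<lambda>a::'a. (a, 0::'b))" "bounded_linear (\<lambda>b::'b. (0::'a, b))"
    unfolding linear_conv_bounded_linear[symmetric] by (auto intro!: linearI)
  then have "smooth_on S (\<lambda>x. (f x, 0) + (0, g x))"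
    by (intro smooth_on_add smooth_on_bounded_linear[of "\<lambda>a. (a, 0)"] smooth_on_bounded_linear[of "\<lambda>b. (0, b)"] assms)
  then show ?thesis by simp
qed

lemma momentum_map_torus_act:
  assumes J: "\<And>z. z \<in> W \<Longrightarrow> J (\<tau> z) = 1/2 * (cmod (z$1))\<^sup>2"
    and H: "\<And>z. z \<in> W \<Longrightarrow> H (\<tau> z) = 1/2 * (cmod (z$3))\<^sup>2"
  shows "momentum_map M torus_act (\<lambda>p. (J p, H p))"
  unfolding momentum_map_def
proof (intro conjI ballI allI)
  show "smooth_fun M (\<lambda>p. (J p, H p))"
    unfolding smooth_fun_def
  proof
    fix p assume "p \<in> points M"
    then obtain k where k: "p \<in> vertex_domain k" by (rule M_cover)
    have "smooth_on (slice_domain k) (in_chart (vertex_chart k) (\<lambda>p. (J p, H p)))"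
      using smooth_on_Pair[OF smooth_in_vertex_chart_modulus[of J 1, OF J] smooth_in_vertex_chart_modulus[of H 3, OF H]]
      by (simp add: in_chart_def comp_def)
    then show "\<exists>c. chart_at M p c \<and> smooth_on (snd c ` fst c) (in_chart c (\<lambda>p. (J p, H p)))"
      using vertex_chart_at[OF k] vertex_chart_image[of k]
      by (intro exI[of _ "vertex_chart k"]) (simp add: vertex_chart_def)
  qed
next
  fix p t assume "p \<in> points M"
  then obtain z where z: "z \<in> W" "p = \<tau> z" by (auto simp: M_def)
  have same: "cmod (torus_rotate t z $ l) = cmod (z$l)" for l by (simp add: torus_rotate_def norm_mult)
  then show "(J (torus_act t p), H (torus_act t p)) = (J p, H p)"
    by (simp only: z(2) torus_act_\<tau> J[OF z(1)] H[OF z(1)] same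
      J[OF torus_rotate_mem_W[OF z(1)]] H[OF torus_rotate_mem_W[OF z(1)]])
next
  fix p \<xi> assume "p \<in> points M"
  then obtain k where k: "p \<in> vertex_domain k" by (rule M_cover)
  let ?c = "vertex_chart k" and ?x = "orbit_coords k p"
  let ?X = "rotation_field (weight1 k \<xi>) (weight2 k \<xi>) ?x"
  have lin: "weight1 k (s *\<^sub>R \<xi>) = s * weight1 k \<xi>" "weight2 k (s *\<^sub>R \<xi>) = s * weight2 k \<xi>" for s
    by (simp_all add: weight1_def weight2_def algebra_simps)
  have cis: "((\<lambda>s. cis (s * w) * a) has_vector_derivative \<i> * of_real w * a) (at 0)" for w a
  proof -
    have "((\<lambda>s. cis (s * w)) has_vector_derivative w *\<^sub>R (\<i> * cis (0 * w))) (at 0)"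
      unfolding has_vector_derivative_def
      by (rule has_derivative_eq_rhs[OF has_derivative_cis[OF has_derivative_mult_left[OF has_derivative_ident]]])
        (auto simp: fun_eq_iff scaleR_conv_of_real algebra_simps)
    from has_vector_derivative_mult_left[OF this, of a] show ?thesis
      by (simp add: scaleR_conv_of_real mult.commute)
  qed
  have bl: "bounded_linear (\<lambda>(a, b). of_coords a b)"
    unfolding linear_conv_bounded_linear[symmetric]
    by (rule linearI; rule coords_eqI) (auto simp: coord_linear)
  have "((\<lambda>s. (\<lambda>(a, b). of_coords a b) (cis (s * weight1 k \<xi>) * coord1 ?x, cis (s * weight2 k \<xi>) * coord2 ?x))
      has_vector_derivative (\<lambda>(a, b). of_coords a b)
        (\<i> * of_real (weight1 k \<xi>) * coord1 ?x, \<i> * of_real (weight2 k \<xi>) * coord2 ?x)) (at 0)"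
    by (intro bounded_linear.has_vector_derivative[OF bl] has_vector_derivative_Pair cis)
  then have vel: "((\<lambda>s. snd ?c (torus_act (s *\<^sub>R \<xi>) p)) has_vector_derivative ?X) (at 0)"
    by (simp add: vertex_chart_def torus_act_vertex_chart(2)[OF k] rotate_coords_def lin rotation_field_def)
  have "differential ?c (\<lambda>q. (J q, H q) \<bullet> \<xi>) p v = std_form ?X v" for v
  proof -
    have eq: "in_chart ?c (\<lambda>q. (J q, H q) \<bullet> \<xi>) = (\<lambda>x. in_chart ?c J x * fst \<xi> + in_chart ?c H x * snd \<xi>)"
      by (cases \<xi>) (simp add: in_chart_def fun_eq_iff)
    note d = modulus_has_derivative[of J 1, OF J orbit_coords_mem[OF k]]
      modulus_has_derivative[of H 3, OF H orbit_coords_mem[OF k]]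
    show ?thesis
      unfolding differential_def eq std_form_rotation_field
      by (subst dir_deriv_eq[of _ _ "snd ?c p", OF has_derivative_add[OF has_derivative_mult_left has_derivative_mult_left]])
        (use d in \<open>auto simp: vertex_chart_def weight1_def weight2_def algebra_simps\<close>)
  qed
  then show "\<exists>c X. chart_at M p c \<and>
        ((\<lambda>s. snd c (torus_act (s *\<^sub>R \<xi>) p)) has_vector_derivative X) (at 0) \<and>
        (\<forall>v. form M c p X v = differential c (\<lambda>q. (J q, H q) \<bullet> \<xi>) p v)"
    using vertex_chart_at[OF k] vel form_vertex_chart[OF k]
    by (intro exI[of _ ?c] exI[of _ ?X]) simp
qed

section \<open>The fixed points\<close>

lemma zero_mem_slice_domain: "0 \<in> slice_domain k"
proof -
  have wrap: "(9::8) = 1" by simp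
  have "\<forall>k l. l \<noteq> k \<longrightarrow> l \<noteq> k+1 \<longrightarrow> slice_radius k 0 0 l > 0"
    unfolding forall_8 by (simp add: slice_radius_def det_normals_def normal_nth wrap)
  then show ?thesis by (simp add: slice_domain_def coord_linear)
qed

definition vertex_point :: "8 \<Rightarrow> (complex^8) set" where
  "vertex_point k = \<tau> (slice k 0)"

lemma vertex_point:
  "vertex_point k \<in> vertex_domain k" "orbit_coords k (vertex_point k) = 0"
  using \<tau>_slice[OF zero_mem_slice_domain] by (simp_all add: vertex_point_def)

lemma vertex_pointI:
  assumes "p \<in> vertex_domain k" "orbit_coords k p = 0" shows "p = vertex_point k"
  using vertex_domainE[OF assms(1)] assms(2) by (metis vertex_point_def)

lemma slice_zero_nth: "slice k 0 $ l = 0 \<longleftrightarrow> l = k \<or> l = k+1"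
  using slice_off_axes[OF zero_mem_slice_domain, of k] slice_nth(1,2)[of k 0]
  by (auto simp: off_axes_def coord_linear)

text \<open>The vanishing coordinates of the point are \<open>k\<close> and \<open>k + 1\<close>, and they determine \<open>k\<close> since the cycle
  of edges is longer than two.\<close>

lemma inj_vertex_point: "inj vertex_point"
proof
  fix k j assume "vertex_point k = vertex_point j"
  then have "slice k 0 \<in> \<tau> (slice j 0)" by (simp add: vertex_point_def \<tau>_eq_iff)
  from orbit_cmod[OF this] have "slice k 0 $ l = 0 \<longleftrightarrow> slice j 0 $ l = 0" for l by (metis norm_eq_zero)
  then have *: "l = k \<or> l = k+1 \<longleftrightarrow> l = j \<or> l = j+1" for l by (simp add: slice_zero_nth)
  show "k = j"
  proof (rule ccontr)
    assume "k \<noteq> j"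
    then have "k = j+1" "j = k+1" using *[of k] *[of j] by auto
    then have "k = k + 2" by (metis add.assoc one_add_one)
    then show False by simp
  qed
qed

text \<open>Such a matrix is a pair of rotation generators, and \<open>\<lambda>\<close> is an eigenvalue iff \<open>\<lambda>\<^sup>2\<close> is \<open>-\<alpha>\<^sup>2\<close> or
  \<open>-\<beta>\<^sup>2\<close>.\<close>

lemma complex_eigenvalues_rotations:
  fixes L :: "real^4^4"
  assumes "\<And>i j. L$i$j = (if i = 1 \<and> j = 2 then \<alpha> else if i = 2 \<and> j = 1 then - \<alpha>
     else if i = 3 \<and> j = 4 then \<beta> else if i = 4 \<and> j = 3 then - \<beta> else 0)"
  shows "complex_eigenvalues L =
    {\<i> * of_real \<alpha>, - \<i> * of_real \<alpha>, \<i> * of_real \<beta>, - \<i> * of_real \<beta>}"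
proof -
  have ev: "l \<in> complex_eigenvalues L \<longleftrightarrow> (\<exists>v::complex^4. v \<noteq> 0 \<and> of_real \<alpha> * v$2 = l * v$1 \<and>
      - of_real \<alpha> * v$1 = l * v$2 \<and> of_real \<beta> * v$4 = l * v$3 \<and> - of_real \<beta> * v$3 = l * v$4)" for l
  proof -
    have "(\<chi> i j. complex_of_real (L$i$j)) *v v = l *s v \<longleftrightarrow> of_real \<alpha> * v$2 = l * v$1 \<and>
      - of_real \<alpha> * v$1 = l * v$2 \<and> of_real \<beta> * v$4 = l * v$3 \<and> - of_real \<beta> * v$3 = l * v$4"
      for v :: "complex^4"
      unfolding vec_eq_iff[where 'b = 4] forall_4 by (simp add: matrix_vector_mult_def sum_4 assms)
    then show ?thesis by (simp only: complex_eigenvalues_def mem_Collect_eq)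
  qed
  have sq: "l * l = - (of_real a * of_real a) \<longleftrightarrow> l = \<i> * of_real a \<or> l = - \<i> * of_real a" for l and a :: real
  proof -
    have "(l - \<i> * of_real a) * (l + \<i> * of_real a) = l * l + of_real a * of_real a"
      by (simp add: algebra_simps)
    then have "l * l = - (of_real a * of_real a) \<longleftrightarrow> (l - \<i> * of_real a) * (l + \<i> * of_real a) = 0"
      by (simp only: eq_neg_iff_add_eq_0)
    then show ?thesis by (simp only: mult_eq_0_iff right_minus_eq eq_neg_iff_add_eq_0 mult_minus_left)
  qed
  have "l \<in> complex_eigenvalues L \<longleftrightarrow> l * l = - (of_real \<alpha> * of_real \<alpha>) \<or> l * l = - (of_real \<beta> * of_real \<beta>)" for l
  proof
    assume "l \<in> complex_eigenvalues L"
    then obtain v :: "complex^4" where v: "v \<noteq> 0" "of_real \<alpha> * v$2 = l * v$1" "- of_real \<alpha> * v$1 = l * v$2"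
      "of_real \<beta> * v$4 = l * v$3" "- of_real \<beta> * v$3 = l * v$4" unfolding ev by blast
    have a: "(l * l + of_real \<alpha> * of_real \<alpha>) * v$1 = 0" "(l * l + of_real \<alpha> * of_real \<alpha>) * v$2 = 0"
      and b: "(l * l + of_real \<beta> * of_real \<beta>) * v$3 = 0" "(l * l + of_real \<beta> * of_real \<beta>) * v$4 = 0"
      using v(2-) by algebra+
    from v(1) have "v$1 \<noteq> 0 \<or> v$2 \<noteq> 0 \<or> v$3 \<noteq> 0 \<or> v$4 \<noteq> 0" by (simp add: vec_eq_iff forall_4)
    then have "l * l + of_real \<alpha> * of_real \<alpha> = 0 \<or> l * l + of_real \<beta> * of_real \<beta> = 0"
      using a b by auto
    then show "l * l = - (of_real \<alpha> * of_real \<alpha>) \<or> l * l = - (of_real \<beta> * of_real \<beta>)"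
      by (simp add: eq_neg_iff_add_eq_0)
  next
    assume "l * l = - (of_real \<alpha> * of_real \<alpha>) \<or> l * l = - (of_real \<beta> * of_real \<beta>)"
    then have cases: "l = \<i> * of_real \<alpha> \<or> l = - \<i> * of_real \<alpha> \<or> l = \<i> * of_real \<beta> \<or> l = - \<i> * of_real \<beta>"
      unfolding sq by blast
    have nth: "(vector [a, b, c, d] :: complex^4) $ 1 = a" "(vector [a, b, c, d] :: complex^4) $ 2 = b"
      "(vector [a, b, c, d] :: complex^4) $ 3 = c" "(vector [a, b, c, d] :: complex^4) $ 4 = d" for a b c d
      by (simp_all add: vector_def)
    have nz: "v \<noteq> 0" if "v$1 \<noteq> 0 \<or> v$3 \<noteq> 0" for v :: "complex^4" using that by auto
    from cases consider "l = \<i> * of_real \<alpha>" | "l = - \<i> * of_real \<alpha>" | "l = \<i> * of_real \<beta>"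
      | "l = - \<i> * of_real \<beta>" by blast
    then show "l \<in> complex_eigenvalues L"
    proof cases
      case 1 then show ?thesis unfolding ev
        by (intro exI[of _ "vector [1, \<i>, 0, 0]"] conjI nz) (simp_all add: nth complex_eq_iff)
    next
      case 2 then show ?thesis unfolding ev
        by (intro exI[of _ "vector [1, - \<i>, 0, 0]"] conjI nz) (simp_all add: nth complex_eq_iff)
    next
      case 3 then show ?thesis unfolding ev
        by (intro exI[of _ "vector [0, 0, 1, \<i>]"] conjI nz) (simp_all add: nth complex_eq_iff)
    next
      case 4 then show ?thesis unfolding ev
        by (intro exI[of _ "vector [0, 0, 1, - \<i>]"] conjI nz) (simp_all add: nth complex_eq_iff)
    qed
  qed
  then show ?thesis unfolding sq by blast
qed

lemma coord_axis:
  "coord1 (axis 1 1) = 1" "coord1 (axis 2 1) = \<i>" "coord1 (axis 3 1) = 0" "coord1 (axis 4 1) = 0"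
  "coord2 (axis 1 1) = 0" "coord2 (axis 2 1) = 0" "coord2 (axis 3 1) = 1" "coord2 (axis 4 1) = \<i>"
  by (simp_all add: coord1_def coord2_def axis_def complex_eq_iff)

lemma matrix_inv_std_form:
  fixes \<Omega> :: "real^4^4"
  assumes "\<Omega> = (\<chi> i j. std_form (axis i 1) (axis j 1))"
  shows "matrix_inv \<Omega> = - \<Omega>"
proof -
  have inv: "\<Omega> ** (- \<Omega>) = mat 1" "(- \<Omega>) ** \<Omega> = mat 1"
    unfolding assms
    by (simp_all add: vec_eq_iff forall_4 matrix_matrix_mult_def sum_4 mat_def std_form_def coord_axis)
  have "\<Omega> ** matrix_inv \<Omega> = mat 1 \<and> matrix_inv \<Omega> ** \<Omega> = mat 1"
    unfolding matrix_inv_def by (rule someI[of _ "- \<Omega>"]) (use inv in blast)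
  then have left: "matrix_inv \<Omega> ** \<Omega> = mat 1" ..
  have "matrix_inv \<Omega> = matrix_inv \<Omega> ** (\<Omega> ** (- \<Omega>))" by (simp only: inv(1) matrix_mul_rid)
  also have "\<dots> = - \<Omega>"
    by (simp only: matrix_mul_assoc left matrix_mul_lid)
  finally show ?thesis .
qed

context
  fixes J H :: "(complex^8) set \<Rightarrow> real"
  assumes J: "\<And>z. z \<in> W \<Longrightarrow> J (\<tau> z) = 1/2 * (cmod (z$1))\<^sup>2"
    and H: "\<And>z. z \<in> W \<Longrightarrow> H (\<tau> z) = 1/2 * (cmod (z$3))\<^sup>2"
begin

text \<open>By unimodularity the Hessians of \<open>J\<close> and \<open>H\<close> span the same plane as those of the two halved
  squared moduli, and some combination has Hessian \<open>diag(1, 1, 2, 2)\<close>; composed with the inverse of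
  the standard form this has the eigenvalues \<open>\<plusminus>i\<close> and \<open>\<plusminus>2i\<close>.\<close>

lemma elliptic_elliptic_vertex_point: "elliptic_elliptic M J H (vertex_point k)"
proof -
  let ?c = "vertex_chart k" and ?p = "vertex_point k"
  let ?Q = "\<lambda>a b. (\<chi> i i'. a * (coord1 (axis i 1) \<bullet> coord1 (axis i' 1)) +
     b * (coord2 (axis i 1) \<bullet> coord2 (axis i' 1))) :: real^4^4"
  note hess = hessian_modulus[OF _ vertex_point(2) zero_mem_slice_domain]
  have hJ: "hessian ?c J ?p = ?Q (det_normals 1 (k+1)) (det_normals k 1)"
    by (rule hess) (rule J)
  have hH: "hessian ?c H ?p = ?Q (det_normals 3 (k+1)) (det_normals k 3)"
    by (rule hess) (rule H)
  have comb: "a *\<^sub>R hessian ?c J ?p + b *\<^sub>R hessian ?c H ?p =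
      ?Q (det_normals 1 (k+1) * a + det_normals 3 (k+1) * b) (det_normals k 1 * a + det_normals k 3 * b)" for a b :: real
    unfolding hJ hH by (simp add: vec_eq_iff algebra_simps)
  have indep: "a = 0 \<and> b = 0" if "a *\<^sub>R hessian ?c J ?p + b *\<^sub>R hessian ?c H ?p = 0" for a b :: real
  proof (rule coefficients_eq_0)
    have "?Q (det_normals 1 (k+1) * a + det_normals 3 (k+1) * b) (det_normals k 1 * a + det_normals k 3 * b) $ i $ i = (0 :: real^4^4) $ i $ i" for i
      using that unfolding comb by (simp only:)
    from this[of 1] this[of 3]
    show "det_normals 1 (k+1) * a + det_normals 3 (k+1) * b = 0" "det_normals k 1 * a + det_normals k 3 * b = 0"
      by (simp_all add: coord_axis inner_complex_def)
  qed
  \<comment> \<open>the solution of the two equations below, by the inverse of the unimodular coefficient matrix\<close>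
  define a b where "a = real_of_int (det_normals k 3 - 2 * det_normals 3 (k+1))"
    and "b = real_of_int (2 * det_normals 1 (k+1) - det_normals k 1)"
  have ab: "det_normals 1 (k+1) * a + det_normals 3 (k+1) * b = 1" "det_normals k 1 * a + det_normals k 3 * b = 2"
  proof -
    have "det_normals 1 (k+1) * (det_normals k 3 - 2 * det_normals 3 (k+1)) +
        det_normals 3 (k+1) * (2 * det_normals 1 (k+1) - det_normals k 1) = 1"
      "det_normals k 1 * (det_normals k 3 - 2 * det_normals 3 (k+1)) +
        det_normals k 3 * (2 * det_normals 1 (k+1) - det_normals k 1) = 2"
      using det_normals_J_H[of k] by algebra+
    then show "det_normals 1 (k+1) * a + det_normals 3 (k+1) * b = 1" "det_normals k 1 * a + det_normals k 3 * b = 2"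
      unfolding a_def b_def of_int_mult[symmetric] of_int_add[symmetric] by simp_all
  qed
  define \<Omega> :: "real^4^4" where "\<Omega> = (\<chi> i j. std_form (axis i 1) (axis j 1))"
  have "form_matrix M ?c ?p = \<Omega>"
    by (simp add: form_matrix_def form_vertex_chart[OF vertex_point(1)] \<Omega>_def)
  then have "linearization M ?c J H ?p a b =
      a *\<^sub>R (- \<Omega> ** hessian ?c J ?p) + b *\<^sub>R (- \<Omega> ** hessian ?c H ?p)"
    by (simp only: linearization_def matrix_inv_std_form[OF \<Omega>_def])
  also have "\<dots> = - \<Omega> ** (a *\<^sub>R hessian ?c J ?p + b *\<^sub>R hessian ?c H ?p)"
    by (simp add: vec_eq_iff matrix_matrix_mult_def sum_4 algebra_simps)
  also have "\<dots> = - \<Omega> ** ?Q 1 2" by (simp only: comb ab)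
  finally have lin: "linearization M ?c J H ?p a b = - \<Omega> ** ?Q 1 2" .
  have "\<forall>i j. (- \<Omega> ** ?Q 1 2) $i$j = (if i = 1 \<and> j = 2 then 1 else if i = 2 \<and> j = 1 then - 1
     else if i = 3 \<and> j = 4 then 2 else if i = 4 \<and> j = 3 then - 2 else 0)"
    unfolding \<Omega>_def by (simp add: forall_4 matrix_matrix_mult_def sum_4 std_form_def coord_axis inner_complex_def)
  then have ev: "complex_eigenvalues (linearization M ?c J H ?p a b) =
      {\<i> * of_real 1, - \<i> * of_real 1, \<i> * of_real 2, - \<i> * of_real 2}"
    unfolding lin by (intro complex_eigenvalues_rotations) blast
  have "card {\<i> * of_real 1, - \<i> * of_real 1, \<i> * of_real 2, - \<i> * of_real 2} = 4"
    by (simp add: complex_eq_iff)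
  then have "card (complex_eigenvalues (linearization M ?c J H ?p a b)) = 4" unfolding ev .
  moreover have "(1::real) \<noteq> 0" "(2::real) \<noteq> 0" "(1::real) \<noteq> 2" by simp_all
  moreover have "system_rank M ?c J H ?p = 0"
    using rank_0_iff[of J H, OF J H vertex_chart_at[OF vertex_point(1)] vertex_point(1)] vertex_point(2)
    by blast
  ultimately show ?thesis
    unfolding elliptic_elliptic_def using vertex_chart_at[OF vertex_point(1)] indep ev by blast
qed

lemma elliptic_elliptic_iff:
  "p \<in> points M \<and> elliptic_elliptic M J H p \<longleftrightarrow> p \<in> range vertex_point"
proof
  assume p: "p \<in> points M \<and> elliptic_elliptic M J H p"
  then obtain k where k: "p \<in> vertex_domain k" using M_cover by blast
  obtain c where "chart_at M p c" "system_rank M c J H p = 0"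
    using p unfolding elliptic_elliptic_def by blast
  then have "p = vertex_point k"
    using rank_0_iff[of J H, OF J H _ k] by (intro vertex_pointI k) blast
  then show "p \<in> range vertex_point" by blast
next
  assume "p \<in> range vertex_point"
  then show "p \<in> points M \<and> elliptic_elliptic M J H p"
    using elliptic_elliptic_vertex_point vertex_domain_points vertex_point(1) by blast
qed

lemma card_elliptic_elliptic: "card {p \<in> points M. elliptic_elliptic M J H p} = 8"
proof -
  have "{p \<in> points M. elliptic_elliptic M J H p} = range vertex_point"
    using elliptic_elliptic_iff by blast
  then show ?thesis by (simp add: card_image[OF inj_vertex_point])
qed

end

theorem theorem1p1:
  fixes J H :: "(complex^8) set \<Rightarrow> real"
  assumes "\<And>z. z \<in> W \<Longrightarrow> J (\<tau> z) = 1/2 * (cmod (z$1))\<^sup>2"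
    and "\<And>z. z \<in> W \<Longrightarrow> H (\<tau> z) = 1/2 * (cmod (z$3))\<^sup>2"
  shows "(\<exists>\<rho>. hamiltonian_torus2_action M \<rho> (\<lambda>p. (J p, H p)) \<and> effective_action M \<rho>) \<and>
    (\<lambda>p. (J p, H p)) ` points M = octagon \<and>
    completely_integrable M J H \<and>
    card {p \<in> points M. elliptic_elliptic M J H p} = 8"
proof (intro conjI)
  have "hamiltonian_torus2_action M torus_act (\<lambda>p. (J p, H p))"
    unfolding hamiltonian_torus2_action_def
    using torus2_action_torus_act smooth_action_torus_act preserves_form_torus_act
      momentum_map_torus_act[OF assms] by blast
  then show "\<exists>\<rho>. hamiltonian_torus2_action M \<rho> (\<lambda>p. (J p, H p)) \<and> effective_action M \<rho>"
    using effective_action_torus_act by blast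
  show "(\<lambda>p. (J p, H p)) ` points M = octagon" by (rule image_eq_octagon[OF assms])
  show "completely_integrable M J H" by (rule completely_integrable_J_H[OF assms])
  show "card {p \<in> points M. elliptic_elliptic M J H p} = 8" by (rule card_elliptic_elliptic[OF assms])
qed

end
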